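(* Let $(\mathcal{A},\mathcal{A}',\mathcal{A}'')$ be a triple of complex hyperplane arrangements with complements $M=M(\mathcal{A})$, $M'=M(\mathcal{A}')$, $M''=M(\mathcal{A}'')$, and let $(\mathcal{L},\mathcal{L}',\mathcal{L}'')$ be a triple of complex rank one local systems on $(M,M',M'')$. Then there is a long exact sequence in local system cohomology $$\cdots \to H^{q}(M';\mathcal{L}') \to H^{q}(M;\mathcal{L}) \to H^{q-1}(M'';\mathcal{L}'') \to H^{q+1}(M';\mathcal{L}') \to \cdots$$
   Context: A hyperplane arrangement $\mathcal{A}$ in $\mathbb{C}^\ell$ is a finite collection of (affine) complex hyperplanes; its complement is $M(\mathcal{A})=\mathbb{C}^\ell\setminus\bigcup_{K\in\mathcal{A}}K$. Choosing a distinguished hyperplane $H\in\mathcal{A}$ gives a triple of arrangements $(\mathcal{A},\mathcal{A}',\mathcal{A}'')$, where $\mathcal{A}'=\mathcal{A}\setminus\{H\}$ is an arrangement in $\mathbb{C}^\ell$ and $\mathcal{A}''$ is the arrangement in $H\cong\mathbb{C}^{\ell-1}$ with hyperplanes $\{K\cap H\mid K\in\mathcal{A}'\}$ (empty intersections being disregarded). Their complements satisfy $M=M'\setminus(M'\cap H)$ and $M''=M'\cap H$. Let $i:M\to M'$ and $j:M''\to M'$ be the natural inclusions. A triple of local systems $(\mathcal{L},\mathcal{L}',\mathcal{L}'')$ on $(M,M',M'')$ consists of a local system $\mathcal{L}'$ on $M'$ together with the induced local systems $\mathcal{L}=i^*\mathcal{L}'$ on $M$ (which has trivial monodromy about $H$)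 and $\mathcal{L}''=j^*\mathcal{L}'$ on $M''$. *)

theory Defs
  imports "HOL-Analysis.Analysis" "HOL-Homology.Homology" "HOL-Algebra.Exact_Sequence"
begin

subsection \<open>Triples of complex hyperplane arrangements\<close>

definition complex_hyperplane :: "(complex ^ 'n) set \<Rightarrow> bool" where
  "complex_hyperplane K \<longleftrightarrow> (\<exists>a b. a \<noteq> 0 \<and> K = {x. (\<Sum>i\<in>UNIV. a $ i * x $ i) = b})"

definition hyperplane_arrangement :: "(complex ^ 'n) set set \<Rightarrow> bool" where
  "hyperplane_arrangement \<A> \<longleftrightarrow> finite \<A> \<and> (\<forall>K\<in>\<A>. complex_hyperplane K)"

text \<open>The restricted arrangement \<open>\<A>''\<close> lives in the affine space \<open>H\<close> itself; no coordinates
  on \<open>H\<close> are chosen.\<close>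

definition arrangement_triple ::
  "(complex ^ 'n) set \<Rightarrow> (complex ^ 'n) set set \<Rightarrow> (complex ^ 'n) set set \<Rightarrow> (complex ^ 'n) set set \<Rightarrow> bool"
  where
  "arrangement_triple H \<A> \<A>' \<A>'' \<longleftrightarrow>
     hyperplane_arrangement \<A> \<and> H \<in> \<A> \<and> \<A>' = \<A> - {H} \<and>
     \<A>'' = {K \<inter> H | K. K \<in> \<A>' \<and> K \<inter> H \<noteq> {}}"

definition complement_in :: "'a set \<Rightarrow> 'a set set \<Rightarrow> 'a set" where
  "complement_in E \<A> = E - \<Union>\<A>"


subsection \<open>Local systems of complex vector spaces\<close>

text \<open>A local system on \<open>S\<close> is a functor from the fundamental groupoid of \<open>S\<close> to complex vector
  spaces. The fibres are subspaces of a complex vector space \<open>'v\<close> with scalar multiplication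
  \<open>sc\<close>; they may vary from point to point. A path \<open>g\<close> acts from the fibre over its start to
  the fibre over its finish. Invertibility of the transport follows from functoriality.\<close>

record ('a, 'v) local_system =
  fibre :: "'a \<Rightarrow> 'v set"
  transport :: "(real \<Rightarrow> 'a) \<Rightarrow> 'v \<Rightarrow> 'v"

definition is_local_system ::
  "(complex \<Rightarrow> 'v::ab_group_add \<Rightarrow> 'v) \<Rightarrow> 'a::topological_space set \<Rightarrow> ('a, 'v) local_system \<Rightarrow> bool"
  where
  "is_local_system sc S L \<longleftrightarrow>
     (\<forall>x\<in>S. module.subspace sc (fibre L x)) \<and>
     (\<forall>g. path g \<and> path_image g \<subseteq> S \<longrightarrow>
        transport L g ` fibre L (pathstart g) \<subseteq> fibre L (pathfinish g) \<and>
        (\<forall>v\<in>fibre L (pathstart g). \<forall>w\<in>fibre L (pathstart g).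
           transport L g (v + w) = transport L g v + transport L g w) \<and>
        (\<forall>a. \<forall>v\<in>fibre L (pathstart g). transport L g (sc a v) = sc a (transport L g v))) \<and>
     (\<forall>x\<in>S. \<forall>v\<in>fibre L x. transport L (\<lambda>_. x) v = v) \<and>
     (\<forall>g h. path g \<and> path_image g \<subseteq> S \<and> path h \<and> path_image h \<subseteq> S \<and> pathfinish g = pathstart h \<longrightarrow>
        (\<forall>v\<in>fibre L (pathstart g). transport L (g +++ h) v = transport L h (transport L g v))) \<and>
     (\<forall>g h. homotopic_paths S g h \<longrightarrow>
        (\<forall>v\<in>fibre L (pathstart g). transport L g v = transport L h v))"

definition rank_one_local_system ::
  "(complex \<Rightarrow> 'v::ab_group_add \<Rightarrow> 'v) \<Rightarrow> 'a::topological_space set \<Rightarrow> ('a, 'v) local_system \<Rightarrow> bool"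
  where
  "rank_one_local_system sc S L \<longleftrightarrow>
     is_local_system sc S L \<and> (\<forall>x\<in>S. vector_space.dim sc (fibre L x) = 1)"

definition pullback_system :: "('b \<Rightarrow> 'a) \<Rightarrow> ('a, 'v) local_system \<Rightarrow> ('b, 'v) local_system" where
  "pullback_system f L = \<lparr>fibre = (\<lambda>x. fibre L (f x)), transport = (\<lambda>g. transport L (f \<circ> g))\<rparr>"


subsection \<open>Singular cochains with local coefficients\<close>

text \<open>A \<open>q\<close>-cochain assigns to each singular \<open>q\<close>-simplex an element of the fibre over its leading
  vertex. Cochains vanish on everything that is not a singular \<open>q\<close>-simplex of the space, so
  for \<open>q < 0\<close> only the zero cochain remains.\<close>

type_synonym ('a, 'v) cochain = "((nat \<Rightarrow> real) \<Rightarrow> 'a) \<Rightarrow> 'v"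

definition simplex_of_degree :: "int \<Rightarrow> 'a::topological_space set \<Rightarrow> ((nat \<Rightarrow> real) \<Rightarrow> 'a) \<Rightarrow> bool" where
  "simplex_of_degree q S \<sigma> \<longleftrightarrow> 0 \<le> q \<and> singular_simplex (nat q) (top_of_set S) \<sigma>"

definition leading_vertex :: "((nat \<Rightarrow> real) \<Rightarrow> 'a) \<Rightarrow> 'a" where
  "leading_vertex \<sigma> = \<sigma> (\<lambda>i. if i = 0 then 1 else 0)"

text \<open>The edge from vertex \<open>0\<close> to vertex \<open>1\<close>.\<close>

definition leading_edge :: "((nat \<Rightarrow> real) \<Rightarrow> 'a) \<Rightarrow> real \<Rightarrow> 'a" where
  "leading_edge \<sigma> t = \<sigma> (\<lambda>i. if i = 0 then 1 - t else if i = 1 then t else 0)"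

definition cochains ::
  "'a::topological_space set \<Rightarrow> ('a, 'v::ab_group_add) local_system \<Rightarrow> int \<Rightarrow> ('a, 'v) cochain set" where
  "cochains S L q =
     {c. \<forall>\<sigma>. if simplex_of_degree q S \<sigma> then c \<sigma> \<in> fibre L (leading_vertex \<sigma>) else c \<sigma> = 0}"

text \<open>The leading vertex of the \<open>0\<close>-th face is vertex \<open>1\<close> of the simplex, so the corresponding term is
  transported back to the fibre over vertex \<open>0\<close>. All other faces share the leading vertex.\<close>

definition coboundary ::
  "(complex \<Rightarrow> 'v::ab_group_add \<Rightarrow> 'v) \<Rightarrow> 'a::topological_space set \<Rightarrow> ('a, 'v) local_system \<Rightarrow> int \<Rightarrow>
    ('a, 'v) cochain \<Rightarrow> ('a, 'v) cochain" where
  "coboundary sc S L q c = (\<lambda>\<sigma>.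
     if 0 \<le> q \<and> simplex_of_degree (q + 1) S \<sigma>
     then transport L (reversepath (leading_edge \<sigma>)) (c (singular_face (nat (q + 1)) 0 \<sigma>)) +
          (\<Sum>k = 1..nat (q + 1). sc ((- 1) ^ k) (c (singular_face (nat (q + 1)) k \<sigma>)))
     else 0)"

definition cocycles ::
  "(complex \<Rightarrow> 'v::ab_group_add \<Rightarrow> 'v) \<Rightarrow> 'a::topological_space set \<Rightarrow> ('a, 'v) local_system \<Rightarrow> int \<Rightarrow>
    ('a, 'v) cochain set" where
  "cocycles sc S L q = {c \<in> cochains S L q. coboundary sc S L q c = (\<lambda>_. 0)}"

definition coboundaries ::
  "(complex \<Rightarrow> 'v::ab_group_add \<Rightarrow> 'v) \<Rightarrow> 'a::topological_space set \<Rightarrow> ('a, 'v) local_system \<Rightarrow> int \<Rightarrow>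
    ('a, 'v) cochain set" where
  "coboundaries sc S L q = coboundary sc S L (q - 1) ` cochains S L (q - 1)"


subsection \<open>Local system cohomology\<close>

text \<open>Modules are the records of \<open>HOL-Algebra\<close>, whose inherited ring multiplication plays no role.\<close>

definition quotient_module :: "('c, 'b) module \<Rightarrow> 'b set \<Rightarrow> ('c, 'b set) module" where
  "quotient_module V N =
     \<lparr>carrier = a_rcosets\<^bsub>V\<^esub> N, mult = undefined, one = undefined,
      zero = N, add = set_add V,
      smult = (\<lambda>a X. \<Union>x\<in>X. N +>\<^bsub>V\<^esub> (a \<odot>\<^bsub>V\<^esub> x))\<rparr>"

definition cocycle_module ::
  "(complex \<Rightarrow> 'v::ab_group_add \<Rightarrow> 'v) \<Rightarrow> 'a::topological_space set \<Rightarrow> ('a, 'v) local_system \<Rightarrow> int \<Rightarrow>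
    (complex, ('a, 'v) cochain) module" where
  "cocycle_module sc S L q =
     \<lparr>carrier = cocycles sc S L q, mult = undefined, one = undefined,
      zero = (\<lambda>_. 0), add = (\<lambda>c d \<sigma>. c \<sigma> + d \<sigma>), smult = (\<lambda>a c \<sigma>. sc a (c \<sigma>))\<rparr>"

definition cohomology ::
  "(complex \<Rightarrow> 'v::ab_group_add \<Rightarrow> 'v) \<Rightarrow> int \<Rightarrow> 'a::topological_space set \<Rightarrow> ('a, 'v) local_system \<Rightarrow>
    (complex, ('a, 'v) cochain set) module" where
  "cohomology sc q S L =
     quotient_module (cocycle_module sc S L q) (coboundaries sc S L q)"

definition pullback_cochain ::
  "('b \<Rightarrow> 'a) \<Rightarrow> int \<Rightarrow> 'b::topological_space set \<Rightarrow> ('a, 'v::zero) cochain \<Rightarrow> ('b, 'v) cochain" where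
  "pullback_cochain f q S c =
     (\<lambda>\<sigma>. if simplex_of_degree q S \<sigma> then c (simplex_map (nat q) f \<sigma>) else 0)"

text \<open>For continuous \<open>f\<close> from \<open>S\<close> to \<open>T\<close> and \<open>L\<close> a local system on \<open>T\<close>, this is the map from
  \<open>cohomology sc q T L\<close> to \<open>cohomology sc q S (pullback_system f L)\<close>; the union is over the
  representatives of a class.\<close>

definition cohomology_induced ::
  "(complex \<Rightarrow> 'v::ab_group_add \<Rightarrow> 'v) \<Rightarrow> int \<Rightarrow> 'b::topological_space set \<Rightarrow> ('b \<Rightarrow> 'a) \<Rightarrow>
    ('a, 'v) local_system \<Rightarrow> ('a, 'v) cochain set \<Rightarrow> ('b, 'v) cochain set" where
  "cohomology_induced sc q S f L X =
     (\<Union>c\<in>X. coboundaries sc S (pullback_system f L) q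
        +>\<^bsub>cocycle_module sc S (pullback_system f L) q\<^esub> pullback_cochain f q S c)"

text \<open>\<open>add_monoid\<close> keeps the scalar multiplication as a record extension, whereas \<open>exact_seq\<close>
  expects plain monoid records.\<close>

definition additive_group :: "('c, 'a) module \<Rightarrow> 'a monoid" where
  "additive_group V = \<lparr>carrier = carrier V, monoid.mult = add V, one = zero V\<rparr>"

definition linear_maps :: "('c, 'a) module \<Rightarrow> ('c, 'b) module \<Rightarrow> ('a \<Rightarrow> 'b) set" where
  "linear_maps V W =
     {f \<in> hom (additive_group V) (additive_group W).
        \<forall>a. \<forall>x\<in>carrier V. f (a \<odot>\<^bsub>V\<^esub> x) = a \<odot>\<^bsub>W\<^esub> f x}"

end

theory Submission
  imports Defs "HOL-Library.Function_Algebras"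
begin

text \<open>
  The long exact sequence of the pair \<open>(M', M)\<close> reduces the theorem to an isomorphism between
  \<open>H\<^sup>q\<^sup>+\<^sup>1(M', M)\<close> and \<open>H\<^sup>q\<^sup>-\<^sup>1(M'')\<close> with coefficients in \<open>L'\<close>.
  Choose a complex line transversal to \<open>H\<close>; the points of \<open>M'\<close> in small discs of this direction around
  \<open>M''\<close> form an open tube \<open>U\<close>. Write \<open>U\<^sub>C\<close> for the part of \<open>U\<close> whose fibre coordinate lies in \<open>C\<close>.
  Fibrewise linear contractions show that the pairs \<open>(U, U\<^sub>C)\<close> with \<open>C\<close> a slit plane, a quadrant or the origin,
  and \<open>(U\<^sub>R, U\<^sub>Q)\<close> with \<open>Q\<close> a quadrant of the right half plane \<open>R\<close>, have no relative cohomology.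
  Two connecting homomorphisms, each lowering the degree by one, together with excision and restriction, lead from
  \<open>(M', M)\<close> via \<open>(U, U\<^sub>C)\<close> for the punctured plane \<open>C\<close> and \<open>(U\<^sub>R, U\<^sub>Q \<union> U\<^sub>Q\<^sub>')\<close> to \<open>U\<^sub>Q\<close> and
  hence to \<open>M''\<close>. A local system becomes trivial on every convex model, so the chain-level constructions
  for integral singular homology act on cochains with local coefficients; all spaces are treated as families of
  simplices in \<open>M'\<close>, which keeps a single local system throughout.
\<close>

subsection \<open>Transport and evaluation of cochains on models\<close>

text \<open>The shift from \<open>q - 1\<close> to \<open>q + 1\<close> reflects that the cohomology
  of a plane relative to the punctured plane sits in degree two. Instead of a product with a Thom
  class, each of the two degrees comes from a triple whose outer pair is acyclic: slit plane,
  punctured plane, plane; and one quadrant, both quadrants, right half plane. This needs nothing but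
  fibrewise contractions and excision, uniformly over the base. Since \<open>\<L>'\<close> is
  defined on all of \<open>M'\<close>, the tube carries it as well, and monodromy about
  \<open>H\<close> never has to be discussed. The obstacle is that the values of a cochain on
  different simplices lie in different fibres. Moving them all to one base point of a convex model
  makes evaluation on integral chains meaningful and gives a Stokes formula; a primitive of a
  cocycle is then its evaluation on a prism or on a subdivision homotopy. Isomorphisms of cohomology
  are kept as linear relations between cocycles. Extensions and primitives therefore need not be
  selected, and inverses and composites come for free.\<close>

abbreviation vertex :: "nat \<Rightarrow> nat \<Rightarrow> real" where
  "vertex k \<equiv> (\<lambda>i. if i = k then 1 else 0)"

definition identity_simplex :: "nat \<Rightarrow> (nat \<Rightarrow> real) \<Rightarrow> nat \<Rightarrow> real" where
  "identity_simplex p = restrict id (standard_simplex p)"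

definition segment_path :: "(nat \<Rightarrow> real) \<Rightarrow> (nat \<Rightarrow> real) \<Rightarrow> real \<Rightarrow> nat \<Rightarrow> real" where
  "segment_path x y t = (\<lambda>i. (1 - t) * x i + t * y i)"

text \<open>The function space \<open>nat \<Rightarrow> real\<close> is not an instance of \<open>real_vector\<close>, so \<open>convex\<close> is unavailable.\<close>

definition segment_closed :: "(nat \<Rightarrow> real) set \<Rightarrow> bool" where
  "segment_closed Y \<longleftrightarrow> (\<forall>x\<in>Y. \<forall>y\<in>Y. \<forall>t\<in>{0..1}. segment_path x y t \<in> Y)"

lemma segment_path_ends [simp]: "segment_path x y 0 = x" "segment_path x y 1 = y"
  by (auto simp: segment_path_def)

lemma segment_path_same [simp]: "segment_path x x t = x"
  by (auto simp: segment_path_def algebra_simps)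

lemma segment_closed_simplex: "segment_closed (standard_simplex p)"
  unfolding segment_closed_def segment_path_def using convex_standard_simplex by auto

lemma continuous_on_fun_iff:
  fixes f :: "'a::topological_space \<Rightarrow> 'i \<Rightarrow> 'b::topological_space"
  shows "continuous_on A f \<longleftrightarrow> (\<forall>i. continuous_on A (\<lambda>x. f x i))"
  by (metis continuous_on_coordinatewise_then_product continuous_on_product_then_coordinatewise)

lemma path_segment: "path (segment_path x y)"
  unfolding path_def segment_path_def
  by (intro continuous_on_coordinatewise_then_product continuous_intros)

lemma path_image_segment:
  "segment_closed Y \<Longrightarrow> x \<in> Y \<Longrightarrow> y \<in> Y \<Longrightarrow> path_image (segment_path x y) \<subseteq> Y"
  by (auto simp: path_image_def segment_closed_def)

lemma pathstart_segment [simp]: "pathstart (segment_path x y) = x"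
  and pathfinish_segment [simp]: "pathfinish (segment_path x y) = y"
  by (auto simp: pathstart_def pathfinish_def)

text \<open>The straight-line homotopy from \<open>g\<close> to \<open>h\<close> stays in
  \<open>Y\<close>, and where the two paths agree its track is constant, so the end points stay
  fixed.\<close>

lemma homotopic_paths_segment_closed:
  assumes Y: "segment_closed Y" and g: "path g" "path_image g \<subseteq> Y" and h: "path h" "path_image h \<subseteq> Y"
    and ends: "pathstart g = pathstart h" "pathfinish g = pathfinish h"
  shows "homotopic_paths Y g h"
proof -
  define F where "F = (\<lambda>z::real\<times>real. segment_path (g (snd z)) (h (snd z)) (fst z))"
  have sub: "snd ` ({0..1::real} \<times> {0..1::real}) \<subseteq> {0..1}" by auto
  have cg: "continuous_on ({0..1} \<times> {0..1}) (\<lambda>z::real\<times>real. g (snd z))"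
    and ch: "continuous_on ({0..1} \<times> {0..1}) (\<lambda>z::real\<times>real. h (snd z))"
    using g(1) h(1) sub unfolding path_def
    by (auto intro: continuous_on_compose2[OF _ continuous_on_snd[OF continuous_on_id] sub])
  have "continuous_on ({0..1} \<times> {0..1}) F"
    unfolding F_def segment_path_def
    using cg[unfolded continuous_on_fun_iff] ch[unfolded continuous_on_fun_iff]
    by (intro continuous_on_coordinatewise_then_product) (auto intro!: continuous_intros)
  moreover have "F \<in> {0..1} \<times> {0..1} \<rightarrow> Y"
    using Y g(2) h(2) by (auto simp: F_def segment_closed_def path_image_def image_subset_iff)
  moreover have "F (t, 0) = pathstart g" "F (t, 1) = pathfinish g" for t
    using ends by (auto simp: F_def pathstart_def pathfinish_def)
  ultimately show ?thesis
    unfolding homotopic_paths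
    by (intro exI[of _ F]) (auto simp: F_def pathstart_def pathfinish_def)
qed

lemma singular_simplex_top_of_set:
  "singular_simplex p (top_of_set Y) f \<longleftrightarrow>
     continuous_on (standard_simplex p) f \<and> f ` standard_simplex p \<subseteq> Y \<and> f \<in> extensional (standard_simplex p)"
  by (auto simp: singular_simplex_def euclidean_product_topology continuous_map_in_subtopology)

lemma identity_simplex_apply [simp]: "x \<in> standard_simplex p \<Longrightarrow> identity_simplex p x = x"
  by (simp add: identity_simplex_def)

lemma simplicial_identity_simplex [simp]:
  "simplicial_simplex p Y (identity_simplex p) \<longleftrightarrow> standard_simplex p \<subseteq> Y"
  unfolding identity_simplex_def by (rule simplicial_simplex_id)

lemma identity_simplex: "standard_simplex p \<subseteq> Y \<Longrightarrow> singular_simplex p (top_of_set Y) (identity_simplex p)"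
  using simplicial_imp_singular_simplex[of p Y "identity_simplex p"] by (simp add: euclidean_product_topology)

lemma simplex_map_identity:
  "singular_simplex p X f \<Longrightarrow> simplex_map p f (identity_simplex p) = f"
  by (auto simp: simplex_map_def singular_simplex_def extensional_def fun_eq_iff)

text \<open>Only the \<open>0\<close>-th face changes the leading vertex, which is why the twisted
  coboundary has exactly one transported term.\<close>

lemma simplical_face_vertex_0: "simplical_face k (vertex 0) = (if k = 0 then vertex 1 else vertex 0)"
  by (auto simp: simplical_face_def fun_eq_iff)

lemma continuous_on_simplical_face: "continuous_on A (simplical_face k :: (nat \<Rightarrow> real) \<Rightarrow> _)"
proof (rule continuous_on_coordinatewise_then_product)
  show "continuous_on A (\<lambda>x::nat \<Rightarrow> real. simplical_face k x i)" for i
    unfolding simplical_face_def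
    by (cases "i < k"; cases "i = k") (auto intro: continuous_on_subset[OF continuous_on_product_coordinates])
qed

lemma simplical_face_maps: "k \<le> Suc q \<Longrightarrow> x \<in> standard_simplex q \<Longrightarrow> simplical_face k x \<in> standard_simplex (Suc q)"
  using simplical_face_in_standard_simplex[of "Suc q" k x] by simp


section \<open>Transport over convex models\<close>

locale coefficient_system = vector_space sc
  for sc :: "complex \<Rightarrow> 'v::ab_group_add \<Rightarrow> 'v" +
  fixes S :: "'a::topological_space set" and L :: "('a, 'v) local_system"
  assumes local_system: "is_local_system sc S L"
begin

lemma fibre_subspace: "x \<in> S \<Longrightarrow> subspace (fibre L x)"
  using local_system by (auto simp: is_local_system_def)

lemma fibre_0 [simp]: "x \<in> S \<Longrightarrow> 0 \<in> fibre L x"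
  and fibre_add: "x \<in> S \<Longrightarrow> v \<in> fibre L x \<Longrightarrow> w \<in> fibre L x \<Longrightarrow> v + w \<in> fibre L x"
  and fibre_diff: "x \<in> S \<Longrightarrow> v \<in> fibre L x \<Longrightarrow> w \<in> fibre L x \<Longrightarrow> v - w \<in> fibre L x"
  and fibre_scale: "x \<in> S \<Longrightarrow> v \<in> fibre L x \<Longrightarrow> sc a v \<in> fibre L x"
  and fibre_sum: "x \<in> S \<Longrightarrow> (\<And>i. i \<in> I \<Longrightarrow> f i \<in> fibre L x) \<Longrightarrow> sum f I \<in> fibre L x"
  using fibre_subspace
  by (auto intro: subspace_0 subspace_add subspace_diff subspace_scale subspace_sum)

lemma
  assumes "path g" "path_image g \<subseteq> S"
  shows transport_in: "v \<in> fibre L (pathstart g) \<Longrightarrow> transport L g v \<in> fibre L (pathfinish g)"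
    and transport_add: "v \<in> fibre L (pathstart g) \<Longrightarrow> w \<in> fibre L (pathstart g) \<Longrightarrow>
       transport L g (v + w) = transport L g v + transport L g w"
    and transport_scale: "v \<in> fibre L (pathstart g) \<Longrightarrow> transport L g (sc a v) = sc a (transport L g v)"
  using local_system assms unfolding is_local_system_def by blast+

lemma transport_const: "x \<in> S \<Longrightarrow> v \<in> fibre L x \<Longrightarrow> transport L (\<lambda>_. x) v = v"
  using local_system unfolding is_local_system_def by blast

lemma transport_join:
  "\<lbrakk>path g; path_image g \<subseteq> S; path h; path_image h \<subseteq> S; pathfinish g = pathstart h; v \<in> fibre L (pathstart g)\<rbrakk>
    \<Longrightarrow> transport L (g +++ h) v = transport L h (transport L g v)"
  using local_system unfolding is_local_system_def by blast

lemma transport_homotopic: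
  "homotopic_paths S g h \<Longrightarrow> v \<in> fibre L (pathstart g) \<Longrightarrow> transport L g v = transport L h v"
  using local_system unfolding is_local_system_def by blast

text \<open>\<open>Y\<close> is a convex parameter domain such as a simplex or a cylinder, and
  \<open>\<Sigma>\<close> need not be injective. Pulled back along \<open>\<Sigma>\<close>, the
  local system has path-independent transport between any two points of \<open>Y\<close>.\<close>

definition model_map :: "(nat \<Rightarrow> real) set \<Rightarrow> ((nat \<Rightarrow> real) \<Rightarrow> 'a) \<Rightarrow> bool" where
  "model_map Y \<Sigma> \<longleftrightarrow> segment_closed Y \<and> continuous_on Y \<Sigma> \<and> \<Sigma> ` Y \<subseteq> S"

definition segment_transport :: "((nat \<Rightarrow> real) \<Rightarrow> 'a) \<Rightarrow> (nat \<Rightarrow> real) \<Rightarrow> (nat \<Rightarrow> real) \<Rightarrow> 'v \<Rightarrow> 'v" where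
  "segment_transport \<Sigma> x y = transport L (\<Sigma> \<circ> segment_path x y)"

lemma model_map_in: "model_map Y \<Sigma> \<Longrightarrow> x \<in> Y \<Longrightarrow> \<Sigma> x \<in> S"
  by (auto simp: model_map_def)

lemma model_path:
  assumes "model_map Y \<Sigma>" "path g" "path_image g \<subseteq> Y"
  shows "path (\<Sigma> \<circ> g)" "path_image (\<Sigma> \<circ> g) \<subseteq> S"
  using assms by (auto simp: model_map_def path_image_compose image_subset_iff
      intro!: path_continuous_image intro: continuous_on_subset)

text \<open>Paths in \<open>Y\<close> with common ends are homotopic there, and
  \<open>\<Sigma>\<close> carries the homotopy into \<open>S\<close>.\<close>

lemma transport_model_eq:
  assumes "model_map Y \<Sigma>" "path g" "path_image g \<subseteq> Y" "path h" "path_image h \<subseteq> Y"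
    "pathstart g = pathstart h" "pathfinish g = pathfinish h" "v \<in> fibre L (\<Sigma> (pathstart g))"
  shows "transport L (\<Sigma> \<circ> g) v = transport L (\<Sigma> \<circ> h) v"
proof -
  have "homotopic_paths Y g h"
    using assms by (intro homotopic_paths_segment_closed) (auto simp: model_map_def)
  then have "homotopic_paths S (\<Sigma> \<circ> g) (\<Sigma> \<circ> h)"
    using assms(1) by (intro homotopic_paths_continuous_image) (auto simp: model_map_def)
  then show ?thesis
    using assms(8) by (intro transport_homotopic) (auto simp: pathstart_compose)
qed

lemma
  assumes M: "model_map Y \<Sigma>" and xy: "x \<in> Y" "y \<in> Y"
  shows segment_transport_in: "v \<in> fibre L (\<Sigma> x) \<Longrightarrow> segment_transport \<Sigma> x y v \<in> fibre L (\<Sigma> y)"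
    and segment_transport_add: "v \<in> fibre L (\<Sigma> x) \<Longrightarrow> w \<in> fibre L (\<Sigma> x) \<Longrightarrow>
          segment_transport \<Sigma> x y (v + w) = segment_transport \<Sigma> x y v + segment_transport \<Sigma> x y w"
    and segment_transport_scale: "v \<in> fibre L (\<Sigma> x) \<Longrightarrow>
          segment_transport \<Sigma> x y (sc a v) = sc a (segment_transport \<Sigma> x y v)"
proof -
  have g: "path_image (segment_path x y) \<subseteq> Y"
    using M xy by (intro path_image_segment) (auto simp: model_map_def)
  note p = model_path[OF M path_segment g]
  show "v \<in> fibre L (\<Sigma> x) \<Longrightarrow> segment_transport \<Sigma> x y v \<in> fibre L (\<Sigma> y)"
    using transport_in[OF p] by (simp add: segment_transport_def pathstart_compose pathfinish_compose)
  show "v \<in> fibre L (\<Sigma> x) \<Longrightarrow> w \<in> fibre L (\<Sigma> x) \<Longrightarrow>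
          segment_transport \<Sigma> x y (v + w) = segment_transport \<Sigma> x y v + segment_transport \<Sigma> x y w"
    using transport_add[OF p] by (simp add: segment_transport_def pathstart_compose)
  show "v \<in> fibre L (\<Sigma> x) \<Longrightarrow> segment_transport \<Sigma> x y (sc a v) = sc a (segment_transport \<Sigma> x y v)"
    using transport_scale[OF p] by (simp add: segment_transport_def pathstart_compose)
qed

lemma segment_transport_0:
  assumes "model_map Y \<Sigma>" "x \<in> Y" "y \<in> Y"
  shows "segment_transport \<Sigma> x y 0 = 0"
  using segment_transport_scale[OF assms fibre_0[OF model_map_in[OF assms(1,2)]], of 0] by simp

lemma segment_transport_sum:
  assumes "model_map Y \<Sigma>" "x \<in> Y" "y \<in> Y" "\<And>i. i \<in> I \<Longrightarrow> f i \<in> fibre L (\<Sigma> x)"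
  shows "segment_transport \<Sigma> x y (sum f I) = (\<Sum>i\<in>I. segment_transport \<Sigma> x y (f i))"
  using assms(4)
proof (induction I rule: infinite_finite_induct)
  case (insert i I)
  then show ?case
    using assms(1,2,3) fibre_sum[of "\<Sigma> x" I f] model_map_in[OF assms(1,2)]
    by (simp add: segment_transport_add)
qed (use assms in \<open>auto simp: segment_transport_0\<close>)

lemma segment_transport_id:
  assumes "model_map Y \<Sigma>" "x \<in> Y" "v \<in> fibre L (\<Sigma> x)"
  shows "segment_transport \<Sigma> x x v = v"
proof -
  have "\<Sigma> \<circ> segment_path x x = (\<lambda>_. \<Sigma> x)" by auto
  then show ?thesis
    using transport_const assms model_map_in[OF assms(1,2)] by (simp add: segment_transport_def)
qed

lemma segment_transport_trans:
  assumes M: "model_map Y \<Sigma>" and xyz: "x \<in> Y" "y \<in> Y" "z \<in> Y" and v: "v \<in> fibre L (\<Sigma> x)"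
  shows "segment_transport \<Sigma> y z (segment_transport \<Sigma> x y v) = segment_transport \<Sigma> x z v"
proof -
  have im: "path_image (segment_path a b) \<subseteq> Y" if "a \<in> Y" "b \<in> Y" for a b
    using M that by (intro path_image_segment) (auto simp: model_map_def)
  have "segment_transport \<Sigma> y z (segment_transport \<Sigma> x y v)
      = transport L ((\<Sigma> \<circ> segment_path x y) +++ (\<Sigma> \<circ> segment_path y z)) v"
    unfolding segment_transport_def
    using im xyz v by (intro transport_join[symmetric] model_path[OF M] path_segment)
      (auto simp: pathstart_compose pathfinish_compose)
  also have "\<dots> = transport L (\<Sigma> \<circ> (segment_path x y +++ segment_path y z)) v"
    by (simp add: path_compose_join)
  also have "\<dots> = segment_transport \<Sigma> x z v"
    unfolding segment_transport_def
    using im xyz v by (intro transport_model_eq[OF M] path_join_imp path_segment)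
      (simp_all add: subset_path_image_join)
  finally show ?thesis .
qed

lemma model_map_compose:
  assumes "model_map Y \<Sigma>" "segment_closed Y'" "continuous_on Y' \<phi>" "\<phi> ` Y' \<subseteq> Y"
  shows "model_map Y' (\<Sigma> \<circ> \<phi>)"
  using assms unfolding model_map_def
  by (auto intro: continuous_on_compose2[of Y] simp: o_def)

text \<open>\<open>\<phi>\<close> may bend a segment into a curve in \<open>Y\<close>; convexity of
  \<open>Y\<close> makes its transport agree with the one along the straight segment between the
  images.\<close>

lemma segment_transport_natural:
  assumes M: "model_map Y \<Sigma>" and Y': "segment_closed Y'" "continuous_on Y' \<phi>" "\<phi> ` Y' \<subseteq> Y"
    and xy: "x \<in> Y'" "y \<in> Y'" and v: "v \<in> fibre L (\<Sigma> (\<phi> x))"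
  shows "segment_transport (\<Sigma> \<circ> \<phi>) x y v = segment_transport \<Sigma> (\<phi> x) (\<phi> y) v"
proof -
  have i: "path_image (segment_path x y) \<subseteq> Y'"
    using Y' xy by (intro path_image_segment) auto
  have j: "path_image (segment_path (\<phi> x) (\<phi> y)) \<subseteq> Y"
    using M Y' xy by (intro path_image_segment) (auto simp: model_map_def)
  have p: "path (\<phi> \<circ> segment_path x y)"
    using Y'(2) i by (intro path_continuous_image path_segment) (auto intro: continuous_on_subset)
  have "transport L (\<Sigma> \<circ> (\<phi> \<circ> segment_path x y)) v = transport L (\<Sigma> \<circ> segment_path (\<phi> x) (\<phi> y)) v"
    using i j p Y'(3) v by (intro transport_model_eq[OF M] path_segment)
      (auto simp: path_image_compose pathstart_compose pathfinish_compose)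
  then show ?thesis
    by (simp add: segment_transport_def o_assoc)
qed

text \<open>Transport takes a path defined on all reals, so agreement on \<open>Y\<close> need not
  give equal functions; they agree on the unit interval and are therefore homotopic.\<close>

lemma segment_transport_cong:
  assumes M: "model_map Y \<Sigma>" and xy: "x \<in> Y" "y \<in> Y" and v: "v \<in> fibre L (\<Sigma> x)"
    and eq: "\<And>x. x \<in> Y \<Longrightarrow> \<Sigma> x = \<Sigma>' x"
  shows "segment_transport \<Sigma> x y v = segment_transport \<Sigma>' x y v"
proof -
  have i: "path_image (segment_path x y) \<subseteq> Y"
    using M xy by (intro path_image_segment) (auto simp: model_map_def)
  have "homotopic_paths S (\<Sigma> \<circ> segment_path x y) (\<Sigma>' \<circ> segment_path x y)"
    using eq i model_path[OF M path_segment i]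
    by (intro homotopic_paths_eq) (auto simp: path_image_def image_subset_iff)
  then show ?thesis
    unfolding segment_transport_def
    using v by (intro transport_homotopic) (auto simp: pathstart_compose)
qed

definition family :: "'a set \<Rightarrow> int \<Rightarrow> ((nat \<Rightarrow> real) \<Rightarrow> 'a) set" where
  "family B q = {\<sigma>. simplex_of_degree q B \<sigma>}"

lemma family_nat: "family B (int q) = {\<sigma>. singular_simplex q (top_of_set B) \<sigma>}"
  by (auto simp: family_def simplex_of_degree_def)

lemma leading_vertex: "leading_vertex \<sigma> = \<sigma> (vertex 0)"
  by (simp add: leading_vertex_def)

lemma model_map_simplex: "singular_simplex p (top_of_set S) \<sigma> \<Longrightarrow> model_map (standard_simplex p) \<sigma>"
  by (auto simp: model_map_def segment_closed_simplex singular_simplex_top_of_set)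

lemma cochain_in:
  assumes "c \<in> cochains S L (int q)" "singular_simplex q (top_of_set S) \<sigma>"
  shows "c \<sigma> \<in> fibre L (\<sigma> (vertex 0))"
  using assms by (auto simp: cochains_def simplex_of_degree_def leading_vertex dest!: spec[of _ \<sigma>])

lemma simplex_map_model:
  assumes "model_map Y \<Sigma>" "singular_simplex q (top_of_set Y) \<alpha>"
  shows "singular_simplex q (top_of_set S) (simplex_map q \<Sigma> \<alpha>)"
  using assms
  by (intro singular_simplex_simplex_map[of q "top_of_set Y"]) (auto simp: model_map_def)

lemma face_simplex:
  assumes "singular_simplex (Suc q) X \<sigma>" "k \<le> Suc q"
  shows "singular_simplex q X (singular_face (Suc q) k \<sigma>)"
  using singular_simplex_singular_face[OF assms(1) _ assms(2)] by simp

text \<open>All faces can be treated alike: for \<open>k > 0\<close> the segment joins vertex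
  \<open>0\<close> to itself and transports trivially, while for \<open>k = 0\<close> it is the
  reversed leading edge.\<close>

lemma coboundary_uniform:
  assumes c: "c \<in> cochains S L (int q)" and \<sigma>: "singular_simplex (Suc q) (top_of_set S) \<sigma>"
  shows "coboundary sc S L (int q) c \<sigma> =
    (\<Sum>k\<le>Suc q. sc ((-1) ^ k) (segment_transport \<sigma> (simplical_face k (vertex 0)) (vertex 0)
                               (c (singular_face (Suc q) k \<sigma>))))"
    (is "_ = (\<Sum>k\<le>Suc q. ?t k)")
proof -
  have nat: "nat (int q + 1) = Suc q" by simp
  have edge: "reversepath (leading_edge \<sigma>) = \<sigma> \<circ> segment_path (vertex 1) (vertex 0)"
    by (auto simp: reversepath_def leading_edge_def segment_path_def fun_eq_iff intro!: arg_cong[of _ _ \<sigma>])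
  have k: "?t k = sc ((-1) ^ k) (c (singular_face (Suc q) k \<sigma>))" if "k \<in> {1..Suc q}" for k
  proof -
    have "c (singular_face (Suc q) k \<sigma>) \<in> fibre L (singular_face (Suc q) k \<sigma> (vertex 0))"
      using face_simplex[OF \<sigma>] that by (intro cochain_in[OF c]) auto
    then have "c (singular_face (Suc q) k \<sigma>) \<in> fibre L (\<sigma> (vertex 0))"
      using that by (simp add: singular_face_def simplical_face_vertex_0)
    then show ?thesis
      using that segment_transport_id[OF model_map_simplex[OF \<sigma>], of "vertex 0"]
      by (simp add: simplical_face_vertex_0)
  qed
  have "(\<Sum>k\<le>Suc q. ?t k) = ?t 0 + (\<Sum>k=1..Suc q. ?t k)"
    by (simp add: sum.atMost_shift sum.atLeast_Suc_atMost_Suc_shift atMost_atLeast0 sum.atLeast_Suc_atMost del: sum.cl_ivl_Suc)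
  also have "(\<Sum>k=1..Suc q. ?t k) = (\<Sum>k=1..Suc q. sc ((-1) ^ k) (c (singular_face (Suc q) k \<sigma>)))"
    using k by (rule sum.cong[OF refl])
  finally show ?thesis
    using \<sigma> unfolding coboundary_def
    by (simp add: nat edge simplex_of_degree_def simplical_face_vertex_0 segment_transport_def nat_add_distrib)
qed

section \<open>Evaluation of twisted cochains on integral chains of a model\<close>

definition simplex_value ::
  "nat \<Rightarrow> ('a, 'v) cochain \<Rightarrow> ((nat \<Rightarrow> real) \<Rightarrow> 'a) \<Rightarrow> (nat \<Rightarrow> real) \<Rightarrow> ((nat \<Rightarrow> real) \<Rightarrow> nat \<Rightarrow> real) \<Rightarrow> 'v" where
  "simplex_value q c \<Sigma> y \<alpha> = segment_transport \<Sigma> (\<alpha> (vertex 0)) y (c (simplex_map q \<Sigma> \<alpha>))"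

definition combine :: "('b \<Rightarrow> 'v) \<Rightarrow> ('b \<Rightarrow>\<^sub>0 int) \<Rightarrow> 'v" where
  "combine f b = (\<Sum>\<alpha>\<in>Poly_Mapping.keys b. sc (of_int (Poly_Mapping.lookup b \<alpha>)) (f \<alpha>))"

lemma combine_superset:
  "finite K \<Longrightarrow> Poly_Mapping.keys b \<subseteq> K \<Longrightarrow> combine f b = (\<Sum>\<alpha>\<in>K. sc (of_int (Poly_Mapping.lookup b \<alpha>)) (f \<alpha>))"
  unfolding combine_def by (rule sum.mono_neutral_left) (auto simp: in_keys_iff)

lemma combine_0 [simp]: "combine f 0 = 0"
  by (simp add: combine_def)

lemma combine_of [simp]: "combine f (frag_of a) = f a"
  by (simp add: combine_def)

lemma combine_cmul: "combine f (frag_cmul n b) = sc (of_int n) (combine f b)"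
  using combine_superset[of "Poly_Mapping.keys b" "frag_cmul n b" f]
  by (auto simp: combine_def scale_sum_right)

lemma combine_diff: "combine f (a - b) = combine f a - combine f b"
  using combine_superset[of "Poly_Mapping.keys a \<union> Poly_Mapping.keys b" a f]
    combine_superset[of "Poly_Mapping.keys a \<union> Poly_Mapping.keys b" b f]
    combine_superset[of "Poly_Mapping.keys a \<union> Poly_Mapping.keys b" "a - b" f] keys_diff[of a b]
  by (simp add: lookup_minus scale_left_diff_distrib sum_subtractf)

lemma combine_minus: "combine f (- b) = - combine f b"
  using combine_diff[of f 0 b] by simp

lemma combine_add: "combine f (a + b) = combine f a + combine f b"
  using combine_diff[of f a "- b"] by (simp add: combine_minus)

lemma combine_sum: "combine f (sum g I) = (\<Sum>i\<in>I. combine f (g i))"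
  by (induction I rule: infinite_finite_induct) (auto simp: combine_add)

lemma combine_extend: "combine f (frag_extend g b) = combine (\<lambda>x. combine f (g x)) b"
  by (simp add: frag_extend_def combine_sum combine_cmul combine_def[of _ b])

lemma combine_cong: "(\<And>x. x \<in> Poly_Mapping.keys b \<Longrightarrow> f x = g x) \<Longrightarrow> combine f b = combine g b"
  by (simp add: combine_def)

lemma combine_eq_0: "(\<And>x. x \<in> Poly_Mapping.keys b \<Longrightarrow> f x = 0) \<Longrightarrow> combine f b = 0"
  by (simp add: combine_def)

text \<open>The value of \<open>c\<close> on the image of \<open>b\<close> under
  \<open>\<Sigma>\<close>, all contributions being carried to the fibre over
  \<open>\<Sigma> y\<close>. Through it, identities between integral chains in \<open>Y\<close>
  become identities of twisted cochains.\<close>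

definition pairing ::
  "nat \<Rightarrow> ('a, 'v) cochain \<Rightarrow> ((nat \<Rightarrow> real) \<Rightarrow> 'a) \<Rightarrow> (nat \<Rightarrow> real) \<Rightarrow> (nat \<Rightarrow> real) chain \<Rightarrow> 'v" where
  "pairing q c \<Sigma> y b = combine (simplex_value q c \<Sigma> y) b"

lemma chainD: "singular_chain q X b \<Longrightarrow> \<alpha> \<in> Poly_Mapping.keys b \<Longrightarrow> singular_simplex q X \<alpha>"
  by (auto simp: singular_chain_def)

lemma simplex_in: "singular_simplex q (top_of_set Y) \<alpha> \<Longrightarrow> x \<in> standard_simplex q \<Longrightarrow> \<alpha> x \<in> Y"
  by (auto simp: singular_simplex_top_of_set)

lemma cochain_simplex_map_in:
  assumes "model_map Y \<Sigma>" "c \<in> cochains S L (int q)" "singular_simplex q (top_of_set Y) \<alpha>"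
  shows "c (simplex_map q \<Sigma> \<alpha>) \<in> fibre L (\<Sigma> (\<alpha> (vertex 0)))"
  using cochain_in[OF assms(2) simplex_map_model[OF assms(1,3)]] by (simp add: simplex_map_def)

lemma simplex_value_in:
  assumes "model_map Y \<Sigma>" "c \<in> cochains S L (int q)" "singular_simplex q (top_of_set Y) \<alpha>" "y \<in> Y"
  shows "simplex_value q c \<Sigma> y \<alpha> \<in> fibre L (\<Sigma> y)"
  unfolding simplex_value_def
  by (intro segment_transport_in[OF assms(1)] cochain_simplex_map_in[OF assms(1)] assms simplex_in[OF assms(3)]) auto

lemma pairing_in:
  assumes "model_map Y \<Sigma>" "c \<in> cochains S L (int q)" "singular_chain q (top_of_set Y) b" "y \<in> Y"
  shows "pairing q c \<Sigma> y b \<in> fibre L (\<Sigma> y)"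
  unfolding pairing_def combine_def
  by (intro fibre_sum fibre_scale simplex_value_in[OF assms(1,2)] chainD[OF assms(3)] model_map_in[OF assms(1)] assms(4))

text \<open>Stokes' formula. It is checked on single simplices, where naturality turns transports
  inside the domain of the simplex into transports in \<open>Y\<close>.\<close>

lemma pairing_boundary:
  assumes M: "model_map Y \<Sigma>" and c: "c \<in> cochains S L (int q)"
    and b: "singular_chain (Suc q) (top_of_set Y) b" and y: "y \<in> Y"
  shows "pairing (Suc q) (coboundary sc S L (int q) c) \<Sigma> y b = pairing q c \<Sigma> y (chain_boundary (Suc q) b)"
proof -
  have "simplex_value (Suc q) (coboundary sc S L (int q) c) \<Sigma> y \<alpha> =
     combine (simplex_value q c \<Sigma> y) (\<Sum>k\<le>Suc q. frag_cmul ((-1) ^ k) (frag_of (singular_face (Suc q) k \<alpha>)))"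
    if "\<alpha> \<in> Poly_Mapping.keys b" for \<alpha>
  proof -
    have \<alpha>: "singular_simplex (Suc q) (top_of_set Y) \<alpha>" using chainD[OF b that] .
    let ?s = "simplex_map (Suc q) \<Sigma> \<alpha>"
    let ?p = "\<lambda>k. simplical_face k (vertex 0)"
    note s = simplex_map_model[OF M \<alpha>]
    have \<alpha>': "segment_closed (standard_simplex (Suc q))" "continuous_on (standard_simplex (Suc q)) \<alpha>"
        "\<alpha> ` standard_simplex (Suc q) \<subseteq> Y"
      using \<alpha> by (auto simp: segment_closed_simplex singular_simplex_top_of_set)
    note M\<alpha> = model_map_compose[OF M \<alpha>']
    \<comment> \<open>A face value first goes to vertex \<open>0\<close> inside the simplex and then
      on to \<open>y\<close>; the composite is the direct transport from the leading vertex of the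
      face.\<close>
    have tm: "segment_transport \<Sigma> (\<alpha> (vertex 0)) y (segment_transport ?s (?p k) (vertex 0) (c (singular_face (Suc q) k ?s)))
        = simplex_value q c \<Sigma> y (singular_face (Suc q) k \<alpha>)"
      and term_in: "segment_transport ?s (?p k) (vertex 0) (c (singular_face (Suc q) k ?s)) \<in> fibre L (\<Sigma> (\<alpha> (vertex 0)))"
      if k: "k \<le> Suc q" for k
    proof -
      have p: "?p k \<in> standard_simplex (Suc q)" and v: "vertex 0 \<in> standard_simplex (Suc q)"
        using k by (auto simp: simplical_face_vertex_0)
      have face: "singular_face (Suc q) k ?s = simplex_map q \<Sigma> (singular_face (Suc q) k \<alpha>)"
        using simplical_face_maps[OF k] by (auto simp: singular_face_def simplex_map_def fun_eq_iff)
      have face0: "singular_face (Suc q) k \<alpha> (vertex 0) = \<alpha> (?p k)"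
        by (simp add: singular_face_def)
      have cin: "c (singular_face (Suc q) k ?s) \<in> fibre L (\<Sigma> (\<alpha> (?p k)))"
        using cochain_simplex_map_in[OF M c face_simplex[OF \<alpha> k]] unfolding face face0 .
      have "segment_transport ?s (?p k) (vertex 0) (c (singular_face (Suc q) k ?s))
          = segment_transport (\<Sigma> \<circ> \<alpha>) (?p k) (vertex 0) (c (singular_face (Suc q) k ?s))"
        using cin p by (intro segment_transport_cong[OF model_map_simplex[OF s] p v])
          (auto simp: simplex_map_def)
      also have "\<dots> = segment_transport \<Sigma> (\<alpha> (?p k)) (\<alpha> (vertex 0)) (c (singular_face (Suc q) k ?s))"
        by (rule segment_transport_natural[OF M \<alpha>' p v cin])
      finally have eq: "segment_transport ?s (?p k) (vertex 0) (c (singular_face (Suc q) k ?s)) =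
        segment_transport \<Sigma> (\<alpha> (?p k)) (\<alpha> (vertex 0)) (c (singular_face (Suc q) k ?s))" .
      have inY: "\<alpha> (?p k) \<in> Y" "\<alpha> (vertex 0) \<in> Y" using simplex_in[OF \<alpha>] p v by auto
      show "segment_transport ?s (?p k) (vertex 0) (c (singular_face (Suc q) k ?s)) \<in> fibre L (\<Sigma> (\<alpha> (vertex 0)))"
        unfolding eq by (rule segment_transport_in[OF M inY cin])
      show "segment_transport \<Sigma> (\<alpha> (vertex 0)) y (segment_transport ?s (?p k) (vertex 0) (c (singular_face (Suc q) k ?s)))
        = simplex_value q c \<Sigma> y (singular_face (Suc q) k \<alpha>)"
        unfolding simplex_value_def face0 face[symmetric] eq
        by (rule segment_transport_trans[OF M inY y cin])
    qed
    have inY: "\<alpha> (vertex 0) \<in> Y" using simplex_in[OF \<alpha>] by simp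
    have "simplex_value (Suc q) (coboundary sc S L (int q) c) \<Sigma> y \<alpha>
       = segment_transport \<Sigma> (\<alpha> (vertex 0)) y (\<Sum>k\<le>Suc q. sc ((-1) ^ k)
           (segment_transport ?s (?p k) (vertex 0) (c (singular_face (Suc q) k ?s))))"
      unfolding simplex_value_def coboundary_uniform[OF c s] ..
    also have "\<dots> = (\<Sum>k\<le>Suc q. segment_transport \<Sigma> (\<alpha> (vertex 0)) y (sc ((-1) ^ k)
           (segment_transport ?s (?p k) (vertex 0) (c (singular_face (Suc q) k ?s)))))"
      using term_in model_map_in[OF M inY]
      by (intro segment_transport_sum[OF M inY y] fibre_scale) auto
    also have "\<dots> = (\<Sum>k\<le>Suc q. sc ((-1) ^ k) (simplex_value q c \<Sigma> y (singular_face (Suc q) k \<alpha>)))"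
    proof (rule sum.cong[OF refl])
      fix k assume "k \<in> {..Suc q}"
      then have k: "k \<le> Suc q" by simp
      show "segment_transport \<Sigma> (\<alpha> (vertex 0)) y (sc ((-1) ^ k)
           (segment_transport ?s (?p k) (vertex 0) (c (singular_face (Suc q) k ?s))))
          = sc ((-1) ^ k) (simplex_value q c \<Sigma> y (singular_face (Suc q) k \<alpha>))"
        by (simp add: segment_transport_scale[OF M inY y term_in[OF k]] tm[OF k])
    qed
    also have "\<dots> = combine (simplex_value q c \<Sigma> y) (\<Sum>k\<le>Suc q. frag_cmul ((-1) ^ k) (frag_of (singular_face (Suc q) k \<alpha>)))"
      by (simp only: combine_sum combine_cmul combine_of of_int_power of_int_minus of_int_1)
    finally show ?thesis .
  qed
  then show ?thesis
    unfolding pairing_def chain_boundary_def by (auto simp: combine_extend intro!: combine_cong)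
qed

text \<open>Changing the model changes the reference point as well: values collected at
  \<open>y'\<close> sit over \<open>\<phi> y'\<close> and must still travel to
  \<open>y\<close>.\<close>

lemma pairing_chain_map:
  assumes M: "model_map Y \<Sigma>" and c: "c \<in> cochains S L (int q)"
    and \<phi>: "segment_closed Y'" "continuous_on Y' \<phi>" "\<phi> ` Y' \<subseteq> Y"
    and b: "singular_chain q (top_of_set Y') b" and y: "y \<in> Y" and y': "y' \<in> Y'"
  shows "pairing q c \<Sigma> y (chain_map q \<phi> b) = segment_transport \<Sigma> (\<phi> y') y (pairing q c (\<Sigma> \<circ> \<phi>) y' b)"
proof -
  note M' = model_map_compose[OF M \<phi>]
  have \<phi>y: "\<phi> y' \<in> Y" using \<phi> y' by auto
  have v: "simplex_value q c \<Sigma> y (simplex_map q \<phi> \<alpha>)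
      = segment_transport \<Sigma> (\<phi> y') y (simplex_value q c (\<Sigma> \<circ> \<phi>) y' \<alpha>)" if "\<alpha> \<in> Poly_Mapping.keys b" for \<alpha>
  proof -
    have \<alpha>: "singular_simplex q (top_of_set Y') \<alpha>" using chainD[OF b that] .
    have 0: "\<alpha> (vertex 0) \<in> Y'" using simplex_in[OF \<alpha>] by simp
    have cin: "c (simplex_map q (\<Sigma> \<circ> \<phi>) \<alpha>) \<in> fibre L (\<Sigma> (\<phi> (\<alpha> (vertex 0))))"
      using cochain_simplex_map_in[OF M' c \<alpha>] by simp
    have "segment_transport \<Sigma> (\<phi> y') y (simplex_value q c (\<Sigma> \<circ> \<phi>) y' \<alpha>) =
       segment_transport \<Sigma> (\<phi> y') y (segment_transport \<Sigma> (\<phi> (\<alpha> (vertex 0))) (\<phi> y') (c (simplex_map q (\<Sigma> \<circ> \<phi>) \<alpha>)))"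
      unfolding simplex_value_def segment_transport_natural[OF M \<phi> 0 y' cin] ..
    also have "\<dots> = segment_transport \<Sigma> (\<phi> (\<alpha> (vertex 0))) y (c (simplex_map q (\<Sigma> \<circ> \<phi>) \<alpha>))"
      using 0 \<phi> by (intro segment_transport_trans[OF M _ \<phi>y y cin]) auto
    also have "\<dots> = simplex_value q c \<Sigma> y (simplex_map q \<phi> \<alpha>)"
      by (simp add: simplex_value_def simplex_map_compose) (simp add: simplex_map_def)
    finally show ?thesis ..
  qed
  have "pairing q c \<Sigma> y (chain_map q \<phi> b) = combine (\<lambda>\<alpha>. simplex_value q c \<Sigma> y (simplex_map q \<phi> \<alpha>)) b"
    by (simp add: pairing_def chain_map_def combine_extend)
  also have "\<dots> = (\<Sum>\<alpha>\<in>Poly_Mapping.keys b. segment_transport \<Sigma> (\<phi> y') y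
       (sc (of_int (Poly_Mapping.lookup b \<alpha>)) (simplex_value q c (\<Sigma> \<circ> \<phi>) y' \<alpha>)))"
    unfolding combine_def
  proof (intro sum.cong refl)
    fix \<alpha> assume a: "\<alpha> \<in> Poly_Mapping.keys b"
    show "sc (of_int (Poly_Mapping.lookup b \<alpha>)) (simplex_value q c \<Sigma> y (simplex_map q \<phi> \<alpha>)) =
      segment_transport \<Sigma> (\<phi> y') y (sc (of_int (Poly_Mapping.lookup b \<alpha>)) (simplex_value q c (\<Sigma> \<circ> \<phi>) y' \<alpha>))"
      using segment_transport_scale[OF M \<phi>y y] simplex_value_in[OF M' c chainD[OF b a] y'] by (simp add: v[OF a])
  qed
  also have "\<dots> = segment_transport \<Sigma> (\<phi> y') y (pairing q c (\<Sigma> \<circ> \<phi>) y' b)"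
    unfolding pairing_def combine_def
    using simplex_value_in[OF M' c chainD[OF b] y'] model_map_in[OF M \<phi>y]
    by (subst segment_transport_sum[OF M \<phi>y y]) (auto intro!: fibre_scale)
  finally show ?thesis .
qed

lemma pairing_cong:
  assumes M: "model_map Y \<Sigma>" and c: "c \<in> cochains S L (int q)"
    and b: "singular_chain q (top_of_set Y) b" and y: "y \<in> Y" and eq: "\<And>x. x \<in> Y \<Longrightarrow> \<Sigma> x = \<Sigma>' x"
  shows "pairing q c \<Sigma> y b = pairing q c \<Sigma>' y b"
  unfolding pairing_def
proof (rule combine_cong)
  fix \<alpha> assume "\<alpha> \<in> Poly_Mapping.keys b"
  then have \<alpha>: "singular_simplex q (top_of_set Y) \<alpha>" by (rule chainD[OF b])
  have "simplex_map q \<Sigma>' \<alpha> = simplex_map q \<Sigma> \<alpha>"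
    using eq simplex_in[OF \<alpha>] by (auto simp: simplex_map_def fun_eq_iff)
  then show "simplex_value q c \<Sigma> y \<alpha> = simplex_value q c \<Sigma>' y \<alpha>"
    using segment_transport_cong[OF M _ y cochain_simplex_map_in[OF M c \<alpha>], of \<Sigma>'] simplex_in[OF \<alpha>] eq
    by (simp add: simplex_value_def)
qed

text \<open>Every cochain value is a pairing with the identity chain, so claims about all
  \<open>\<sigma>\<close> reduce to universal chains on the standard simplex.\<close>

lemma pairing_identity:
  assumes c: "c \<in> cochains S L (int q)" and \<sigma>: "singular_simplex q (top_of_set S) \<sigma>"
  shows "pairing q c \<sigma> (vertex 0) (frag_of (identity_simplex q)) = c \<sigma>"
proof -
  show ?thesis
    using simplex_map_identity[OF \<sigma>] segment_transport_id[OF model_map_simplex[OF \<sigma>] _ cochain_in[OF c \<sigma>]]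
    by (simp add: pairing_def simplex_value_def)
qed

end

subsection \<open>Relative cochains of families of simplices\<close>

context coefficient_system
begin

text \<open>Subcomplexes of the singular complex of \<open>S\<close>. They are more general than
  \<open>family B\<close>: the simplices contained in \<open>A\<close> or in \<open>B\<close> form
  one, but in general not that of a subspace.\<close>

definition face_closed :: "(int \<Rightarrow> ((nat \<Rightarrow> real) \<Rightarrow> 'a) set) \<Rightarrow> bool" where
  "face_closed P \<longleftrightarrow> (\<forall>q. P q \<subseteq> family S q) \<and>
     (\<forall>q. \<forall>\<sigma>\<in>P (int (Suc q)). \<forall>k\<le>Suc q. singular_face (Suc q) k \<sigma> \<in> P (int q))"

text \<open>Extension by zero puts the relative cochains of all pairs into one function space, so
  that inclusions of cochain groups are plain subset relations.\<close>

definition rel_cochains ::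
  "(int \<Rightarrow> ((nat \<Rightarrow> real) \<Rightarrow> 'a) set) \<Rightarrow> (int \<Rightarrow> ((nat \<Rightarrow> real) \<Rightarrow> 'a) set) \<Rightarrow> int \<Rightarrow> ('a, 'v) cochain set"
  where
  "rel_cochains P Q q = {c. \<forall>\<sigma>. if \<sigma> \<in> P q - Q q then c \<sigma> \<in> fibre L (leading_vertex \<sigma>) else c \<sigma> = 0}"

definition cut :: "((nat \<Rightarrow> real) \<Rightarrow> 'a) set \<Rightarrow> ('a, 'v) cochain \<Rightarrow> ('a, 'v) cochain" where
  "cut F c = (\<lambda>\<sigma>. if \<sigma> \<in> F then c \<sigma> else 0)"

text \<open>The cut is essential: a cochain extended by zero outside \<open>P\<close> can have a
  nonzero coboundary on a simplex outside \<open>P\<close> with some face in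
  \<open>P\<close>.\<close>

definition rel_coboundary ::
  "(int \<Rightarrow> ((nat \<Rightarrow> real) \<Rightarrow> 'a) set) \<Rightarrow> int \<Rightarrow> ('a, 'v) cochain \<Rightarrow> ('a, 'v) cochain" where
  "rel_coboundary P q c = cut (P (q + 1)) (coboundary sc S L q c)"

definition cochain_scale :: "complex \<Rightarrow> ('a, 'v) cochain \<Rightarrow> ('a, 'v) cochain" where
  "cochain_scale a c = (\<lambda>\<sigma>. sc a (c \<sigma>))"

definition rel_cocycles where
  "rel_cocycles P Q q = {c \<in> rel_cochains P Q q. rel_coboundary P q c = 0}"

definition rel_coboundaries where
  "rel_coboundaries P Q q = rel_coboundary P (q - 1) ` rel_cochains P Q (q - 1)"

lemma cochain_scale_apply [simp]: "cochain_scale a c \<sigma> = sc a (c \<sigma>)"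
  by (simp add: cochain_scale_def)

lemma leading_vertex_in: "simplex_of_degree q S \<sigma> \<Longrightarrow> leading_vertex \<sigma> \<in> S"
  by (auto simp: simplex_of_degree_def leading_vertex intro: simplex_in)

lemma face_closed_family_sub: "face_closed P \<Longrightarrow> \<sigma> \<in> P q \<Longrightarrow> simplex_of_degree q S \<sigma>"
  by (auto simp: face_closed_def family_def)

lemma face_closed_face: "face_closed P \<Longrightarrow> \<sigma> \<in> P (int q + 1) \<Longrightarrow> k \<le> Suc q \<Longrightarrow> singular_face (Suc q) k \<sigma> \<in> P (int q)"
  by (auto simp: face_closed_def add.commute)

lemma rel_cochains_0 [simp]: "face_closed P \<Longrightarrow> 0 \<in> rel_cochains P Q q"
  by (auto simp: rel_cochains_def dest: face_closed_family_sub intro!: fibre_0 leading_vertex_in)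

lemma rel_cochains_add: "face_closed P \<Longrightarrow> c \<in> rel_cochains P Q q \<Longrightarrow> d \<in> rel_cochains P Q q \<Longrightarrow> c + d \<in> rel_cochains P Q q"
  by (auto simp: rel_cochains_def dest: face_closed_family_sub intro!: fibre_add leading_vertex_in)

lemma rel_cochains_diff: "face_closed P \<Longrightarrow> c \<in> rel_cochains P Q q \<Longrightarrow> d \<in> rel_cochains P Q q \<Longrightarrow> c - d \<in> rel_cochains P Q q"
  by (auto simp: rel_cochains_def dest: face_closed_family_sub intro!: fibre_diff leading_vertex_in)

lemma rel_cochains_scale: "face_closed P \<Longrightarrow> c \<in> rel_cochains P Q q \<Longrightarrow> cochain_scale a c \<in> rel_cochains P Q q"
  by (auto simp: rel_cochains_def dest: face_closed_family_sub intro!: fibre_scale leading_vertex_in)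

lemma rel_cochains_in_cochains: "face_closed P \<Longrightarrow> c \<in> rel_cochains P Q q \<Longrightarrow> c \<in> cochains S L q"
  using face_closed_family_sub[of P _ q]
  unfolding rel_cochains_def cochains_def
  by (auto dest: spec intro!: fibre_0 leading_vertex_in split: if_splits)

lemma rel_cochains_zero: "c \<in> rel_cochains P Q q \<Longrightarrow> \<sigma> \<notin> P q - Q q \<Longrightarrow> c \<sigma> = 0"
  by (auto simp: rel_cochains_def dest!: spec[of _ \<sigma>])

lemma coboundary_neg: "q < 0 \<Longrightarrow> coboundary sc S L q c = 0"
  by (simp add: coboundary_def zero_fun_def)

lemma coboundary_off: "\<not> simplex_of_degree (q + 1) S \<sigma> \<Longrightarrow> coboundary sc S L q c \<sigma> = 0"
  by (simp add: coboundary_def)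

lemma coboundary_cong:
  assumes "\<And>k. k \<le> Suc q \<Longrightarrow> c (singular_face (Suc q) k \<sigma>) = d (singular_face (Suc q) k \<sigma>)"
  shows "coboundary sc S L (int q) c \<sigma> = coboundary sc S L (int q) d \<sigma>"
proof -
  have "nat (int q + 1) = Suc q" by simp
  with assms show ?thesis unfolding coboundary_def by auto
qed

lemma simplex_of_degree_Suc: "simplex_of_degree (int q + 1) S \<sigma> \<longleftrightarrow> singular_simplex (Suc q) (top_of_set S) \<sigma>"
  by (simp add: simplex_of_degree_def nat_add_distrib)

lemma int_cases_neg: obtains "q < 0" | n where "q = int n"
  by (metis int_ops(1) nonneg_int_cases not_less)

lemma face_cochain_in:
  assumes "c \<in> cochains S L (int q)" "singular_simplex (Suc q) (top_of_set S) \<sigma>" "k \<le> Suc q"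
  shows "c (singular_face (Suc q) k \<sigma>) \<in> fibre L (\<sigma> (simplical_face k (vertex 0)))"
  using cochain_in[OF assms(1) face_simplex[OF assms(2,3)]] by (simp add: singular_face_def)

lemma coboundary_in:
  assumes c: "c \<in> cochains S L q"
  shows "coboundary sc S L q c \<in> cochains S L (q + 1)"
proof (cases rule: int_cases_neg[of q])
  case 1
  then show ?thesis
    by (auto simp: coboundary_neg cochains_def intro!: fibre_0 leading_vertex_in)
next
  case (2 n)
  have "coboundary sc S L q c \<sigma> \<in> fibre L (leading_vertex \<sigma>)" if "simplex_of_degree (q + 1) S \<sigma>" for \<sigma>
  proof -
    have \<sigma>: "singular_simplex (Suc n) (top_of_set S) \<sigma>" using that 2 by (simp add: simplex_of_degree_Suc)
    note M = model_map_simplex[OF \<sigma>]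
    show ?thesis
      unfolding 2 coboundary_uniform[OF c[unfolded 2] \<sigma>] leading_vertex
      using face_cochain_in[OF c[unfolded 2] \<sigma>] simplical_face_maps[of _ n "vertex 0"]
      by (intro fibre_sum fibre_scale segment_transport_in[OF M] model_map_in[OF M]) auto
  qed
  then show ?thesis
    by (auto simp: cochains_def coboundary_off)
qed

lemma
  assumes c: "c \<in> cochains S L q"
  shows coboundary_add: "d \<in> cochains S L q \<Longrightarrow> coboundary sc S L q (c + d) = coboundary sc S L q c + coboundary sc S L q d"
    and coboundary_scale: "coboundary sc S L q (cochain_scale a c) = cochain_scale a (coboundary sc S L q c)"
proof -
  have sum: "c + d \<in> cochains S L q" if "d \<in> cochains S L q" for d
    using c that by (auto simp: cochains_def intro!: fibre_add leading_vertex_in)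
  have scale: "cochain_scale a c \<in> cochains S L q"
    using c by (auto simp: cochains_def intro!: fibre_scale leading_vertex_in)
  show "coboundary sc S L q (c + d) = coboundary sc S L q c + coboundary sc S L q d"
    if d: "d \<in> cochains S L q"
  proof
    fix \<sigma>
    show "coboundary sc S L q (c + d) \<sigma> = (coboundary sc S L q c + coboundary sc S L q d) \<sigma>"
    proof (cases "0 \<le> q \<and> simplex_of_degree (q + 1) S \<sigma>")
      case True
      then obtain n where n: "q = int n" by (metis nonneg_int_cases)
      have \<sigma>: "singular_simplex (Suc n) (top_of_set S) \<sigma>"
        using True n by (simp add: simplex_of_degree_Suc)
      note M = model_map_simplex[OF \<sigma>]
      have t: "segment_transport \<sigma> (simplical_face k (vertex 0)) (vertex 0) (c (singular_face (Suc n) k \<sigma>) + d (singular_face (Suc n) k \<sigma>))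
         = segment_transport \<sigma> (simplical_face k (vertex 0)) (vertex 0) (c (singular_face (Suc n) k \<sigma>))
         + segment_transport \<sigma> (simplical_face k (vertex 0)) (vertex 0) (d (singular_face (Suc n) k \<sigma>))"
        if "k \<le> Suc n" for k
        using face_cochain_in[OF c[unfolded n] \<sigma> that] face_cochain_in[OF d[unfolded n] \<sigma> that]
          simplical_face_maps[OF that, of "vertex 0"]
        by (intro segment_transport_add[OF M]) auto
      show ?thesis
        unfolding n coboundary_uniform[OF sum[OF d, unfolded n] \<sigma>] plus_fun_apply
          coboundary_uniform[OF c[unfolded n] \<sigma>] coboundary_uniform[OF d[unfolded n] \<sigma>] sum.distrib[symmetric]
        by (rule sum.cong) (auto simp: t scale_right_distrib)
    next
      case False
      then show ?thesis by (auto simp: coboundary_def)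
    qed
  qed
  show "coboundary sc S L q (cochain_scale a c) = cochain_scale a (coboundary sc S L q c)"
  proof
    fix \<sigma>
    show "coboundary sc S L q (cochain_scale a c) \<sigma> = cochain_scale a (coboundary sc S L q c) \<sigma>"
    proof (cases "0 \<le> q \<and> simplex_of_degree (q + 1) S \<sigma>")
      case True
      then obtain n where n: "q = int n" by (metis nonneg_int_cases)
      have \<sigma>: "singular_simplex (Suc n) (top_of_set S) \<sigma>"
        using True n by (simp add: simplex_of_degree_Suc)
      note M = model_map_simplex[OF \<sigma>]
      have t: "segment_transport \<sigma> (simplical_face k (vertex 0)) (vertex 0) (sc a (c (singular_face (Suc n) k \<sigma>)))
         = sc a (segment_transport \<sigma> (simplical_face k (vertex 0)) (vertex 0) (c (singular_face (Suc n) k \<sigma>)))"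
        if "k \<le> Suc n" for k
        using face_cochain_in[OF c[unfolded n] \<sigma> that] simplical_face_maps[OF that, of "vertex 0"]
        by (intro segment_transport_scale[OF M]) auto
      show ?thesis
        unfolding n coboundary_uniform[OF scale[unfolded n] \<sigma>] cochain_scale_apply
          coboundary_uniform[OF c[unfolded n] \<sigma>] scale_sum_right
        by (rule sum.cong) (auto simp: t mult.commute)
    next
      case False
      then show ?thesis by (auto simp: coboundary_def)
    qed
  qed
qed

lemma coboundary_0 [simp]: "coboundary sc S L q 0 = 0"
proof -
  have "0 \<in> cochains S L q" by (auto simp: cochains_def intro!: fibre_0 leading_vertex_in)
  then show ?thesis using coboundary_add[of 0 q 0] by auto
qed

text \<open>Stokes' formula, applied twice, turns the value at \<open>\<sigma>\<close> into the
  pairing of \<open>c\<close> with the double boundary of the identity chain.\<close>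

lemma coboundary_coboundary:
  assumes c: "c \<in> cochains S L q"
  shows "coboundary sc S L (q + 1) (coboundary sc S L q c) = 0"
proof (cases rule: int_cases_neg[of q])
  case 1
  then show ?thesis
    by (simp add: coboundary_neg)
next
  case (2 n)
  note c' = c[unfolded 2]
  have c1: "coboundary sc S L (int n) c \<in> cochains S L (int (Suc n))"
    using coboundary_in[OF c'] by (simp add: add.commute)
  have c2: "coboundary sc S L (int (Suc n)) (coboundary sc S L (int n) c) \<in> cochains S L (int (Suc (Suc n)))"
    using coboundary_in[OF c1] by (simp add: add.commute)
  have "coboundary sc S L (int (Suc n)) (coboundary sc S L (int n) c) \<sigma> = 0" for \<sigma>
  proof (cases "singular_simplex (Suc (Suc n)) (top_of_set S) \<sigma>")
    case True
    note M = model_map_simplex[OF True]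
    let ?\<iota> = "frag_of (identity_simplex (Suc (Suc n)))"
    have \<iota>: "singular_chain (Suc (Suc n)) (top_of_set (standard_simplex (Suc (Suc n)))) ?\<iota>"
      by (simp add: singular_chain_of identity_simplex)
    have v: "vertex 0 \<in> standard_simplex (Suc (Suc n))" by simp
    have "coboundary sc S L (int (Suc n)) (coboundary sc S L (int n) c) \<sigma>
        = pairing n c \<sigma> (vertex 0) (chain_boundary (Suc n) (chain_boundary (Suc (Suc n)) ?\<iota>))"
      unfolding pairing_identity[OF c2 True, symmetric] pairing_boundary[OF M c1 \<iota> v]
      using singular_chain_boundary_alt[OF \<iota>] by (intro pairing_boundary[OF M c' _ v])
    also have "\<dots> = 0"
      using chain_boundary_boundary[OF \<iota>] by (simp add: pairing_def)
    finally show ?thesis .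
  next
    case False
    then show ?thesis using simplex_of_degree_Suc[of "Suc n" \<sigma>]
      by (intro coboundary_off) auto
  qed
  then show ?thesis by (auto simp: 2 fun_eq_iff add.commute)
qed

lemma cut_cut: "cut F (cut F c) = cut F c"
  by (auto simp: cut_def)

lemma cut_0 [simp]: "cut F 0 = 0"
  and cut_add: "cut F (c + d) = cut F c + cut F d"
  and cut_diff: "cut F (c - d) = cut F c - cut F d"
  and cut_scale: "cut F (cochain_scale a c) = cochain_scale a (cut F c)"
  by (auto simp: cut_def fun_eq_iff)

lemma rel_coboundary_0 [simp]: "rel_coboundary P q 0 = 0"
  by (simp add: rel_coboundary_def)

lemma
  assumes P: "face_closed P" and c: "c \<in> rel_cochains P Q q"
  shows rel_coboundary_add: "d \<in> rel_cochains P Q' q \<Longrightarrow>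
      rel_coboundary P q (c + d) = rel_coboundary P q c + rel_coboundary P q d"
    and rel_coboundary_scale: "rel_coboundary P q (cochain_scale a c) = cochain_scale a (rel_coboundary P q c)"
  using coboundary_add coboundary_scale rel_cochains_in_cochains[OF P] c
  unfolding rel_coboundary_def by (metis cut_add, metis cut_scale)

lemma rel_coboundary_diff:
  assumes P: "face_closed P" and c: "c \<in> rel_cochains P Q q" and d: "d \<in> rel_cochains P Q' q"
  shows "rel_coboundary P q (c - d) = rel_coboundary P q c - rel_coboundary P q d"
proof -
  have e: "c - d = c + cochain_scale (- 1) d" by (auto simp: fun_eq_iff)
  show ?thesis
    unfolding e rel_coboundary_add[OF P c rel_cochains_scale[OF P d]] rel_coboundary_scale[OF P d]
    by (auto simp: fun_eq_iff)
qed

lemma rel_cochains_mono: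
  assumes P: "face_closed P" and "\<And>q. Q q \<subseteq> P q" "\<And>q. R q \<subseteq> Q q"
  shows "rel_cochains P Q q \<subseteq> rel_cochains P R q" "rel_cochains Q R q \<subseteq> rel_cochains P R q"
proof -
  have 0: "0 \<in> fibre L (leading_vertex \<sigma>)" if "\<sigma> \<in> P q" for \<sigma>
    using that by (intro fibre_0 leading_vertex_in face_closed_family_sub[OF P])
  show "rel_cochains P Q q \<subseteq> rel_cochains P R q"
    unfolding rel_cochains_def using 0 assms(3)[of q] by (force split: if_splits)
  show "rel_cochains Q R q \<subseteq> rel_cochains P R q"
    unfolding rel_cochains_def using 0 assms(2)[of q] by (force split: if_splits)
qed

lemma cut_in:
  assumes "\<And>q. Q q \<subseteq> P q" "c \<in> rel_cochains P R q"
  shows "cut (Q q) c \<in> rel_cochains Q R q"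
  using assms unfolding rel_cochains_def cut_def by (auto split: if_splits)

lemma cut_same: "z \<in> rel_cochains Q R q \<Longrightarrow> cut (Q q) z = z"
  by (auto simp: cut_def fun_eq_iff rel_cochains_zero)

lemma cut_eq_0:
  assumes "c \<in> rel_cochains P R q" "cut (Q q) c = 0" "R q \<subseteq> Q q"
  shows "c \<in> rel_cochains P Q q"
proof -
  have "c \<sigma> = 0" if "\<sigma> \<in> Q q" for \<sigma>
    using that assms(2) by (auto simp: cut_def fun_eq_iff dest!: spec[of _ \<sigma>])
  moreover have "if \<sigma> \<in> P q - R q then c \<sigma> \<in> fibre L (leading_vertex \<sigma>) else c \<sigma> = 0" for \<sigma>
    using assms(1) unfolding rel_cochains_def by blast
  ultimately have "if \<sigma> \<in> P q - Q q then c \<sigma> \<in> fibre L (leading_vertex \<sigma>) else c \<sigma> = 0" for \<sigma>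
    using assms(3) by (metis DiffD1 DiffD2 DiffI subsetD)
  then show ?thesis
    by (simp add: rel_cochains_def)
qed

lemma cut_rel: "c \<in> rel_cochains P Q q \<Longrightarrow> cut (Q q) c = 0"
  by (auto simp: cut_def fun_eq_iff rel_cochains_zero)

text \<open>On a simplex of \<open>Q\<close> both sides involve only its faces, and these lie in
  \<open>Q\<close>.\<close>

lemma cut_rel_coboundary:
  assumes Q: "face_closed Q" and QP: "\<And>q. Q q \<subseteq> P q"
  shows "cut (Q (q + 1)) (rel_coboundary P q c) = rel_coboundary Q q (cut (Q q) c)"
proof
  fix \<sigma>
  show "cut (Q (q + 1)) (rel_coboundary P q c) \<sigma> = rel_coboundary Q q (cut (Q q) c) \<sigma>"
  proof (cases rule: int_cases_neg[of q])
    case 1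
    then show ?thesis by (auto simp: rel_coboundary_def cut_def coboundary_neg)
  next
    case (2 n)
    show ?thesis
    proof (cases "\<sigma> \<in> Q (q + 1)")
      case True
      have "coboundary sc S L (int n) c \<sigma> = coboundary sc S L (int n) (cut (Q (int n)) c) \<sigma>"
        using face_closed_face[OF Q, of \<sigma> n] True 2 by (intro coboundary_cong) (auto simp: cut_def)
      then show ?thesis using True QP[of "q + 1"] 2 by (auto simp: rel_coboundary_def cut_def)
    qed (auto simp: rel_coboundary_def cut_def)
  qed
qed

lemma rel_coboundary_in:
  assumes P: "face_closed P" and Q: "face_closed Q" and QP: "\<And>q. Q q \<subseteq> P q"
    and c: "c \<in> rel_cochains P Q q"
  shows "rel_coboundary P q c \<in> rel_cochains P Q (q + 1)"
proof (rule cut_eq_0)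
  show "rel_coboundary P q c \<in> rel_cochains P (\<lambda>_. {}) (q + 1)"
    using coboundary_in[OF rel_cochains_in_cochains[OF P c]] face_closed_family_sub[OF P, of _ "q + 1"]
    by (auto simp: rel_coboundary_def cut_def rel_cochains_def cochains_def)
  show "cut (Q (q + 1)) (rel_coboundary P q c) = 0"
    unfolding cut_rel_coboundary[OF Q QP] cut_rel[OF c] using Q by simp
  show "{} \<subseteq> Q (q + 1)" by simp
qed

lemma rel_coboundary_rel_coboundary:
  assumes P: "face_closed P" and c: "c \<in> rel_cochains P Q q"
  shows "rel_coboundary P (q + 1) (rel_coboundary P q c) = 0"
proof -
  have "rel_coboundary P (q + 1) (rel_coboundary P q c) = cut (P (q + 1 + 1)) (coboundary sc S L (q + 1) (coboundary sc S L q c))"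
    using cut_rel_coboundary[OF P order_refl, of "q + 1" "coboundary sc S L q c"]
    by (simp add: rel_coboundary_def cut_cut)
  then show ?thesis
    using coboundary_coboundary[OF rel_cochains_in_cochains[OF P c]] by simp
qed

section \<open>Isomorphisms of quotients as linear relations\<close>

definition linear_relation :: "(('a, 'v) cochain \<times> ('a, 'v) cochain) set \<Rightarrow> bool" where
  "linear_relation R \<longleftrightarrow>
     (\<forall>x y x' y'. (x, y) \<in> R \<longrightarrow> (x', y') \<in> R \<longrightarrow> (x + x', y + y') \<in> R) \<and>
     (\<forall>a x y. (x, y) \<in> R \<longrightarrow> (cochain_scale a x, cochain_scale a y) \<in> R)"

text \<open>The equivalence of \<open>x \<in> B\<^sub>1\<close> and
  \<open>y \<in> B\<^sub>2\<close>, applied to differences of related pairs, makes the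
  correspondence of classes both well defined and injective; totality on both sides does the
  rest.\<close>

definition quotients_isomorphic where
  "quotients_isomorphic Z\<^sub>1 B\<^sub>1 Z\<^sub>2 B\<^sub>2 \<longleftrightarrow>
     (\<exists>R. linear_relation R \<and> R \<subseteq> Z\<^sub>1 \<times> Z\<^sub>2 \<and> (\<forall>x\<in>Z\<^sub>1. \<exists>y. (x, y) \<in> R) \<and> (\<forall>y\<in>Z\<^sub>2. \<exists>x. (x, y) \<in> R) \<and>
          (\<forall>x y. (x, y) \<in> R \<longrightarrow> (x \<in> B\<^sub>1 \<longleftrightarrow> y \<in> B\<^sub>2)))"

lemma quotients_isomorphic_sym:
  assumes "quotients_isomorphic Z\<^sub>1 B\<^sub>1 Z\<^sub>2 B\<^sub>2"
  shows "quotients_isomorphic Z\<^sub>2 B\<^sub>2 Z\<^sub>1 B\<^sub>1"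
proof -
  obtain R where "linear_relation R" "R \<subseteq> Z\<^sub>1 \<times> Z\<^sub>2" "\<forall>x\<in>Z\<^sub>1. \<exists>y. (x, y) \<in> R" "\<forall>y\<in>Z\<^sub>2. \<exists>x. (x, y) \<in> R"
    "\<forall>x y. (x, y) \<in> R \<longrightarrow> (x \<in> B\<^sub>1 \<longleftrightarrow> y \<in> B\<^sub>2)"
    using assms unfolding quotients_isomorphic_def by blast
  then show ?thesis
    unfolding quotients_isomorphic_def by (intro exI[of _ "R\<inverse>"]) (auto simp: linear_relation_def)
qed

lemma quotients_isomorphic_trans:
  assumes "quotients_isomorphic Z\<^sub>1 B\<^sub>1 Z\<^sub>2 B\<^sub>2" "quotients_isomorphic Z\<^sub>2 B\<^sub>2 Z\<^sub>3 B\<^sub>3"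
  shows "quotients_isomorphic Z\<^sub>1 B\<^sub>1 Z\<^sub>3 B\<^sub>3"
proof -
  obtain R where R: "linear_relation R" "R \<subseteq> Z\<^sub>1 \<times> Z\<^sub>2" "\<forall>x\<in>Z\<^sub>1. \<exists>y. (x, y) \<in> R" "\<forall>y\<in>Z\<^sub>2. \<exists>x. (x, y) \<in> R"
    "\<forall>x y. (x, y) \<in> R \<longrightarrow> (x \<in> B\<^sub>1 \<longleftrightarrow> y \<in> B\<^sub>2)"
    using assms(1) unfolding quotients_isomorphic_def by blast
  obtain T where T: "linear_relation T" "T \<subseteq> Z\<^sub>2 \<times> Z\<^sub>3" "\<forall>x\<in>Z\<^sub>2. \<exists>y. (x, y) \<in> T" "\<forall>y\<in>Z\<^sub>3. \<exists>x. (x, y) \<in> T"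
    "\<forall>x y. (x, y) \<in> T \<longrightarrow> (x \<in> B\<^sub>2 \<longleftrightarrow> y \<in> B\<^sub>3)"
    using assms(2) unfolding quotients_isomorphic_def by blast
  have "linear_relation (R O T)"
    using R(1) T(1) unfolding linear_relation_def by (meson relcomp.simps)
  moreover have "R O T \<subseteq> Z\<^sub>1 \<times> Z\<^sub>3" using R(2) T(2) by blast
  moreover have "\<forall>x\<in>Z\<^sub>1. \<exists>y. (x, y) \<in> R O T" using R(2,3) T(3) by fast
  moreover have "\<forall>y\<in>Z\<^sub>3. \<exists>x. (x, y) \<in> R O T" using R(4) T(2,4) by fast
  moreover have "\<forall>x y. (x, y) \<in> R O T \<longrightarrow> (x \<in> B\<^sub>1 \<longleftrightarrow> y \<in> B\<^sub>3)" using R(5) T(5) by blast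
  ultimately show ?thesis unfolding quotients_isomorphic_def by blast
qed

definition acyclic_pair where
  "acyclic_pair P Q \<longleftrightarrow> (\<forall>q. rel_cocycles P Q q \<subseteq> rel_coboundaries P Q q)"

lemma acyclic_pairE:
  assumes "acyclic_pair P Q" "c \<in> rel_cochains P Q q" "rel_coboundary P q c = 0"
  obtains b where "b \<in> rel_cochains P Q (q - 1)" "c = rel_coboundary P (q - 1) b"
  using assms unfolding acyclic_pair_def rel_cocycles_def rel_coboundaries_def by blast

text \<open>This is the connecting homomorphism of the triple \<open>R\<close>, \<open>Q\<close>,
  \<open>P\<close>; its neighbours in the long exact sequence are the groups of \<open>P\<close>
  relative to \<open>R\<close>, which vanish.\<close>

lemma isomorphic_connecting:
  assumes P: "face_closed P" and Q: "face_closed Q" and R: "face_closed R"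
    and QP: "\<And>q. Q q \<subseteq> P q" and RQ: "\<And>q. R q \<subseteq> Q q" and acyclic: "acyclic_pair P R"
  shows "quotients_isomorphic (rel_cocycles Q R q) (rel_coboundaries Q R q)
            (rel_cocycles P Q (q + 1)) (rel_coboundaries P Q (q + 1))"
proof -
  have RP: "\<And>q. R q \<subseteq> P q" using QP RQ by blast
  note mono = rel_cochains_mono[OF P QP RQ, THEN subsetD]
  let ?T = "{(z, w). z \<in> rel_cocycles Q R q \<and>
     (\<exists>c\<in>rel_cochains P R q. cut (Q q) c = z \<and> w = rel_coboundary P q c)}"
  have "linear_relation ?T"
    unfolding linear_relation_def
  proof (intro conjI allI impI)
    fix x y x' y' assume "(x, y) \<in> ?T" "(x', y') \<in> ?T"
    then obtain c c' where c: "c \<in> rel_cochains P R q" "cut (Q q) c = x" "y = rel_coboundary P q c"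
      and c': "c' \<in> rel_cochains P R q" "cut (Q q) c' = x'" "y' = rel_coboundary P q c'"
      and x: "x \<in> rel_cocycles Q R q" "x' \<in> rel_cocycles Q R q"
      by auto
    have "x + x' \<in> rel_cocycles Q R q"
      using x by (auto simp: rel_cocycles_def rel_cochains_add[OF Q] rel_coboundary_add[OF Q])
    then show "(x + x', y + y') \<in> ?T"
      using c c' by (auto intro!: bexI[of _ "c + c'"] simp: cut_add rel_coboundary_add[OF P c(1) c'(1)] rel_cochains_add[OF P])
  next
    fix a x y assume "(x, y) \<in> ?T"
    then obtain c where c: "c \<in> rel_cochains P R q" "cut (Q q) c = x" "y = rel_coboundary P q c"
      and x: "x \<in> rel_cocycles Q R q" by auto
    have "cochain_scale a x \<in> rel_cocycles Q R q"
      using x by (auto simp: rel_cocycles_def rel_cochains_scale[OF Q] rel_coboundary_scale[OF Q] fun_eq_iff)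
    then show "(cochain_scale a x, cochain_scale a y) \<in> ?T"
      using c by (auto intro!: bexI[of _ "cochain_scale a c"] simp: cut_scale rel_coboundary_scale[OF P c(1)] rel_cochains_scale[OF P])
  qed
  moreover have "?T \<subseteq> rel_cocycles Q R q \<times> rel_cocycles P Q (q + 1)"
  proof
    fix p assume "p \<in> ?T"
    then obtain c where c: "c \<in> rel_cochains P R q" and z: "cut (Q q) c \<in> rel_cocycles Q R q"
      and p: "p = (cut (Q q) c, rel_coboundary P q c)" by auto
    have "cut (Q (q + 1)) (rel_coboundary P q c) = 0"
      using z unfolding cut_rel_coboundary[OF Q QP] rel_cocycles_def by simp
    then show "p \<in> rel_cocycles Q R q \<times> rel_cocycles P Q (q + 1)"
      using cut_eq_0[where Q = Q and R = R, OF rel_coboundary_in[OF P R RP c] _ RQ] rel_coboundary_rel_coboundary[OF P c] z p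
      by (auto simp: rel_cocycles_def)
  qed
  moreover have "\<exists>y. (x, y) \<in> ?T" if "x \<in> rel_cocycles Q R q" for x
    using that mono(2)[of x q] cut_same[of x Q R q] by (auto simp: rel_cocycles_def)
  \<comment> \<open>Acyclicity gives a primitive \<open>c\<close> of \<open>y\<close> on
    \<open>P\<close>; restricted to \<open>Q\<close> it is a cocycle, since \<open>y\<close>
    vanishes there.\<close>
  moreover have "\<exists>x. (x, y) \<in> ?T" if y: "y \<in> rel_cocycles P Q (q + 1)" for y
  proof -
    have "y \<in> rel_cochains P R (q + 1)" "rel_coboundary P (q + 1) y = 0"
      using y mono(1) by (auto simp: rel_cocycles_def)
    then obtain c where c: "c \<in> rel_cochains P R q" "y = rel_coboundary P q c"
      using acyclic by (elim acyclic_pairE) auto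
    have "rel_coboundary Q q (cut (Q q) c) = 0"
      using y unfolding cut_rel_coboundary[OF Q QP, symmetric] c(2)[symmetric] rel_cocycles_def
      by (auto simp: cut_rel)
    then show ?thesis using c cut_in[OF QP c(1)] by (auto simp: rel_cocycles_def)
  qed
  moreover have "x \<in> rel_coboundaries Q R q \<longleftrightarrow> y \<in> rel_coboundaries P Q (q + 1)" if "(x, y) \<in> ?T" for x y
  proof -
    from that obtain c where c: "c \<in> rel_cochains P R q" "cut (Q q) c = x" "y = rel_coboundary P q c" by auto
    show ?thesis
    proof
      assume "x \<in> rel_coboundaries Q R q"
      then obtain b where b: "b \<in> rel_cochains Q R (q - 1)" "x = rel_coboundary Q (q - 1) b"
        by (auto simp: rel_coboundaries_def)
      note bP = mono(2)[OF b(1)]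
      have dbP: "rel_coboundary P (q - 1) b \<in> rel_cochains P R q"
        using rel_coboundary_in[OF P R RP bP] by simp
      have "cut (Q q) (rel_coboundary P (q - 1) b) = x"
        using cut_rel_coboundary[OF Q QP, of "q - 1" b] b cut_same[OF b(1)] QP by simp
      \<comment> \<open>Subtracting the coboundary of the extended primitive makes \<open>c\<close>
        vanish on \<open>Q\<close> and leaves its coboundary unchanged.\<close>
      then have "c - rel_coboundary P (q - 1) b \<in> rel_cochains P Q q"
        using c by (intro cut_eq_0[where Q = Q and R = R, OF rel_cochains_diff[OF P c(1) dbP] _ RQ]) (auto simp: cut_diff)
      moreover have "rel_coboundary P q (c - rel_coboundary P (q - 1) b) = y"
        using rel_coboundary_diff[OF P c(1) dbP] rel_coboundary_rel_coboundary[OF P bP] c(3) by simp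
      ultimately show "y \<in> rel_coboundaries P Q (q + 1)"
        by (auto simp: rel_coboundaries_def)
    next
      assume "y \<in> rel_coboundaries P Q (q + 1)"
      then obtain b where b: "b \<in> rel_cochains P Q q" "y = rel_coboundary P q b"
        by (auto simp: rel_coboundaries_def)
      \<comment> \<open>The difference is a cocycle on \<open>P\<close> relative to
        \<open>R\<close>; its primitive restricts to one of \<open>x\<close>, because
        \<open>b\<close> vanishes on \<open>Q\<close>.\<close>
      have "c - b \<in> rel_cochains P R q" "rel_coboundary P q (c - b) = 0"
        using c b rel_cochains_diff[OF P c(1) mono(1)[OF b(1)]] rel_coboundary_diff[OF P c(1) b(1)] by auto
      then obtain a where a: "a \<in> rel_cochains P R (q - 1)" "c - b = rel_coboundary P (q - 1) a"
        using acyclic by (elim acyclic_pairE)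
      have "x = cut (Q q) (c - b)" using c cut_rel[OF b(1)] by (simp add: cut_diff)
      also have "\<dots> = rel_coboundary Q (q - 1) (cut (Q (q - 1)) a)"
        using cut_rel_coboundary[OF Q QP, of "q - 1" a] QP a(2) by simp
      finally show "x \<in> rel_coboundaries Q R q"
        using cut_in[OF QP a(1)] by (auto simp: rel_coboundaries_def)
    qed
  qed
  ultimately show ?thesis
    unfolding quotients_isomorphic_def by (intro exI[of _ ?T]) blast
qed

text \<open>In the sequence of the triple \<open>R\<close>, \<open>Q\<close>, \<open>P\<close> the
  groups of \<open>P\<close> relative to \<open>Q\<close> vanish, which leaves restriction
  bijective.\<close>

lemma isomorphic_restriction:
  assumes P: "face_closed P" and Q: "face_closed Q" and R: "face_closed R"
    and QP: "\<And>q. Q q \<subseteq> P q" and RQ: "\<And>q. R q \<subseteq> Q q" and acyclic: "acyclic_pair P Q"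
  shows "quotients_isomorphic (rel_cocycles P R q) (rel_coboundaries P R q)
            (rel_cocycles Q R q) (rel_coboundaries Q R q)"
proof -
  have RP: "\<And>q. R q \<subseteq> P q" using QP RQ by blast
  note mono = rel_cochains_mono[OF P QP RQ, THEN subsetD]
  let ?T = "{(z, w). z \<in> rel_cocycles P R q \<and> w = cut (Q q) z}"
  have "linear_relation ?T"
    using rel_cochains_add[OF P] rel_coboundary_add[OF P] rel_cochains_scale[OF P] rel_coboundary_scale[OF P]
    by (auto simp: linear_relation_def rel_cocycles_def cut_add cut_scale fun_eq_iff)
  moreover have "?T \<subseteq> rel_cocycles P R q \<times> rel_cocycles Q R q"
    using cut_in[OF QP] Q by (auto simp: rel_cocycles_def cut_rel_coboundary[OF Q QP, symmetric])
  moreover have "\<exists>x. (x, y) \<in> ?T" if y: "y \<in> rel_cocycles Q R q" for y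
  proof -
    have y0: "y \<in> rel_cochains Q R q" "rel_coboundary Q q y = 0" using y by (auto simp: rel_cocycles_def)
    note yP = mono(2)[OF y0(1)]
    \<comment> \<open>The extension of \<open>y\<close> by zero need not be a cocycle, but its
      coboundary vanishes on \<open>Q\<close>; acyclicity corrects it by a cochain \<open>b\<close>
      that is zero on \<open>Q\<close>.\<close>
    have "rel_coboundary P q y \<in> rel_cochains P Q (q + 1)"
      using cut_rel_coboundary[OF Q QP, of q y] y0 cut_same[OF y0(1)] QP
      by (intro cut_eq_0[where Q = Q and R = R, OF rel_coboundary_in[OF P R RP yP] _ RQ]) simp
    then obtain b where b: "b \<in> rel_cochains P Q q" "rel_coboundary P q y = rel_coboundary P q b"
      using acyclic rel_coboundary_rel_coboundary[OF P yP] by (elim acyclic_pairE) auto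
    have "y - b \<in> rel_cocycles P R q"
      using rel_cochains_diff[OF P yP mono(1)[OF b(1)]] rel_coboundary_diff[OF P yP b(1)] b(2)
      by (auto simp: rel_cocycles_def)
    moreover have "cut (Q q) (y - b) = y"
      using cut_same[OF y0(1)] cut_rel[OF b(1)] by (simp add: cut_diff)
    ultimately show ?thesis by auto
  qed
  moreover have "x \<in> rel_coboundaries P R q \<longleftrightarrow> y \<in> rel_coboundaries Q R q" if "(x, y) \<in> ?T" for x y
  proof -
    from that have x: "x \<in> rel_cochains P R q" "rel_coboundary P q x = 0" and y: "y = cut (Q q) x"
      by (auto simp: rel_cocycles_def)
    show ?thesis
    proof
      assume "x \<in> rel_coboundaries P R q"
      then obtain b where b: "b \<in> rel_cochains P R (q - 1)" "x = rel_coboundary P (q - 1) b"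
        by (auto simp: rel_coboundaries_def)
      have "y = rel_coboundary Q (q - 1) (cut (Q (q - 1)) b)"
        using cut_rel_coboundary[OF Q QP, of "q - 1" b] QP b y by simp
      then show "y \<in> rel_coboundaries Q R q"
        using cut_in[OF QP b(1)] by (auto simp: rel_coboundaries_def)
    next
      assume "y \<in> rel_coboundaries Q R q"
      then obtain b where b: "b \<in> rel_cochains Q R (q - 1)" "y = rel_coboundary Q (q - 1) b"
        by (auto simp: rel_coboundaries_def)
      note bP = mono(2)[OF b(1)]
      have dbP: "rel_coboundary P (q - 1) b \<in> rel_cochains P R q"
        using rel_coboundary_in[OF P R RP bP] by simp
      have "cut (Q q) (rel_coboundary P (q - 1) b) = y"
        using cut_rel_coboundary[OF Q QP, of "q - 1" b] b cut_same[OF b(1)] QP by simp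
      \<comment> \<open>The extension of \<open>b\<close> by zero is a primitive of \<open>x\<close>
        up to a cocycle vanishing on \<open>Q\<close>; acyclicity supplies the missing part
        \<open>a\<close>.\<close>
      then have "x - rel_coboundary P (q - 1) b \<in> rel_cochains P Q q"
        using y by (intro cut_eq_0[where Q = Q and R = R, OF rel_cochains_diff[OF P x(1) dbP] _ RQ]) (auto simp: cut_diff)
      moreover have "rel_coboundary P q (x - rel_coboundary P (q - 1) b) = 0"
        using rel_coboundary_diff[OF P x(1) dbP] rel_coboundary_rel_coboundary[OF P bP] x(2) by simp
      ultimately obtain a where a: "a \<in> rel_cochains P Q (q - 1)"
          "x - rel_coboundary P (q - 1) b = rel_coboundary P (q - 1) a"
        using acyclic by (elim acyclic_pairE)
      have "x = rel_coboundary P (q - 1) (a + b)"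
        using rel_coboundary_add[OF P a(1) bP] a(2) by (simp add: algebra_simps)
      then show "x \<in> rel_coboundaries P R q"
        using rel_cochains_add[OF P mono(1)[OF a(1)] bP] by (auto simp: rel_coboundaries_def)
    qed
  qed
  ultimately show ?thesis
    unfolding quotients_isomorphic_def by (intro exI[of _ ?T]) blast
qed

lemma face_closed_Un: "face_closed P \<Longrightarrow> face_closed Q \<Longrightarrow> face_closed (\<lambda>q. P q \<union> Q q)"
  by (auto simp: face_closed_def)

text \<open>For unions of families excision is an equality: on both sides the cochains are those
  supported on \<open>P\<close> outside \<open>Q\<close>.\<close>

lemma excision_families:
  assumes P: "face_closed P" and Q: "face_closed Q"
  shows "rel_cocycles (\<lambda>q. P q \<union> Q q) Q q = rel_cocycles P (\<lambda>q. P q \<inter> Q q) q"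
    and "rel_coboundaries (\<lambda>q. P q \<union> Q q) Q q = rel_coboundaries P (\<lambda>q. P q \<inter> Q q) q"
proof -
  let ?U = "\<lambda>q. P q \<union> Q q" and ?I = "\<lambda>q. P q \<inter> Q q"
  have C: "rel_cochains ?U Q q = rel_cochains P ?I q" for q
  proof -
    have "P q \<union> Q q - Q q = P q - P q \<inter> Q q" by blast
    then show ?thesis unfolding rel_cochains_def by simp
  qed
  \<comment> \<open>The two coboundaries could differ only on simplices in \<open>Q\<close> and not
    in \<open>P\<close>, and there the left one vanishes because \<open>Q\<close> is face
    closed.\<close>
  have D: "rel_coboundary ?U q c = rel_coboundary P q c" if "c \<in> rel_cochains ?U Q q" for q c
  proof -
    have "cut (Q (q + 1)) (rel_coboundary ?U q c) = 0"
      using rel_coboundary_in[OF face_closed_Un[OF P Q] Q _ that] by (intro cut_rel) auto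
    then show ?thesis
      by (auto simp: rel_coboundary_def cut_def fun_eq_iff split: if_splits)
  qed
  show "rel_cocycles ?U Q q = rel_cocycles P ?I q"
    unfolding rel_cocycles_def using C D by auto
  show "rel_coboundaries ?U Q q = rel_coboundaries P ?I q"
    unfolding rel_coboundaries_def C[symmetric] using D by (intro image_cong) auto
qed

lemma face_closed_family: "B \<subseteq> S \<Longrightarrow> face_closed (family B)"
  unfolding face_closed_def family_nat
  by (auto simp: family_def simplex_of_degree_def intro: singular_simplex_mono face_simplex)

lemma family_Int: "family (A \<inter> B) = (\<lambda>q. family A q \<inter> family B q)"
  by (auto simp: family_def simplex_of_degree_def singular_simplex_top_of_set fun_eq_iff)

lemma family_mono: "A \<subseteq> B \<Longrightarrow> family A q \<subseteq> family B q"
  by (auto simp: family_def simplex_of_degree_def singular_simplex_top_of_set)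

end

subsection \<open>Prisms and iterated subdivision\<close>

text \<open>Only the coefficients \<open>1\<close> and \<open>-1\<close> occur, so compatibility
  with differences suffices.\<close>

lemma additive_alternating_sum:
  assumes diff: "\<And>a b. h (a - b) = h a - (h b :: 'c \<Rightarrow>\<^sub>0 int)"
  shows "h (\<Sum>k\<in>I. frag_cmul ((-1) ^ k) (g k)) = (\<Sum>k\<in>I. frag_cmul ((-1) ^ k) (h (g k)))"
proof -
  have 0: "h 0 = 0" using diff[of 0 0] by simp
  have minus: "h (- a) = - h a" for a using diff[of 0 a] 0 by simp
  have add: "h (a + b) = h a + h b" for a b using diff[of a "- b"] minus by simp
  have pm: "h (frag_cmul ((-1) ^ k) a) = frag_cmul ((-1) ^ k) (h a)" for k a
    by (cases "even k") (auto simp: minus)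
  show ?thesis by (induction I rule: infinite_finite_induct) (auto simp: 0 add pm)
qed

text \<open>Contracting \<open>Y\<close> to \<open>y\<close> makes \<open>z\<close> homologous to
  its image in a point. In positive degree that image bounds; in degree \<open>0\<close> it is the
  coefficient sum of \<open>z\<close> times one constant simplex, so \<open>aug\<close> says that
  the augmentation is zero.\<close>

lemma segment_closed_cycle_is_boundary:
  assumes Y: "segment_closed Y" "y \<in> Y" and z: "singular_chain p (top_of_set Y) z" "chain_boundary p z = 0"
    and aug: "p = 0 \<Longrightarrow> chain_map 0 (\<lambda>_. y) z = 0"
  shows "\<exists>K. singular_chain (Suc p) (top_of_set Y) K \<and> chain_boundary (Suc p) K = z"
proof -
  let ?X = "top_of_set Y"
  have "homotopic_with (\<lambda>h. h \<in> {} \<rightarrow> {}) ?X ?X id (\<lambda>_. y)"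
  proof -
    let ?h = "\<lambda>z. segment_path (snd z) y (fst z)"
    have "continuous_on ({0..1} \<times> Y) ?h"
      unfolding segment_path_def
      by (intro continuous_on_coordinatewise_then_product continuous_on_add continuous_on_mult
          continuous_on_diff continuous_on_const continuous_on_fst continuous_on_id
          continuous_on_product_then_coordinatewise[OF continuous_on_snd[OF continuous_on_id]])
    then have "continuous_map (prod_topology (top_of_set {0..1}) ?X) ?X ?h"
      using Y by (auto simp: segment_closed_def prod_topology_subtopology_eu)
    then show ?thesis
      by (auto simp: homotopic_with_def intro!: exI[of _ ?h])
  qed
  moreover have "singular_relcycle p ?X {} z"
    using z by (simp add: singular_cycle)
  ultimately have "homologous_rel p ?X {} (chain_map p id z) (chain_map p (\<lambda>_. y) z)"
    by (rule homotopic_imp_homologous_rel_chain_maps)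
  then obtain K where K: "singular_chain (Suc p) ?X K" "chain_boundary (Suc p) K = z - chain_map p (\<lambda>_. y) z"
    using chain_map_ident[OF z(1)] by (auto simp: homologous_rel_def singular_boundary)
  have "\<exists>K'. singular_chain (Suc p) ?X K' \<and> chain_boundary (Suc p) K' = chain_map p (\<lambda>_. y) z"
  proof (cases "p = 0")
    case True
    then show ?thesis using aug by (intro exI[of _ 0]) auto
  next
    case False
    let ?P = "top_of_set {y}"
    have "singular_relcycle p ?P {} (chain_map p (\<lambda>_. y) z)"
      using z singular_chain_chain_map[OF z(1), of ?P "\<lambda>_. y"] chain_boundary_chain_map[OF z(1), of "\<lambda>_. y"]
      by (auto simp: singular_cycle)
    then have "singular_relboundary p ?P {} (chain_map p (\<lambda>_. y) z)"
      using False by (subst singular_boundary_eq_cycle_singleton[of _ y]) auto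
    then show ?thesis
      using singular_chain_mono[of "Suc p" euclidean "{y}" _ Y] Y(2) by (auto simp: singular_boundary)
  qed
  then obtain K' where "singular_chain (Suc p) ?X K'" "chain_boundary (Suc p) K' = chain_map p (\<lambda>_. y) z" by blast
  then show ?thesis
    using K by (intro exI[of _ "K + K'"]) (auto simp: singular_chain_add chain_boundary_add)
qed

text \<open>The product of the unit interval with the simplex, coded in the sequence space of the
  simplex itself so that it can serve as a model: coordinate \<open>0\<close> is time and the
  simplex coordinates are shifted by one.\<close>

definition cylinder :: "nat \<Rightarrow> (nat \<Rightarrow> real) set" where
  "cylinder p = {y. y 0 \<in> {0..1} \<and> (\<lambda>i. y (Suc i)) \<in> standard_simplex p}"

definition cylinder_map :: "((nat \<Rightarrow> real) \<Rightarrow> nat \<Rightarrow> real) \<Rightarrow> (nat \<Rightarrow> real) \<Rightarrow> nat \<Rightarrow> real" where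
  "cylinder_map f y = case_nat (y 0) (f (\<lambda>i. y (Suc i)))"

lemma case_nat_in_cylinder: "t \<in> {0..1} \<Longrightarrow> x \<in> standard_simplex p \<Longrightarrow> case_nat t x \<in> cylinder p"
  by (simp add: cylinder_def)

lemma segment_closed_cylinder: "segment_closed (cylinder p)"
proof -
  have "segment_path x y t \<in> cylinder p" if "x \<in> cylinder p" "y \<in> cylinder p" "t \<in> {0..1}" for x y t
  proof -
    have "(\<lambda>i. segment_path x y t (Suc i)) = segment_path (\<lambda>i. x (Suc i)) (\<lambda>i. y (Suc i)) t"
      by (simp add: segment_path_def)
    then show ?thesis
      using that segment_closed_simplex[of p]
      by (auto simp: cylinder_def segment_closed_def segment_path_def convex_bound_le)
  qed
  then show ?thesis by (auto simp: segment_closed_def)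
qed

lemma continuous_on_tail: "continuous_on A (\<lambda>y::nat \<Rightarrow> real. \<lambda>i. y (Suc i))"
  by (intro continuous_on_coordinatewise_then_product continuous_on_subset[OF continuous_on_product_coordinates]) simp

lemma continuous_on_case_nat:
  fixes f :: "'a::topological_space \<Rightarrow> nat \<Rightarrow> real"
  assumes "continuous_on A t" "continuous_on A f"
  shows "continuous_on A (\<lambda>x. case_nat (t x) (f x))"
proof (rule continuous_on_coordinatewise_then_product)
  show "continuous_on A (\<lambda>x. case_nat (t x) (f x) i)" for i
    using assms continuous_on_product_then_coordinatewise[OF assms(2)] by (cases i) auto
qed

lemma continuous_on_cylinder_map:
  assumes "continuous_on (standard_simplex p) f"
  shows "continuous_on (cylinder p) (cylinder_map f)"
  unfolding cylinder_map_def
  by (intro continuous_on_case_nat continuous_on_compose2[OF assms continuous_on_tail]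
      continuous_on_subset[OF continuous_on_product_coordinates]) (auto simp: cylinder_def)

lemma cylinder_map_maps:
  assumes "f ` standard_simplex p \<subseteq> standard_simplex n"
  shows "cylinder_map f ` cylinder p \<subseteq> cylinder n"
  using assms by (auto simp: cylinder_map_def cylinder_def)

lemma cylinder_map_case_nat: "cylinder_map f \<circ> case_nat t = case_nat t \<circ> f"
  by (auto simp: cylinder_map_def)

abbreviation simplex_top :: "nat \<Rightarrow> (nat \<Rightarrow> real) topology" where
  "simplex_top p \<equiv> top_of_set (standard_simplex p)"

abbreviation cylinder_top :: "nat \<Rightarrow> (nat \<Rightarrow> real) topology" where
  "cylinder_top p \<equiv> top_of_set (cylinder p)"

abbreviation identity_chain :: "nat \<Rightarrow> (nat \<Rightarrow> real) chain" where
  "identity_chain p \<equiv> frag_of (identity_simplex p)"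

text \<open>With \<open>K\<close> the prism this is the product of a chain with the interval: one
  copy of \<open>K\<close> for each simplex \<open>f\<close>, carried along
  \<open>cylinder_map f\<close>.\<close>

definition cylinder_chain :: "nat \<Rightarrow> (nat \<Rightarrow> real) chain \<Rightarrow> (nat \<Rightarrow> real) chain \<Rightarrow> (nat \<Rightarrow> real) chain" where
  "cylinder_chain p K = frag_extend (\<lambda>f. chain_map (Suc p) (cylinder_map f) K)"

text \<open>Chains as chosen here exist because the prescribed boundary is a cycle in a contractible model;
  this is shown by induction in \<open>good_prism\<close>.\<close>

primrec prism :: "nat \<Rightarrow> (nat \<Rightarrow> real) chain" where
  "prism 0 = (SOME K. singular_chain 1 (cylinder_top 0) K \<and> chain_boundary 1 K =
     chain_map 0 (case_nat 1) (identity_chain 0) - chain_map 0 (case_nat 0) (identity_chain 0))"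
| "prism (Suc p) = (SOME K. singular_chain (Suc (Suc p)) (cylinder_top (Suc p)) K \<and> chain_boundary (Suc (Suc p)) K =
     chain_map (Suc p) (case_nat 1) (identity_chain (Suc p)) - chain_map (Suc p) (case_nat 0) (identity_chain (Suc p))
     - cylinder_chain p (prism p) (chain_boundary (Suc p) (identity_chain (Suc p))))"

definition prism_sides :: "nat \<Rightarrow> (nat \<Rightarrow> real) chain \<Rightarrow> (nat \<Rightarrow> real) chain" where
  "prism_sides p c = (if p = 0 then 0 else cylinder_chain (p - 1) (prism (p - 1)) (chain_boundary p c))"

definition good_prism :: "nat \<Rightarrow> bool" where
  "good_prism p \<longleftrightarrow> singular_chain (Suc p) (cylinder_top p) (prism p) \<and> chain_boundary (Suc p) (prism p) =
     chain_map p (case_nat 1) (identity_chain p) - chain_map p (case_nat 0) (identity_chain p)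
     - prism_sides p (identity_chain p)"

lemma cylinder_chain_diff: "cylinder_chain p K (a - b) = cylinder_chain p K a - cylinder_chain p K b"
  by (simp add: cylinder_chain_def frag_extend_diff)

lemma cylinder_chain_of [simp]: "cylinder_chain p K (frag_of f) = chain_map (Suc p) (cylinder_map f) K"
  by (simp add: cylinder_chain_def)

lemma cylinder_chain_0 [simp]: "cylinder_chain p K 0 = 0"
  by (simp add: cylinder_chain_def)

lemma prism_sides_0 [simp]: "prism_sides p 0 = 0"
  by (simp add: prism_sides_def)

lemma prism_sides_diff: "prism_sides p (a - b) = prism_sides p a - prism_sides p b"
  by (simp add: prism_sides_def chain_boundary_diff cylinder_chain_diff)

lemma singular_chain_cylinder_map:
  assumes K: "singular_chain q (cylinder_top p) K" and f: "singular_simplex p (simplex_top n) f"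
  shows "singular_chain q (cylinder_top n) (chain_map q (cylinder_map f) K)"
  using f continuous_on_cylinder_map[of p f] cylinder_map_maps[of f p n]
  by (intro singular_chain_chain_map[OF K]) (auto simp: singular_simplex_top_of_set)

lemma singular_chain_cylinder_chain:
  assumes "singular_chain (Suc p) (cylinder_top p) K" and "singular_chain p (simplex_top n) c"
  shows "singular_chain (Suc p) (cylinder_top n) (cylinder_chain p K c)"
  unfolding cylinder_chain_def
  using assms by (intro singular_chain_extend singular_chain_cylinder_map) (auto simp: singular_chain_def)

lemma cylinder_chain_natural:
  assumes K: "singular_chain (Suc p) (cylinder_top p) K" and c: "singular_chain p (simplex_top n) c"
  shows "chain_map (Suc p) (cylinder_map f) (cylinder_chain p K c) = cylinder_chain p K (chain_map p f c)"
  using c unfolding singular_chain_def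
proof (induction c rule: frag_induction)
  case (one g)
  have "chain_map (Suc p) (cylinder_map f \<circ> cylinder_map g) K = chain_map (Suc p) (cylinder_map (simplex_map p f g)) K"
    by (rule chain_map_eq[OF K]) (auto simp: cylinder_map_def simplex_map_def cylinder_def)
  then show ?case by (simp add: chain_map_compose)
qed (auto simp: chain_map_diff cylinder_chain_diff)

lemma identity_chain_in: "singular_chain p (simplex_top p) (identity_chain p)"
  by (simp add: singular_chain_of identity_simplex)

text \<open>Naturality carries the formula from the identity simplex over to each \<open>f\<close>.
  Assuming \<open>good_prism\<close> only in dimensions \<open>p\<close> and \<open>p - 1\<close>
  makes this usable inside the induction that establishes it.\<close>

lemma boundary_cylinder_chain:
  assumes good: "good_prism p" "p > 0 \<Longrightarrow> good_prism (p - 1)" and c: "singular_chain p (simplex_top n) c"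
  shows "chain_boundary (Suc p) (cylinder_chain p (prism p) c) =
    chain_map p (case_nat 1) c - chain_map p (case_nat 0) c - prism_sides p c"
  using c unfolding singular_chain_def
proof (induction c rule: frag_induction)
  case (one f)
  then have f: "singular_simplex p (simplex_top n) f" by simp
  have K: "singular_chain (Suc p) (cylinder_top p) (prism p)"
    and dK: "chain_boundary (Suc p) (prism p) =
     chain_map p (case_nat 1) (identity_chain p) - chain_map p (case_nat 0) (identity_chain p)
     - prism_sides p (identity_chain p)"
    using good by (auto simp: good_prism_def)
  have e: "chain_map p (cylinder_map f) (chain_map p (case_nat t) (identity_chain p)) = chain_map p (case_nat t) (frag_of f)" for t
  proof -
    have "chain_map p (cylinder_map f) (chain_map p (case_nat t) (identity_chain p))
       = chain_map p (case_nat t) (chain_map p f (identity_chain p))"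
      using fun_cong[OF chain_map_compose[of p "cylinder_map f" "case_nat t"], of "identity_chain p"]
        fun_cong[OF chain_map_compose[of p "case_nat t" f], of "identity_chain p"]
      unfolding cylinder_map_case_nat by (simp only: o_def)
    then show ?thesis using simplex_map_identity[OF f] by simp
  qed
  have s: "chain_map p (cylinder_map f) (prism_sides p (identity_chain p)) = prism_sides p (frag_of f)"
  proof (cases p)
    case (Suc m)
    have "singular_chain m (simplex_top p) (chain_boundary (Suc m) (identity_chain (Suc m)))"
      using singular_chain_boundary_alt[OF identity_chain_in[of "Suc m"]] Suc by simp
    moreover have "singular_chain (Suc m) (cylinder_top m) (prism m)"
      using good(2) Suc by (simp add: good_prism_def)
    ultimately have "chain_map p (cylinder_map f) (prism_sides p (identity_chain p)) =
       cylinder_chain m (prism m) (chain_map m f (chain_boundary (Suc m) (identity_chain (Suc m))))"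
      unfolding prism_sides_def Suc by (simp add: cylinder_chain_natural)
    also have "chain_map m f (chain_boundary (Suc m) (identity_chain (Suc m))) = chain_boundary (Suc m) (frag_of f)"
      using chain_boundary_chain_map[OF identity_chain_in[of "Suc m"], of f] f
        simplex_map_identity[OF f] Suc by simp
    finally show ?thesis by (simp add: prism_sides_def Suc)
  qed (simp add: prism_sides_def)
  show ?case
    using chain_boundary_chain_map[OF K, of "cylinder_map f"]
    by (simp only: cylinder_chain_of dK chain_map_diff e s diff_Suc_1 diff_Suc_Suc One_nat_def diff_zero)
qed (auto simp: chain_boundary_diff cylinder_chain_diff chain_map_diff prism_sides_diff)

lemma case_nat_continuous: "t \<in> {0..1} \<Longrightarrow> continuous_map (simplex_top p) (cylinder_top p) (case_nat t)"
  using case_nat_in_cylinder by (auto intro!: continuous_on_case_nat)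

lemma good_prism: "good_prism p"
proof (induction p rule: less_induct)
  case (less p)
  show ?case
  proof (cases p)
    case 0
    let ?z = "chain_map 0 (case_nat 1) (identity_chain 0) - chain_map 0 (case_nat 0) (identity_chain 0)"
    have v: "case_nat 0 (vertex 0) \<in> cylinder 0" by (intro case_nat_in_cylinder) auto
    \<comment> \<open>In dimension \<open>0\<close> the prescribed boundary is a difference of two
      points, whose coefficient sum is zero.\<close>
    have "\<exists>K. singular_chain (Suc 0) (cylinder_top 0) K \<and> chain_boundary (Suc 0) K = ?z"
    proof (rule segment_closed_cycle_is_boundary[OF segment_closed_cylinder v])
      show "singular_chain 0 (cylinder_top 0) ?z"
        by (intro singular_chain_diff singular_chain_chain_map[OF identity_chain_in] case_nat_continuous) auto
    qed (auto simp: chain_boundary_def chain_map_diff simplex_map_def fun_eq_iff intro!: arg_cong[of _ _ frag_of])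
    from someI_ex[OF this] show ?thesis
      unfolding good_prism_def 0 prism.simps One_nat_def prism_sides_def by simp
  next
    case (Suc m)
    have good: "good_prism m" "m > 0 \<Longrightarrow> good_prism (m - 1)" using less.IH Suc by auto
    let ?d = "chain_boundary (Suc m) (identity_chain (Suc m))"
    have d: "singular_chain m (simplex_top (Suc m)) ?d"
      by (rule singular_chain_boundary_alt[OF identity_chain_in])
    have dd: "chain_boundary m ?d = 0"
      using chain_boundary_boundary[OF identity_chain_in[of "Suc m"]] by simp
    let ?z = "chain_map (Suc m) (case_nat 1) (identity_chain (Suc m)) - chain_map (Suc m) (case_nat 0) (identity_chain (Suc m))
       - cylinder_chain m (prism m) ?d"
    have v: "case_nat 0 (vertex 0) \<in> cylinder (Suc m)" by (intro case_nat_in_cylinder) auto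
    have "\<exists>K. singular_chain (Suc (Suc m)) (cylinder_top (Suc m)) K \<and> chain_boundary (Suc (Suc m)) K = ?z"
    proof (rule segment_closed_cycle_is_boundary[OF segment_closed_cylinder v])
      show "singular_chain (Suc m) (cylinder_top (Suc m)) ?z"
        using good(1) d
        by (intro singular_chain_diff singular_chain_chain_map[OF identity_chain_in] case_nat_continuous
            singular_chain_cylinder_chain) (auto simp: good_prism_def)
      \<comment> \<open>The sides have no sides of their own, as the boundary of a boundary
        vanishes; the rest of their boundary cancels against that of top and bottom.\<close>
      have "prism_sides m ?d = 0" using dd by (simp add: prism_sides_def cylinder_chain_def)
      then have "chain_boundary (Suc m) (cylinder_chain m (prism m) ?d) = chain_map m (case_nat 1) ?d - chain_map m (case_nat 0) ?d"
        using boundary_cylinder_chain[OF good d] by simp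
      moreover have "chain_boundary (Suc m) (chain_map (Suc m) g (identity_chain (Suc m))) = chain_map m g ?d" for g :: "_ \<Rightarrow> nat \<Rightarrow> real"
        using chain_boundary_chain_map[OF identity_chain_in[of "Suc m"], of g] by simp
      ultimately show "chain_boundary (Suc m) ?z = 0"
        by (simp only: chain_boundary_diff diff_self)
    qed simp
    from someI_ex[OF this] show ?thesis
      unfolding good_prism_def Suc prism.simps prism_sides_def by simp
  qed
qed

lemma singular_chain_prism: "singular_chain (Suc p) (cylinder_top p) (prism p)"
  using good_prism[of p] by (simp add: good_prism_def)

section \<open>Iterated barycentric subdivision\<close>

definition iterated_subd :: "nat \<Rightarrow> nat \<Rightarrow> (nat \<Rightarrow> real) chain \<Rightarrow> (nat \<Rightarrow> real) chain" where
  "iterated_subd n p c = (\<Sum>j<n. subd p ((simplicial_subdivision p ^^ j) c))"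

lemma simplicial_subdivision_power_diff:
  "(simplicial_subdivision p ^^ j) (a - b) = (simplicial_subdivision p ^^ j) a - (simplicial_subdivision p ^^ j) b"
  by (induction j) (auto simp: simplicial_subdivision_diff)

lemma iterated_subd_diff: "iterated_subd n p (a - b) = iterated_subd n p a - iterated_subd n p b"
  by (simp add: iterated_subd_def simplicial_subdivision_power_diff sum_subtractf)

lemma simplicial_chain_subdivision_power:
  "simplicial_chain p Y c \<Longrightarrow> simplicial_chain p Y ((simplicial_subdivision p ^^ j) c)"
  by (induction j) (auto simp: simplicial_chain_simplicial_subdivision)

lemma boundary_subdivision_power:
  assumes "simplicial_chain p Y c"
  shows "chain_boundary p ((simplicial_subdivision p ^^ j) c) = (simplicial_subdivision (p - 1) ^^ j) (chain_boundary p c)"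
  by (induction j) (auto simp: chain_boundary_simplicial_subdivision[OF simplicial_chain_subdivision_power[OF assms]])

lemma subdivision_power_natural:
  assumes "simplicial_chain p (standard_simplex q) c" "simplicial_simplex q Y g"
  shows "chain_map p g ((simplicial_subdivision p ^^ j) c) = (simplicial_subdivision p ^^ j) (chain_map p g c)"
  by (induction j)
     (auto simp: naturality_simplicial_subdivision[OF simplicial_chain_subdivision_power[OF assms(1)] assms(2), symmetric])

lemma simplicial_chain_iterated_subd:
  assumes "simplicial_chain p (standard_simplex q) c"
  shows "simplicial_chain (Suc p) (standard_simplex q) (iterated_subd n p c)"
  unfolding iterated_subd_def
  by (intro simplicial_chain_sum chain_homotopic_simplicial_subdivision2 simplicial_chain_subdivision_power assms)

text \<open>The summands are the one-step homotopies applied to successive subdivisions, so their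
  boundary formulas telescope to a homotopy from the identity to the \<open>n\<close>-fold
  subdivision.\<close>

lemma boundary_iterated_subd:
  assumes "simplicial_chain p (standard_simplex q) c"
  shows "chain_boundary (Suc p) (iterated_subd n p c) =
    (simplicial_subdivision p ^^ n) c - c - iterated_subd n (p - 1) (chain_boundary p c)"
proof (induction n)
  case 0
  then show ?case by (simp add: iterated_subd_def)
next
  case (Suc n)
  have "iterated_subd (Suc n) r d = iterated_subd n r d + subd r ((simplicial_subdivision r ^^ n) d)" for r d
    by (simp add: iterated_subd_def)
  then show ?case
    using chain_homotopic_simplicial_subdivision3[OF simplicial_chain_subdivision_power[OF assms, of n]]
    by (simp add: chain_boundary_add Suc.IH boundary_subdivision_power[OF assms])
qed

lemma iterated_subd_natural:
  assumes "simplicial_chain p (standard_simplex q) c" "simplicial_simplex q (standard_simplex r) g"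
  shows "chain_map (Suc p) g (iterated_subd n p c) = iterated_subd n p (chain_map p g c)"
  unfolding iterated_subd_def
  by (simp add: chain_map_sum subdivision_power_natural[OF assms, symmetric]
      chain_homotopic_simplicial_subdivision1[OF simplicial_chain_subdivision_power[OF assms(1)] assms(2)])

text \<open>\<open>subd\<close> is natural and hence determined by its value on the identity
  simplex.\<close>

lemma subd_as_pushforward:
  assumes "simplicial_chain p (standard_simplex q) b"
  shows "subd p b = frag_extend (\<lambda>f. chain_map (Suc p) f (subd p (identity_chain p))) b"
  using assms unfolding simplicial_chain_def
proof (induction b rule: frag_induction)
  case (one f)
  then have f: "simplicial_simplex p (standard_simplex q) f" by simp
  have "chain_map (Suc p) f (subd p (identity_chain p)) = subd p (chain_map p f (identity_chain p))"
    using f by (intro chain_homotopic_simplicial_subdivision1[of _ p]) auto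
  then show ?case
    using simplex_map_identity[OF simplicial_imp_singular_simplex[OF f]] by simp
qed (auto simp: frag_extend_diff)

text \<open>This factorisation passes smallness from the simplices of \<open>b\<close> to those of
  the homotopy \<open>subd p b\<close>.\<close>

lemma keys_subd:
  assumes "simplicial_chain p (standard_simplex q) b" "\<beta> \<in> Poly_Mapping.keys (subd p b)"
  obtains f \<gamma> where "f \<in> Poly_Mapping.keys b" "singular_simplex (Suc p) (simplex_top p) \<gamma>" "\<beta> = simplex_map (Suc p) f \<gamma>"
proof -
  have "\<beta> \<in> Poly_Mapping.keys (frag_extend (\<lambda>f. chain_map (Suc p) f (subd p (identity_chain p))) b)"
    using assms(2) subd_as_pushforward[OF assms(1)] by metis
  then have "\<beta> \<in> (\<Union>f\<in>Poly_Mapping.keys b. Poly_Mapping.keys (chain_map (Suc p) f (subd p (identity_chain p))))"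
    by (rule subsetD[OF keys_frag_extend])
  then obtain f where f: "f \<in> Poly_Mapping.keys b" "\<beta> \<in> Poly_Mapping.keys (chain_map (Suc p) f (subd p (identity_chain p)))"
    by blast
  then obtain \<gamma> where "\<gamma> \<in> Poly_Mapping.keys (subd p (identity_chain p))" "\<beta> = simplex_map (Suc p) f \<gamma>"
    using keys_frag_extend[of "frag_of \<circ> simplex_map (Suc p) f" "subd p (identity_chain p)"]
    unfolding chain_map_def by auto
  moreover have "singular_chain (Suc p) (simplex_top p) (subd p (identity_chain p))"
    using simplicial_imp_singular_chain[OF chain_homotopic_simplicial_subdivision2[of p p "identity_chain p"]]
    by (simp add: euclidean_product_topology)
  ultimately show thesis using that f(1) by (auto simp: singular_chain_def)
qed

text \<open>The preimages of \<open>A\<close> and \<open>B\<close> form an open cover of the compact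
  simplex, and repeated subdivision gets below its Lebesgue number.\<close>

lemma subdivision_small:
  assumes \<sigma>: "continuous_on (standard_simplex p) \<sigma>" "\<sigma> ` standard_simplex p \<subseteq> A \<union> B"
    and AB: "openin (top_of_set (A \<union> B)) A" "openin (top_of_set (A \<union> B)) B"
  obtains n where "\<And>j f. n \<le> j \<Longrightarrow> f \<in> Poly_Mapping.keys ((simplicial_subdivision p ^^ j) (identity_chain p)) \<Longrightarrow>
      (\<sigma> \<circ> f) ` standard_simplex p \<subseteq> A \<or> (\<sigma> \<circ> f) ` standard_simplex p \<subseteq> B"
proof -
  let ?C = "{standard_simplex p \<inter> \<sigma> -` A, standard_simplex p \<inter> \<sigma> -` B}"
  have o: "openin (simplex_top p) U" if "U \<in> ?C" for U
    using that continuous_openin_preimage[OF \<sigma>(1) _ AB(1)] continuous_openin_preimage[OF \<sigma>(1) _ AB(2)] \<sigma>(2)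
    by auto
  have c: "topspace (simplex_top p) \<subseteq> \<Union>?C" using \<sigma>(2) by auto
  obtain n where n: "\<And>m f. n \<le> m \<Longrightarrow> f \<in> Poly_Mapping.keys ((singular_subdivision p ^^ m) (identity_chain p))
      \<Longrightarrow> \<exists>V\<in>?C. f \<in> standard_simplex p \<rightarrow> V"
    using sufficient_iterated_singular_subdivision_exists[OF o c identity_chain_in] by metis
  have simp: "simplicial_chain p (standard_simplex p) (identity_chain p)" by simp
  have eq: "(singular_subdivision p ^^ m) (identity_chain p) = (simplicial_subdivision p ^^ m) (identity_chain p)" for m
    by (induction m)
       (auto simp: singular_subdivision_simplicial_simplex[OF simplicial_chain_subdivision_power[OF simp]])
  show thesis
    by (rule that[of n]) (use n eq in \<open>fastforce simp: Pi_iff\<close>)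
qed

section \<open>Cochains obtained by pairing with universal chains\<close>

context coefficient_system
begin

text \<open>The computation shared by the prism and the subdivision argument: if \<open>b\<close> is
  given on each face by pairing \<open>c\<close> with one chain \<open>K\<close>, its coboundary
  pairs \<open>c\<close> with copies of \<open>K\<close> in one model \<open>Y'\<close> for
  \<open>\<sigma>\<close>. Here \<open>\<iota>\<close> places \<open>\<sigma>\<close> in
  \<open>Y'\<close>, \<open>F k\<close> places the model of the \<open>k\<close>-th face there, and
  the conditions on \<open>\<iota>\<close> match the base points.\<close>

lemma model_coboundary:
  assumes b: "b \<in> cochains S L (int p)" and c: "c \<in> cochains S L (int r)"
    and \<sigma>: "singular_simplex (Suc p) (top_of_set S) \<sigma>"
    and M: "model_map Y' \<Sigma>" and y': "y' \<in> Y'"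
    and \<iota>: "continuous_on (standard_simplex (Suc p)) \<iota>" "\<iota> ` standard_simplex (Suc p) \<subseteq> Y'"
      "\<And>x. x \<in> standard_simplex (Suc p) \<Longrightarrow> \<Sigma> (\<iota> x) = \<sigma> x" "\<iota> (vertex 0) = y'"
    and Y: "segment_closed Y" "y \<in> Y" and K: "singular_chain r (top_of_set Y) K"
    and F: "\<And>k. k \<le> Suc p \<Longrightarrow> continuous_on Y (F k)" "\<And>k. k \<le> Suc p \<Longrightarrow> F k ` Y \<subseteq> Y'"
      "\<And>k. k \<le> Suc p \<Longrightarrow> \<iota> (simplical_face k (vertex 0)) = F k y"
    and face: "\<And>k. k \<le> Suc p \<Longrightarrow> b (singular_face (Suc p) k \<sigma>) = pairing r c (\<Sigma> \<circ> F k) y K"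
  shows "coboundary sc S L (int p) b \<sigma> =
    (\<Sum>k\<le>Suc p. sc ((-1) ^ k) (pairing r c \<Sigma> y' (chain_map r (F k) K)))"
  unfolding coboundary_uniform[OF b \<sigma>]
proof (intro sum.cong refl)
  fix k assume "k \<in> {..Suc p}"
  then have k: "k \<le> Suc p" by simp
  let ?v = "b (singular_face (Suc p) k \<sigma>)"
  have v: "?v \<in> fibre L (\<sigma> (simplical_face k (vertex 0)))" by (rule face_cochain_in[OF b \<sigma> k])
  have f: "simplical_face k (vertex 0) \<in> standard_simplex (Suc p)" and v0: "vertex 0 \<in> standard_simplex (Suc p)"
    using simplical_face_maps[OF k, of "vertex 0"] by auto
  have "segment_transport \<sigma> (simplical_face k (vertex 0)) (vertex 0) ?v
      = segment_transport (\<Sigma> \<circ> \<iota>) (simplical_face k (vertex 0)) (vertex 0) ?v"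
    using \<iota>(3) by (intro segment_transport_cong[OF model_map_simplex[OF \<sigma>] f v0 v]) auto
  also have "\<dots> = segment_transport \<Sigma> (F k y) y' ?v"
    using segment_transport_natural[OF M segment_closed_simplex \<iota>(1,2) f v0, of ?v] v \<iota>(3)[OF f]
    by (simp only: F(3)[OF k] \<iota>(4))
  also have "\<dots> = pairing r c \<Sigma> y' (chain_map r (F k) K)"
    unfolding face[OF k] by (rule pairing_chain_map[OF M c Y(1) F(1,2)[OF k] K y' Y(2), symmetric])
  finally show "sc ((-1) ^ k) (segment_transport \<sigma> (simplical_face k (vertex 0)) (vertex 0) ?v) =
      sc ((-1) ^ k) (pairing r c \<Sigma> y' (chain_map r (F k) K))" by simp
qed

lemma pairing_alternating_sum:
  "pairing q c \<Sigma> y (\<Sum>k\<in>I. frag_cmul ((-1) ^ k) (g k)) = (\<Sum>k\<in>I. sc ((-1) ^ k) (pairing q c \<Sigma> y (g k)))"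
  by (simp add: pairing_def combine_sum combine_cmul)

lemma pairing_eq_0:
  assumes M: "model_map Y \<Sigma>" and b: "singular_chain q (top_of_set Y) b" and y: "y \<in> Y"
    and 0: "\<And>\<alpha>. \<alpha> \<in> Poly_Mapping.keys b \<Longrightarrow> c (simplex_map q \<Sigma> \<alpha>) = 0"
  shows "pairing q c \<Sigma> y b = 0"
  unfolding pairing_def
proof (rule combine_eq_0)
  fix \<alpha> assume \<alpha>: "\<alpha> \<in> Poly_Mapping.keys b"
  show "simplex_value q c \<Sigma> y \<alpha> = 0"
    unfolding simplex_value_def 0[OF \<alpha>]
    using simplex_in[OF chainD[OF b \<alpha>], of "vertex 0"] by (intro segment_transport_0[OF M _ y]) simp
qed

lemma family_simplex_map:
  assumes "continuous_on Y \<Sigma>" "\<Sigma> ` Y \<subseteq> B" "singular_simplex q (top_of_set Y) \<alpha>"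
  shows "simplex_map q \<Sigma> \<alpha> \<in> family B (int q)"
  unfolding family_nat mem_Collect_eq
  using assms(1,2) by (intro singular_simplex_simplex_map[OF assms(3)]) auto

lemma coboundary_on_family:
  assumes "rel_coboundary (family B) q c = 0" "\<sigma> \<in> family B (q + 1)"
  shows "coboundary sc S L q c \<sigma> = 0"
  using fun_cong[OF assms(1), of \<sigma>] assms(2) by (simp add: rel_coboundary_def cut_def)

text \<open>The cocycle condition is available only on simplices of \<open>B\<close>; hence the
  demand that the model land in \<open>B\<close>.\<close>

lemma pairing_boundary_cocycle:
  assumes M: "model_map Y \<Sigma>" "\<Sigma> ` Y \<subseteq> B" and c: "c \<in> cochains S L (int q)" "rel_coboundary (family B) (int q) c = 0"
    and b: "singular_chain (Suc q) (top_of_set Y) b" and y: "y \<in> Y"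
  shows "pairing q c \<Sigma> y (chain_boundary (Suc q) b) = 0"
  unfolding pairing_boundary[OF M(1) c(1) b y, symmetric]
proof (rule pairing_eq_0[OF M(1) b y])
  fix \<alpha> assume "\<alpha> \<in> Poly_Mapping.keys b"
  then have "simplex_map (Suc q) \<Sigma> \<alpha> \<in> family B (int (Suc q))"
    using M by (intro family_simplex_map[of Y] chainD[OF b]) (auto simp: model_map_def)
  then show "coboundary sc S L (int q) c (simplex_map (Suc q) \<Sigma> \<alpha>) = 0"
    by (intro coboundary_on_family[OF c(2)]) (simp add: add.commute)
qed

lemma acyclic_pairI:
  assumes P: "face_closed P"
    and 0: "\<And>c. c \<in> rel_cochains P Q 0 \<Longrightarrow> rel_coboundary P 0 c = 0 \<Longrightarrow> c = 0"
    and Suc: "\<And>p c. c \<in> rel_cochains P Q (int (Suc p)) \<Longrightarrow> rel_coboundary P (int (Suc p)) c = 0 \<Longrightarrow>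
       \<exists>b\<in>rel_cochains P Q (int p). c = rel_coboundary P (int p) b"
  shows "acyclic_pair P Q"
  unfolding acyclic_pair_def
proof (intro allI subsetI)
  fix q c assume "c \<in> rel_cocycles P Q q"
  then have c: "c \<in> rel_cochains P Q q" "rel_coboundary P q c = 0" by (auto simp: rel_cocycles_def)
  show "c \<in> rel_coboundaries P Q q"
  proof (cases rule: int_cases_neg[of q])
    case 1
    then have "\<sigma> \<notin> P q" for \<sigma>
      using face_closed_family_sub[OF P, of \<sigma> q] by (auto simp: simplex_of_degree_def)
    then have "c = 0"
      using rel_cochains_zero[OF c(1)] by (auto simp: fun_eq_iff)
    then show ?thesis unfolding rel_coboundaries_def using P by (intro image_eqI[of _ _ 0]) auto
  next
    case (2 n)
    show ?thesis
    proof (cases n)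
      case 0
      then have "c = 0" using assms(2) c 2 by simp
      then show ?thesis unfolding rel_coboundaries_def using P by (intro image_eqI[of _ _ 0]) auto
    next
      case (Suc p)
      then obtain b where "b \<in> rel_cochains P Q (int p)" "c = rel_coboundary P (int p) b"
        using assms(3)[of c p] c 2 by auto
      then show ?thesis using Suc 2 by (auto simp: rel_coboundaries_def)
    qed
  qed
qed

text \<open>The sign is that of the side term in the chain homotopy formulas; scaling by
  \<open>- 1\<close> absorbs it.\<close>

lemma eq_rel_coboundaryI:
  assumes P: "face_closed P" and b: "b \<in> rel_cochains P Q (int p)" and c: "c \<in> rel_cochains P Q (int (Suc p))"
    and eq: "\<And>\<sigma>. \<sigma> \<in> P (int (Suc p)) \<Longrightarrow> coboundary sc S L (int p) b \<sigma> = - c \<sigma>"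
  shows "\<exists>b\<in>rel_cochains P Q (int p). c = rel_coboundary P (int p) b"
proof
  show "cochain_scale (- 1) b \<in> rel_cochains P Q (int p)" by (rule rel_cochains_scale[OF P b])
  show "c = rel_coboundary P (int p) (cochain_scale (- 1) b)"
    unfolding rel_coboundary_scale[OF P b]
    using eq rel_cochains_zero[OF c] by (auto simp: rel_coboundary_def cut_def fun_eq_iff add.commute)
qed

subsection \<open>Deformations\<close>

text \<open>The primitive evaluates a cocycle on the prism swept out by a simplex. In the boundary
  of a prism the top lies in \<open>A\<close>, where the cocycle vanishes, the bottom gives back the
  cocycle, and the sides give the coboundary of the primitive. As \<open>A\<close> is preserved at
  all times, the primitive vanishes on \<open>A\<close>.\<close>

lemma deformation_acyclic:
  fixes h :: "real \<times> 'a \<Rightarrow> 'a"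
  assumes AB: "A \<subseteq> B" "B \<subseteq> S" and cont: "continuous_on ({0..1} \<times> B) h"
    and h: "\<And>t x. t \<in> {0..1} \<Longrightarrow> x \<in> B \<Longrightarrow> h (t, x) \<in> B" "\<And>x. x \<in> B \<Longrightarrow> h (0, x) = x"
      "\<And>x. x \<in> B \<Longrightarrow> h (1, x) \<in> A" "\<And>t x. t \<in> {0..1} \<Longrightarrow> x \<in> A \<Longrightarrow> h (t, x) \<in> A"
  shows "acyclic_pair (family B) (family A)"
proof -
  define \<Sigma> where "\<Sigma> = (\<lambda>\<sigma> y. h (y 0, \<sigma> (\<lambda>i. y (Suc i))) :: 'a)"
  let ?y = "case_nat 0 (vertex 0) :: nat \<Rightarrow> real"
  have y: "?y \<in> cylinder p" for p by (intro case_nat_in_cylinder) auto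
  have fB: "face_closed (family B)" using AB by (intro face_closed_family)
  have \<Sigma>cont: "continuous_on (cylinder p) (\<Sigma> \<sigma>)" and \<Sigma>B: "\<Sigma> \<sigma> ` cylinder p \<subseteq> B" if "\<sigma> \<in> family B (int p)" for \<sigma> p
  proof -
    have \<sigma>: "continuous_on (standard_simplex p) \<sigma>" "\<sigma> ` standard_simplex p \<subseteq> B"
      using that by (auto simp: family_nat singular_simplex_top_of_set)
    show "continuous_on (cylinder p) (\<Sigma> \<sigma>)"
      unfolding \<Sigma>_def using \<sigma>
      by (intro continuous_on_compose2[OF cont] continuous_on_Pair continuous_on_compose2[OF \<sigma>(1) continuous_on_tail]
          continuous_on_subset[OF continuous_on_product_coordinates]) (auto simp: cylinder_def)
    show "\<Sigma> \<sigma> ` cylinder p \<subseteq> B"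
      using \<sigma> h(1) by (auto simp: \<Sigma>_def cylinder_def)
  qed
  have \<Sigma>A: "\<Sigma> \<sigma> ` cylinder p \<subseteq> A" if "\<sigma> \<in> family A (int p)" for \<sigma> p
    using that h(4) by (auto simp: \<Sigma>_def cylinder_def family_nat singular_simplex_top_of_set)
  have M: "model_map (cylinder p) (\<Sigma> \<sigma>)" if "\<sigma> \<in> family B (int p)" for \<sigma> p
    using \<Sigma>cont[OF that] \<Sigma>B[OF that] AB by (auto simp: model_map_def segment_closed_cylinder)
  have vanish: "c (simplex_map q (\<Sigma> \<sigma>) \<alpha>) = 0"
    if c: "c \<in> rel_cochains (family B) (family A) (int q)" and "\<sigma> \<in> family B (int p)"
      "singular_simplex q (cylinder_top p) \<alpha>" "(\<Sigma> \<sigma> \<circ> \<alpha>) ` standard_simplex q \<subseteq> A" for c q p \<sigma> \<alpha>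
  proof -
    have "simplex_map q (\<Sigma> \<sigma>) \<alpha> \<in> family B (int q)"
      by (rule family_simplex_map[OF \<Sigma>cont \<Sigma>B]) (use that in auto)
    then have "simplex_map q (\<Sigma> \<sigma>) \<alpha> \<in> family A (int q)"
      using that(4) by (auto simp: family_nat singular_simplex_top_of_set simplex_map_def image_subset_iff)
    then show ?thesis by (intro rel_cochains_zero[OF c]) auto
  qed
  have key: "pairing q c (\<Sigma> \<sigma>) ?y (prism_sides q (identity_chain q)) = - c \<sigma>"
    if c: "c \<in> rel_cochains (family B) (family A) (int q)" "rel_coboundary (family B) (int q) c = 0"
      and \<sigma>: "\<sigma> \<in> family B (int q)" for c q \<sigma>
  proof -
    note cS = rel_cochains_in_cochains[OF fB c(1)]
    have \<sigma>S: "singular_simplex q (top_of_set S) \<sigma>" and \<sigma>B: "singular_simplex q (top_of_set B) \<sigma>"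
      using \<sigma> face_closed_family_sub[OF fB \<sigma>] by (auto simp: family_nat simplex_of_degree_def)
    let ?i = "\<lambda>t::real. chain_map q (case_nat t) (identity_chain q)"
    have i: "singular_chain q (cylinder_top q) (?i t)" if "t \<in> {0..1}" for t
      using that by (intro singular_chain_chain_map[OF identity_chain_in] case_nat_continuous)
    have "pairing q c (\<Sigma> \<sigma>) ?y (chain_boundary (Suc q) (prism q)) = 0"
      by (rule pairing_boundary_cocycle[OF M \<Sigma>B cS c(2) singular_chain_prism y]) (use \<sigma> in auto)
    then have "pairing q c (\<Sigma> \<sigma>) ?y (?i 1) - pairing q c (\<Sigma> \<sigma>) ?y (?i 0)
        - pairing q c (\<Sigma> \<sigma>) ?y (prism_sides q (identity_chain q)) = 0"
      using good_prism[of q] unfolding good_prism_def pairing_def by (simp only: combine_diff)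
    moreover have "pairing q c (\<Sigma> \<sigma>) ?y (?i 1) = 0"
    proof (rule pairing_eq_0[OF M[OF \<sigma>] i y])
      fix \<alpha> assume "\<alpha> \<in> Poly_Mapping.keys (?i 1)"
      then have \<alpha>: "\<alpha> = simplex_map q (case_nat 1) (identity_simplex q)" by simp
      have "singular_simplex q (cylinder_top q) \<alpha>"
        using i[of 1] by (simp add: \<alpha> singular_chain_of)
      moreover have "(\<Sigma> \<sigma> \<circ> \<alpha>) ` standard_simplex q \<subseteq> A"
        using h(3) simplex_in[OF \<sigma>B] by (auto simp: \<alpha> \<Sigma>_def simplex_map_def)
      ultimately show "c (simplex_map q (\<Sigma> \<sigma>) \<alpha>) = 0" by (rule vanish[OF c(1) \<sigma>])
    qed simp
    moreover have "pairing q c (\<Sigma> \<sigma>) ?y (?i 0) = c \<sigma>"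
    proof -
      have e: "simplex_map q (\<Sigma> \<sigma>) (simplex_map q (case_nat 0) (identity_simplex q)) = \<sigma>"
        using h(2) simplex_in[OF \<sigma>B] \<sigma>B
        by (auto simp: \<Sigma>_def simplex_map_def singular_simplex_def extensional_def fun_eq_iff)
      have "simplex_map q (case_nat 0) (identity_simplex q) (vertex 0) = ?y"
        by (simp add: simplex_map_def)
      moreover have "c \<sigma> \<in> fibre L (\<Sigma> \<sigma> ?y)"
        using cochain_in[OF cS \<sigma>S] h(2) simplex_in[OF \<sigma>B, of "vertex 0"] by (simp add: \<Sigma>_def)
      ultimately show ?thesis
        using segment_transport_id[OF M[OF \<sigma>] y] by (simp add: pairing_def simplex_value_def e)
    qed
    ultimately show ?thesis
      by (metis diff_0 right_minus_eq)
  qed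
  show ?thesis
  proof (rule acyclic_pairI[OF fB])
    \<comment> \<open>The prism over a point has no sides, so \<open>key\<close> already forces
      \<open>c\<close> to be zero.\<close>
    fix c assume c: "c \<in> rel_cochains (family B) (family A) 0" "rel_coboundary (family B) 0 c = 0"
    show "c = 0"
    proof
      show "c \<sigma> = 0 \<sigma>" for \<sigma>
        using key[of c 0 \<sigma>] c rel_cochains_zero[OF c(1), of \<sigma>]
        by (cases "\<sigma> \<in> family B 0") (auto simp: prism_sides_def pairing_def)
    qed
  next
    fix p c
    assume c: "c \<in> rel_cochains (family B) (family A) (int (Suc p))" "rel_coboundary (family B) (int (Suc p)) c = 0"
    note cS = rel_cochains_in_cochains[OF fB c(1)]
    define b where "b = (\<lambda>\<tau>. if \<tau> \<in> family B (int p) then pairing (Suc p) c (\<Sigma> \<tau>) ?y (prism p) else 0)"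
    have lead: "leading_vertex \<tau> = \<Sigma> \<tau> ?y" if "\<tau> \<in> family B (int p)" for \<tau>
      using h(2) that simplex_in[of p B \<tau> "vertex 0"] by (simp add: leading_vertex \<Sigma>_def family_nat)
    have bA: "b \<tau> = 0" if \<tau>: "\<tau> \<in> family A (int p)" for \<tau>
    proof (cases "\<tau> \<in> family B (int p)")
      case True
      have "pairing (Suc p) c (\<Sigma> \<tau>) ?y (prism p) = 0"
      proof (rule pairing_eq_0[OF M[OF True] singular_chain_prism y])
        fix \<alpha> assume "\<alpha> \<in> Poly_Mapping.keys (prism p)"
        then have \<alpha>: "singular_simplex (Suc p) (cylinder_top p) \<alpha>" by (rule chainD[OF singular_chain_prism])
        have "(\<Sigma> \<tau> \<circ> \<alpha>) ` standard_simplex (Suc p) \<subseteq> A"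
          using \<Sigma>A[OF \<tau>] simplex_in[OF \<alpha>] by auto
        then show "c (simplex_map (Suc p) (\<Sigma> \<tau>) \<alpha>) = 0"
          using vanish[OF c(1) True \<alpha>] by simp
      qed
      then show ?thesis by (simp add: b_def)
    qed (simp add: b_def)
    have "b \<tau> \<in> fibre L (leading_vertex \<tau>)" if "\<tau> \<in> family B (int p)" for \<tau>
      using that pairing_in[OF M[OF that] cS singular_chain_prism y] by (simp add: b_def lead)
    moreover have "b \<tau> = 0" if "\<tau> \<notin> family B (int p)" for \<tau>
      using that by (simp add: b_def)
    ultimately have b: "b \<in> rel_cochains (family B) (family A) (int p)"
      using bA by (auto simp: rel_cochains_def)
    show "\<exists>b\<in>rel_cochains (family B) (family A) (int p). c = rel_coboundary (family B) (int p) b"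
    proof (rule eq_rel_coboundaryI[OF fB b c(1)])
      fix \<sigma> assume \<sigma>: "\<sigma> \<in> family B (int (Suc p))"
      have \<sigma>B: "singular_simplex (Suc p) (top_of_set B) \<sigma>"
        using \<sigma> by (simp only: family_nat mem_Collect_eq)
      have \<sigma>S: "singular_simplex (Suc p) (top_of_set S) \<sigma>"
        using \<sigma>B AB(2) by (auto simp: singular_simplex_top_of_set)
      have Fc: "continuous_on (cylinder p) (cylinder_map (simplical_face k))" for k
        by (intro continuous_on_cylinder_map continuous_on_simplical_face)
      have Fi: "cylinder_map (simplical_face k) ` cylinder p \<subseteq> cylinder (Suc p)" if "k \<le> Suc p" for k
        using simplical_face_maps[OF that] by (intro cylinder_map_maps) auto
      \<comment> \<open>The bottom inclusion \<open>case_nat 0\<close> places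
        \<open>\<sigma>\<close> in the cylinder, and the prisms over its faces become the sides of
        the prism over it.\<close>
      have "coboundary sc S L (int p) b \<sigma> = (\<Sum>k\<le>Suc p. sc ((-1) ^ k)
          (pairing (Suc p) c (\<Sigma> \<sigma>) ?y (chain_map (Suc p) (cylinder_map (simplical_face k)) (prism p))))"
      proof (rule model_coboundary[OF rel_cochains_in_cochains[OF fB b] cS \<sigma>S M[OF \<sigma>] y _ _ _ _
            segment_closed_cylinder y singular_chain_prism Fc Fi, of "case_nat 0"])
        show "continuous_on (standard_simplex (Suc p)) (case_nat 0 :: _ \<Rightarrow> nat \<Rightarrow> real)"
          by (intro continuous_on_case_nat continuous_intros)
        show "case_nat 0 ` standard_simplex (Suc p) \<subseteq> cylinder (Suc p)"
          using case_nat_in_cylinder by auto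
        show "\<Sigma> \<sigma> (case_nat 0 x) = \<sigma> x" if "x \<in> standard_simplex (Suc p)" for x
          using h(2) simplex_in[OF \<sigma>B that] by (simp add: \<Sigma>_def)
        show "case_nat 0 (simplical_face k (vertex 0)) = cylinder_map (simplical_face k) ?y" for k
          by (simp add: cylinder_map_def)
        fix k assume k: "k \<le> Suc p"
        have \<tau>: "singular_face (Suc p) k \<sigma> \<in> family B (int p)"
          using face_simplex[OF \<sigma>B k] by (simp add: family_nat)
        show "b (singular_face (Suc p) k \<sigma>) = pairing (Suc p) c (\<Sigma> \<sigma> \<circ> cylinder_map (simplical_face k)) ?y (prism p)"
          using \<tau> pairing_cong[OF M[OF \<tau>] cS singular_chain_prism y, of "\<Sigma> \<sigma> \<circ> cylinder_map (simplical_face k)"]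
          by (simp add: b_def \<Sigma>_def cylinder_map_def singular_face_def cylinder_def)
      qed auto
      also have "\<dots> = pairing (Suc p) c (\<Sigma> \<sigma>) ?y (prism_sides (Suc p) (identity_chain (Suc p)))"
      proof -
        have f: "chain_map (Suc p) (cylinder_map (singular_face (Suc p) k (identity_simplex (Suc p)))) (prism p) =
           chain_map (Suc p) (cylinder_map (simplical_face k)) (prism p)" if "k \<le> Suc p" for k
          using simplical_face_maps[OF that]
          by (intro chain_map_eq[OF singular_chain_prism]) (auto simp: cylinder_map_def cylinder_def singular_face_def)
        have "prism_sides (Suc p) (identity_chain (Suc p)) =
          (\<Sum>k\<le>Suc p. frag_cmul ((-1) ^ k) (cylinder_chain p (prism p) (frag_of (singular_face (Suc p) k (identity_simplex (Suc p))))))"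
          unfolding prism_sides_def chain_boundary_of
          by (simp add: additive_alternating_sum[of "cylinder_chain p (prism p)", OF cylinder_chain_diff] del: sum.atMost_Suc cylinder_chain_of)
        also have "\<dots> = (\<Sum>k\<le>Suc p. frag_cmul ((-1) ^ k) (chain_map (Suc p) (cylinder_map (simplical_face k)) (prism p)))"
          by (intro sum.cong refl arg_cong2[of _ _ _ _ frag_cmul]) (auto simp: f)
        finally show ?thesis by (simp only: pairing_alternating_sum)
      qed
      also have "\<dots> = - c \<sigma>" by (rule key[OF c \<sigma>])
      finally show "coboundary sc S L (int p) b \<sigma> = - c \<sigma>" .
    qed
  qed
qed

subsection \<open>Small simplices\<close>

text \<open>The scheme of the deformation argument, with \<open>iterated_subd\<close> in place of
  the prism: after enough subdivisions all pieces of \<open>\<sigma>\<close> lie in \<open>A\<close>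
  or in \<open>B\<close>, where the cocycle vanishes, so the identity term must cancel the side
  term.\<close>

lemma small_simplices_acyclic:
  assumes S: "A \<union> B \<subseteq> S" and AB: "openin (top_of_set (A \<union> B)) A" "openin (top_of_set (A \<union> B)) B"
  shows "acyclic_pair (family (A \<union> B)) (\<lambda>q. family A q \<union> family B q)"
proof -
  let ?W = "family (A \<union> B)" and ?U = "\<lambda>q. family A q \<union> family B q"
  let ?v = "vertex 0"
  have fW: "face_closed ?W" using S by (rule face_closed_family)
  have id: "simplicial_chain p (standard_simplex p) (identity_chain p)" for p by simp
  have D: "singular_chain (Suc p) (simplex_top p) (iterated_subd n p (identity_chain p))" for n p
    using simplicial_imp_singular_chain[OF simplicial_chain_iterated_subd[OF id]] by (simp add: euclidean_product_topology)
  have sd: "singular_chain p (simplex_top p) ((simplicial_subdivision p ^^ n) (identity_chain p))" for n p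
    using simplicial_imp_singular_chain[OF simplicial_chain_subdivision_power[OF id]] by (simp add: euclidean_product_topology)
  have v: "?v \<in> standard_simplex p" for p by simp
  have M: "model_map (standard_simplex p) \<tau>" and Wc: "continuous_on (standard_simplex p) \<tau>"
    and Wi: "\<tau> ` standard_simplex p \<subseteq> A \<union> B" if "\<tau> \<in> ?W (int p)" for \<tau> p
    using that face_closed_family_sub[OF fW that]
    by (auto simp: family_nat singular_simplex_top_of_set simplex_of_degree_def intro!: model_map_simplex)
  have vanish: "c (simplex_map q \<tau> \<alpha>) = 0"
    if c: "c \<in> rel_cochains ?W ?U (int q)" and "\<tau> \<in> ?W (int p)" "singular_simplex q (simplex_top p) \<alpha>"
      "(\<tau> \<circ> \<alpha>) ` standard_simplex q \<subseteq> A \<or> (\<tau> \<circ> \<alpha>) ` standard_simplex q \<subseteq> B" for c q p \<tau> \<alpha>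
  proof -
    have "simplex_map q \<tau> \<alpha> \<in> ?W (int q)"
      by (rule family_simplex_map[OF Wc Wi]) (use that in auto)
    then have "simplex_map q \<tau> \<alpha> \<in> ?U (int q)"
      using that(4) by (auto simp: family_nat singular_simplex_top_of_set simplex_map_def image_subset_iff)
    then show ?thesis by (intro rel_cochains_zero[OF c]) auto
  qed
  have small: "\<exists>n. \<forall>j f. n \<le> j \<longrightarrow> f \<in> Poly_Mapping.keys ((simplicial_subdivision p ^^ j) (identity_chain p)) \<longrightarrow>
      (\<tau> \<circ> f) ` standard_simplex p \<subseteq> A \<or> (\<tau> \<circ> f) ` standard_simplex p \<subseteq> B" if "\<tau> \<in> ?W (int p)" for \<tau> p
    using subdivision_small[OF Wc[OF that] Wi[OF that] AB] by metis
  text \<open>The number of subdivisions needed depends on the simplex, but evaluating on \<open>iterated_subd j\<close>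
    no longer depends on \<open>j\<close> once all pieces are small; this stable value defines the primitive of \<open>c\<close>.\<close>
  have stable: "\<exists>n. \<forall>j\<ge>n. pairing (Suc p) c \<tau> ?v (iterated_subd j p (identity_chain p))
      = pairing (Suc p) c \<tau> ?v (iterated_subd n p (identity_chain p))"
    if c: "c \<in> rel_cochains ?W ?U (int (Suc p))" and \<tau>: "\<tau> \<in> ?W (int p)" for c p \<tau>
  proof -
    obtain n where n: "\<And>j f. n \<le> j \<Longrightarrow> f \<in> Poly_Mapping.keys ((simplicial_subdivision p ^^ j) (identity_chain p)) \<Longrightarrow>
      (\<tau> \<circ> f) ` standard_simplex p \<subseteq> A \<or> (\<tau> \<circ> f) ` standard_simplex p \<subseteq> B"
      using small[OF \<tau>] by blast
    have "pairing (Suc p) c \<tau> ?v (iterated_subd j p (identity_chain p))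
      = pairing (Suc p) c \<tau> ?v (iterated_subd n p (identity_chain p))" if "n \<le> j" for j
      using that
    proof (induction j rule: dec_induct)
      case (step j)
      let ?s = "(simplicial_subdivision p ^^ j) (identity_chain p)"
      have ss: "simplicial_chain p (standard_simplex p) ?s" by (rule simplicial_chain_subdivision_power[OF id])
      have sub: "singular_chain (Suc p) (simplex_top p) (subd p ?s)"
        using simplicial_imp_singular_chain[OF chain_homotopic_simplicial_subdivision2[OF ss]]
        by (simp add: euclidean_product_topology)
      \<comment> \<open>The next summand of the homotopy is supported inside pieces that are already
        small.\<close>
      have "pairing (Suc p) c \<tau> ?v (subd p ?s) = 0"
      proof (rule pairing_eq_0[OF M[OF \<tau>] sub v])
        fix \<beta> assume \<beta>: "\<beta> \<in> Poly_Mapping.keys (subd p ?s)"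
        obtain f \<gamma> where f: "f \<in> Poly_Mapping.keys ?s" and \<gamma>: "singular_simplex (Suc p) (simplex_top p) \<gamma>"
          and eq: "\<beta> = simplex_map (Suc p) f \<gamma>"
          using keys_subd[OF ss \<beta>] .
        have "(\<tau> \<circ> \<beta>) ` standard_simplex (Suc p) \<subseteq> (\<tau> \<circ> f) ` standard_simplex p"
          using simplex_in[OF \<gamma>] by (auto simp: eq simplex_map_def)
        then show "c (simplex_map (Suc p) \<tau> \<beta>) = 0"
          using n[OF _ f] step.hyps by (intro vanish[OF c \<tau> chainD[OF sub \<beta>]]) auto
      qed
      then show ?case
        using step.IH by (simp add: iterated_subd_def pairing_def combine_add)
    qed simp
    then show ?thesis by blast
  qed
  show ?thesis
  proof (rule acyclic_pairI[OF fW])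
    fix c assume c: "c \<in> rel_cochains ?W ?U 0" "rel_coboundary ?W 0 c = 0"
    \<comment> \<open>A point of \<open>A \<union> B\<close> lies in \<open>A\<close> or in
      \<open>B\<close>, so there is no nonzero relative cochain in degree \<open>0\<close>.\<close>
    have "\<sigma> \<in> ?U 0" if "\<sigma> \<in> ?W 0" for \<sigma>
      using that family_nat[of _ 0] by (auto simp: singular_simplex_top_of_set standard_simplex_0)
    then show "c = 0"
      using rel_cochains_zero[OF c(1)] by (auto simp: fun_eq_iff)
  next
    fix p c
    assume c: "c \<in> rel_cochains ?W ?U (int (Suc p))" "rel_coboundary ?W (int (Suc p)) c = 0"
    note cS = rel_cochains_in_cochains[OF fW c(1)]
    let ?val = "\<lambda>\<tau> n. pairing (Suc p) c \<tau> ?v (iterated_subd n p (identity_chain p))"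
    obtain N where N: "\<And>\<tau> j. \<tau> \<in> ?W (int p) \<Longrightarrow> N \<tau> \<le> j \<Longrightarrow> ?val \<tau> j = ?val \<tau> (N \<tau>)"
      using stable[OF c(1)] by metis
    define b where "b = (\<lambda>\<tau>. if \<tau> \<in> ?W (int p) then ?val \<tau> (N \<tau>) else 0)"
    have bU: "b \<tau> = 0" if \<tau>: "\<tau> \<in> ?U (int p)" for \<tau>
    proof (cases "\<tau> \<in> ?W (int p)")
      case True
      have "?val \<tau> (N \<tau>) = 0"
      proof (rule pairing_eq_0[OF M[OF True] D v])
        fix \<alpha> assume "\<alpha> \<in> Poly_Mapping.keys (iterated_subd (N \<tau>) p (identity_chain p))"
        then have \<alpha>: "singular_simplex (Suc p) (simplex_top p) \<alpha>" by (rule chainD[OF D])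
        have "(\<tau> \<circ> \<alpha>) ` standard_simplex (Suc p) \<subseteq> A \<or> (\<tau> \<circ> \<alpha>) ` standard_simplex (Suc p) \<subseteq> B"
          using \<tau> simplex_in[OF \<alpha>] by (auto simp: family_nat singular_simplex_top_of_set)
        then show "c (simplex_map (Suc p) \<tau> \<alpha>) = 0"
          by (rule vanish[OF c(1) True \<alpha>])
      qed
      then show ?thesis by (simp add: b_def)
    qed (simp add: b_def)
    have "b \<tau> \<in> fibre L (leading_vertex \<tau>)" if "\<tau> \<in> ?W (int p)" for \<tau>
      using that pairing_in[OF M[OF that] cS D v] by (simp add: b_def leading_vertex)
    moreover have "b \<tau> = 0" if "\<tau> \<notin> ?W (int p)" for \<tau>
      using that by (simp add: b_def)
    ultimately have b: "b \<in> rel_cochains ?W ?U (int p)"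
      using bU by (auto simp: rel_cochains_def)
    show "\<exists>b\<in>rel_cochains ?W ?U (int p). c = rel_coboundary ?W (int p) b"
    proof (rule eq_rel_coboundaryI[OF fW b c(1)])
      fix \<sigma> assume \<sigma>: "\<sigma> \<in> ?W (int (Suc p))"
      have \<sigma>W: "singular_simplex (Suc p) (top_of_set (A \<union> B)) \<sigma>" using \<sigma> by (simp only: family_nat mem_Collect_eq)
      have \<sigma>S: "singular_simplex (Suc p) (top_of_set S) \<sigma>"
        using \<sigma>W S by (auto simp: singular_simplex_top_of_set)
      let ?f = "\<lambda>k. singular_face (Suc p) k \<sigma>"
      have fk: "?f k \<in> ?W (int p)" if "k \<le> Suc p" for k
        using face_simplex[OF \<sigma>W that] by (simp add: family_nat)
      obtain n\<^sub>0 where n0: "\<And>j f. n\<^sub>0 \<le> j \<Longrightarrow> f \<in> Poly_Mapping.keys ((simplicial_subdivision (Suc p) ^^ j) (identity_chain (Suc p))) \<Longrightarrow>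
          (\<sigma> \<circ> f) ` standard_simplex (Suc p) \<subseteq> A \<or> (\<sigma> \<circ> f) ` standard_simplex (Suc p) \<subseteq> B"
        using small[OF \<sigma>] by blast
      \<comment> \<open>This is large enough for \<open>\<sigma>\<close> and for all its faces: one
        homotopy computes \<open>b\<close> on every face, and the pieces of \<open>\<sigma>\<close>
        itself are small.\<close>
      define n where "n = n\<^sub>0 + (\<Sum>k\<le>Suc p. N (?f k))"
      have nN: "N (?f k) \<le> n" if "k \<le> Suc p" for k
      proof -
        have "N (?f k) \<le> (\<Sum>k\<le>Suc p. N (?f k))"
          using that by (intro member_le_sum) auto
        then show ?thesis by (simp add: n_def)
      qed
      let ?D = "iterated_subd n p (identity_chain p)"
      have "coboundary sc S L (int p) b \<sigma> = (\<Sum>k\<le>Suc p. sc ((-1) ^ k)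
          (pairing (Suc p) c \<sigma> ?v (chain_map (Suc p) (simplical_face k) ?D)))"
      proof (rule model_coboundary[OF rel_cochains_in_cochains[OF fW b] cS \<sigma>S M[OF \<sigma>] v _ _ _ _
            segment_closed_simplex v D continuous_on_simplical_face, of id])
        show "simplical_face k ` standard_simplex p \<subseteq> standard_simplex (Suc p)" if "k \<le> Suc p" for k
          using simplical_face_maps[OF that] by auto
        fix k assume k: "k \<le> Suc p"
        have "b (?f k) = pairing (Suc p) c (?f k) ?v ?D"
          using fk[OF k] N[OF fk[OF k] nN[OF k]] by (simp add: b_def)
        also have "\<dots> = pairing (Suc p) c (\<sigma> \<circ> simplical_face k) ?v ?D"
          by (rule pairing_cong[OF M[OF fk[OF k]] cS D v]) (simp add: singular_face_def)
        finally show "b (?f k) = pairing (Suc p) c (\<sigma> \<circ> simplical_face k) ?v ?D" .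
      qed auto
      also have "\<dots> = pairing (Suc p) c \<sigma> ?v (iterated_subd n p (chain_boundary (Suc p) (identity_chain (Suc p))))"
      proof -
        let ?F = "\<lambda>k. singular_face (Suc p) k (identity_simplex (Suc p))"
        have F: "chain_map (Suc p) (simplical_face k) ?D = iterated_subd n p (frag_of (?F k))" if k: "k \<le> Suc p" for k
        proof -
          have s: "simplicial_simplex p (standard_simplex (Suc p)) (?F k)"
            using simplicial_simplex_singular_face[of "Suc p" "standard_simplex (Suc p)" "identity_simplex (Suc p)" k] k by simp
          have "chain_map (Suc p) (simplical_face k) ?D = chain_map (Suc p) (?F k) ?D"
            using simplical_face_maps[OF k] by (intro chain_map_eq[OF D]) (auto simp: singular_face_def)
          also have "\<dots> = iterated_subd n p (chain_map p (?F k) (identity_chain p))"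
            by (rule iterated_subd_natural[OF id s])
          also have "chain_map p (?F k) (identity_chain p) = frag_of (?F k)"
            using simplex_map_identity[OF simplicial_imp_singular_simplex[OF s]] by simp
          finally show ?thesis .
        qed
        have "iterated_subd n p (chain_boundary (Suc p) (identity_chain (Suc p))) =
          (\<Sum>k\<le>Suc p. frag_cmul ((-1) ^ k) (iterated_subd n p (frag_of (?F k))))"
          unfolding chain_boundary_of
          by (simp add: additive_alternating_sum[of "iterated_subd n p", OF iterated_subd_diff] del: sum.atMost_Suc)
        also have "\<dots> = (\<Sum>k\<le>Suc p. frag_cmul ((-1) ^ k) (chain_map (Suc p) (simplical_face k) ?D))"
          by (intro sum.cong refl arg_cong2[of _ _ _ _ frag_cmul]) (auto simp: F)
        finally show ?thesis by (simp only: pairing_alternating_sum)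
      qed
      also have "\<dots> = - c \<sigma>"
      proof -
        have "iterated_subd n p (chain_boundary (Suc p) (identity_chain (Suc p))) =
            (simplicial_subdivision (Suc p) ^^ n) (identity_chain (Suc p)) - identity_chain (Suc p)
            - chain_boundary (Suc (Suc p)) (iterated_subd n (Suc p) (identity_chain (Suc p)))"
          using boundary_iterated_subd[OF id[of "Suc p"], of n] by simp
        moreover have "pairing (Suc p) c \<sigma> ?v (chain_boundary (Suc (Suc p)) (iterated_subd n (Suc p) (identity_chain (Suc p)))) = 0"
          by (rule pairing_boundary_cocycle[OF M[OF \<sigma>] Wi[OF \<sigma>] cS c(2) D v])
        moreover have "pairing (Suc p) c \<sigma> ?v ((simplicial_subdivision (Suc p) ^^ n) (identity_chain (Suc p))) = 0"
          by (intro pairing_eq_0[OF M[OF \<sigma>] sd v] vanish[OF c(1) \<sigma> chainD[OF sd]] n0) (auto simp only: n_def le_add1)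
        ultimately show ?thesis
          using pairing_identity[OF cS \<sigma>S] by (simp add: pairing_def combine_diff)
      qed
      finally show "coboundary sc S L (int p) b \<sigma> = - c \<sigma>" .
    qed
  qed
qed

end

subsection \<open>The Thom isomorphism\<close>

context coefficient_system
begin

abbreviation pairs_isomorphic where
  "pairs_isomorphic P Q q P' Q' q' \<equiv>
     quotients_isomorphic (rel_cocycles P Q q) (rel_coboundaries P Q q) (rel_cocycles P' Q' q') (rel_coboundaries P' Q' q')"

text \<open>Small simplices compute the cohomology of the union relative to \<open>B\<close>; for
  them excision is the equality \<open>excision_families\<close>.\<close>

lemma excision:
  assumes S: "A \<union> B \<subseteq> S" and AB: "openin (top_of_set (A \<union> B)) A" "openin (top_of_set (A \<union> B)) B"
  shows "pairs_isomorphic (family (A \<union> B)) (family B) q (family A) (family (A \<inter> B)) q"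
proof -
  have f: "face_closed (family A)" "face_closed (family B)" "face_closed (family (A \<union> B))"
    using S by (auto intro!: face_closed_family)
  have "pairs_isomorphic (family (A \<union> B)) (family B) q (\<lambda>q. family A q \<union> family B q) (family B) q"
    using f small_simplices_acyclic[OF assms] family_mono
    by (intro isomorphic_restriction face_closed_Un) auto
  then show ?thesis
    unfolding family_Int excision_families[OF f(1,2)] .
qed

lemma family_empty: "family {} = (\<lambda>_. {})"
  by (auto simp: family_def simplex_of_degree_def singular_simplex_empty fun_eq_iff)

end

text \<open>The set \<open>S\<close> is \<open>M'\<close>, the hyperplane \<open>H\<close> is the zero set of \<open>f\<close>, and \<open>E\<close> parametrises a complementary line.\<close>

locale transversal_line = coefficient_system sc S L
  for sc :: "complex \<Rightarrow> 'v::ab_group_add \<Rightarrow> 'v" and S :: "'a::real_normed_vector set" and L +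
  fixes f :: "'a \<Rightarrow> complex" and E :: "complex \<Rightarrow> 'a"
  assumes open_S: "open S" and continuous_f: "continuous_on UNIV f"
    and linear_E: "bounded_linear E" and f_E: "f (x + E z) = f x + z"
begin

text \<open>Projection onto the zero set of \<open>f\<close> along the line \<open>E\<close>;
  together with the fibre coordinate \<open>f x\<close> it splits the whole space as a
  product.\<close>

definition foot :: "'a \<Rightarrow> 'a" where
  "foot x = x - E (f x)"

lemma f_foot [simp]: "f (foot x) = 0"
  using f_E[of x "- f x"] bounded_linear.linear[OF linear_E] by (simp add: foot_def linear_neg)

lemma foot_add [simp]: "foot (foot x + E z) = foot x"
  unfolding foot_def[of "foot x + E z"] f_E by simp

lemma foot_zero: "f x = 0 \<Longrightarrow> foot x = x"
  using bounded_linear.linear[OF linear_E] by (simp add: foot_def linear_0)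

lemma foot_decomposition: "foot x + E (f x) = x"
  by (simp add: foot_def)

lemma continuous_E: "continuous_on A g \<Longrightarrow> continuous_on A (\<lambda>x. E (g x))"
  by (rule bounded_linear.continuous_on[OF linear_E])

lemma continuous_foot: "continuous_on UNIV foot"
  unfolding foot_def by (intro continuous_intros continuous_E continuous_f)

text \<open>The radius is the distance to the complement of \<open>S\<close>, divided by a bound for
  \<open>E\<close> so that a coordinate below it cannot leave \<open>S\<close>.\<close>

lemma tube_radius:
  obtains \<delta> :: "'a \<Rightarrow> real" where "continuous_on UNIV \<delta>" "\<And>x. x \<in> S \<Longrightarrow> 0 < \<delta> x"
    "\<And>x z. x \<in> S \<Longrightarrow> norm z < \<delta> x \<Longrightarrow> x + E z \<in> S"
proof (cases "S = UNIV")
  case True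
  \<comment> \<open>The distance to the empty complement is zero by convention, hence a constant
    radius here.\<close>
  then show ?thesis by (intro that[of "\<lambda>_. 1"]) auto
next
  case False
  obtain K where K: "K > 0" "\<And>z. norm (E z) \<le> norm z * K"
    using bounded_linear.pos_bounded[OF linear_E] by blast
  have ne: "- S \<noteq> {}" using False by auto
  show ?thesis
  proof (rule that[of "\<lambda>x. infdist x (- S) / K"])
    show "continuous_on UNIV (\<lambda>x. infdist x (- S) / K)"
      using K(1) by (intro continuous_intros) auto
    show "0 < infdist x (- S) / K" if "x \<in> S" for x
    proof -
      have "x \<notin> closure (- S)" using that open_S by (simp add: closure_closed closed_Compl)
      then show ?thesis using K(1) ne in_closure_iff_infdist_zero[OF ne, of x] infdist_nonneg[of x "- S"]
        by (auto simp: less_le)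
    qed
    show "x + E z \<in> S" if "x \<in> S" "norm z < infdist x (- S) / K" for x z
    proof (rule ccontr)
      assume "x + E z \<notin> S"
      then have "infdist x (- S) \<le> dist x (x + E z)" by (intro infdist_le) auto
      also have "\<dots> \<le> norm z * K" using K(2) by (simp add: dist_norm)
      also have "\<dots> < infdist x (- S)" using that(2) K(1) by (simp add: pos_less_divide_eq)
      finally show False by simp
    qed
  qed
qed

text \<open>The rise by two in degree is produced by the connecting steps \<open>2\<close> and
  \<open>4\<close>; all other steps keep the degree.\<close>

theorem thom_isomorphism:
  "pairs_isomorphic (family {x\<in>S. f x = 0}) (family {}) (q - 1) (family S) (family {x\<in>S. f x \<noteq> 0}) (q + 1)"
proof -
  obtain \<delta> :: "'a \<Rightarrow> real" where \<delta>: "continuous_on UNIV \<delta>" "\<And>x. x \<in> S \<Longrightarrow> 0 < \<delta> x"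
    "\<And>x z. x \<in> S \<Longrightarrow> norm z < \<delta> x \<Longrightarrow> x + E z \<in> S"
    using tube_radius by blast
  \<comment> \<open>\<open>U UNIV\<close> is the whole tube, with a disc of radius
    \<open>\<delta>\<close> over each foot point in \<open>S\<close>; the set \<open>C\<close>
    constrains the fibre coordinate alone.\<close>
  define U where "U = (\<lambda>C. {x. foot x \<in> S \<and> norm (f x) < \<delta> (foot x) \<and> f x \<in> C})"
  have US: "U C \<subseteq> S" for C
    using \<delta>(3) foot_decomposition by (auto simp: U_def) metis
  have U_mono: "C \<subseteq> D \<Longrightarrow> U C \<subseteq> U D" for C D by (auto simp: U_def)
  have U_Un: "U C \<union> U D = U (C \<union> D)" and U_Int: "U C \<inter> U D = U (C \<inter> D)" for C D by (auto simp: U_def)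
  have cf: "continuous_on UNIV (\<lambda>x. \<delta> (foot x))"
    by (rule continuous_on_compose2[OF \<delta>(1) continuous_foot]) simp
  have open_U: "open (U C)" if "open C" for C
  proof -
    have "U C = foot -` S \<inter> {x. norm (f x) < \<delta> (foot x)} \<inter> f -` C" by (auto simp: U_def)
    moreover have "open (foot -` S)" "open (f -` C)"
      using continuous_foot continuous_f open_S that by (auto intro: open_vimage)
    moreover have "open {x. norm (f x) < \<delta> (foot x)}"
      by (intro open_Collect_less continuous_on_norm continuous_f cf)
    ultimately show ?thesis by auto
  qed
  have openin: "openin (top_of_set T) V" if "open V" "V \<subseteq> T" for V T :: "'a set"
    using that by (simp add: open_subset)
  text \<open>The fibre over a foot point \<open>p\<close> is contracted linearly to its point with coordinate \<open>\<delta> p * s\<close>.\<close>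
  have deform: "acyclic_pair (family (U C)) (family (U D))"
    if DC: "D \<subseteq> C" and s: "norm s < 1" "\<And>r. r > 0 \<Longrightarrow> of_real r * s \<in> D"
      and C: "\<And>z t r. z \<in> C \<Longrightarrow> t \<in> {0..1} \<Longrightarrow> r > 0 \<Longrightarrow> of_real (1 - t) * z + of_real (t * r) * s \<in> C"
      and D: "\<And>z t r. z \<in> D \<Longrightarrow> t \<in> {0..1} \<Longrightarrow> r > 0 \<Longrightarrow> of_real (1 - t) * z + of_real (t * r) * s \<in> D"
    for C D :: "complex set" and s :: complex
  proof -
    let ?g = "\<lambda>p. of_real (1 - fst p) * f (snd p) + of_real (fst p * \<delta> (foot (snd p))) * s"
    let ?h = "\<lambda>p. foot (snd p) + E (?g p)"
    have f_h: "f (?h p) = ?g p" for p by (simp add: f_E)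
    have foot_h: "foot (?h p) = foot (snd p)" for p by simp
    have inU: "?h (t, x) \<in> U X" if t: "t \<in> {0..1}" and x: "x \<in> U UNIV" and g: "?g (t, x) \<in> X" for t x X
    proof -
      let ?r = "\<delta> (foot x)"
      have x': "foot x \<in> S" "norm (f x) < ?r" using x by (auto simp: U_def)
      have "norm (?g (t, x)) \<le> norm (of_real (1 - t) * f x) + norm (of_real (t * ?r) * s)"
        by (simp add: norm_triangle_ineq del: norm_mult)
      also have "\<dots> = (1 - t) * norm (f x) + t * (?r * norm s)"
        using t \<delta>(2)[OF x'(1)] by (simp add: norm_mult abs_mult flip: of_real_diff)
      \<comment> \<open>This is a convex combination of \<open>norm (f x)\<close> and
        \<open>?r * norm s\<close>, both below \<open>?r\<close>; \<open>norm s < 1\<close> gives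
        strictness for \<open>t > 0\<close>, and \<open>t = 0\<close> is the starting point.\<close>
      also have "\<dots> < ?r"
      proof (cases "t = 0")
        case False
        have "(1 - t) * norm (f x) \<le> (1 - t) * ?r" using t x' by (intro mult_left_mono) auto
        moreover have "t * (?r * norm s) < t * ?r"
          using t False \<delta>(2)[OF x'(1)] s(1) by (simp add: mult_less_cancel_left2)
        ultimately show ?thesis by (simp add: algebra_simps)
      qed (use x' in auto)
      finally show ?thesis
        using x'(1) g unfolding U_def mem_Collect_eq foot_h f_h by simp
    qed
    have UU: "x \<in> U UNIV" "f x \<in> X" "\<delta> (foot x) > 0" if "x \<in> U X" for x X
      using that \<delta>(2) by (auto simp: U_def)
    show ?thesis
    proof (rule deformation_acyclic[of _ _ ?h])
      show "U D \<subseteq> U C" "U C \<subseteq> S" using U_mono[OF DC] US by auto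
      have "continuous_on UNIV ?h"
        by (intro continuous_intros continuous_E continuous_on_compose2[OF continuous_foot]
            continuous_on_compose2[OF continuous_f] continuous_on_compose2[OF cf]) auto
      then show "continuous_on ({0..1} \<times> U C) ?h" by (rule continuous_on_subset) simp
      show "?h (t, x) \<in> U C" if "t \<in> {0..1}" "x \<in> U C" for t x
        using inU[OF that(1) UU(1)[OF that(2)]] C[OF UU(2)[OF that(2)] that(1) UU(3)[OF that(2)]] by simp
      show "?h (t, x) \<in> U D" if "t \<in> {0..1}" "x \<in> U D" for t x
        using inU[OF that(1) UU(1)[OF that(2)]] D[OF UU(2)[OF that(2)] that(1) UU(3)[OF that(2)]] by simp
      show "?h (0, x) = x" for x using foot_decomposition by simp
      show "?h (1, x) \<in> U D" if "x \<in> U C" for x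
        using inU[of 1, OF _ UU(1)[OF that]] s(2)[OF UU(3)[OF that]] by simp
    qed
  qed
  \<comment> \<open>\<open>?slit\<close> omits the closed ray of nonnegative reals. Together with
    \<open>?right\<close> it covers the punctured plane, and the two overlap in the disjoint
    quadrants \<open>?up\<close> and \<open>?down\<close>.\<close>
  let ?slit = "{z. Im z = 0 \<longrightarrow> Re z < 0}" and ?right = "{z. 0 < Re z}"
  let ?up = "{z. 0 < Re z \<and> 0 < Im z}" and ?down = "{z. 0 < Re z \<and> Im z < 0}"
  have open_sets: "open (- {0 :: complex})" "open ?slit" "open ?right" "open ?up" "open ?down"
  proof -
    have e: "?slit = {z. Im z < 0} \<union> {z. 0 < Im z} \<union> {z. Re z < 0}" by auto
    show "open ?slit" unfolding e
      by (intro open_Un open_halfspace_Im_gt open_halfspace_Im_lt open_halfspace_Re_lt)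
    show "open ?right" by (rule open_halfspace_Re_gt)
    show "open ?up" "open ?down"
      by (intro open_Collect_conj open_halfspace_Im_gt open_halfspace_Im_lt open_halfspace_Re_gt)+
  qed auto
  \<comment> \<open>The slit plane is not convex, but star-shaped about every negative real: a
    segment towards such a point meets the real axis only on the negative side.\<close>
  have convex_slit: "of_real (1 - t) * z + of_real (t * r) * (- 1 / 2) \<in> ?slit"
    if "z \<in> ?slit" "t \<in> {0..1}" "r > 0" for z :: complex and t r :: real
  proof -
    have "(1 - t) * Re z - t * r / 2 < 0" if "(1 - t) * Im z = 0"
    proof (cases "t = 1")
      case True
      then show ?thesis using \<open>r > 0\<close> by simp
    next
      case False
      then have "Im z = 0" "1 - t > 0" using that \<open>t \<in> {0..1}\<close> by auto
      then have "(1 - t) * Re z < 0" using \<open>z \<in> ?slit\<close> by (simp add: mult_pos_neg)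
      moreover have "t * r \<ge> 0" using \<open>t \<in> {0..1}\<close> \<open>r > 0\<close> by simp
      ultimately show ?thesis by simp
    qed
    then show ?thesis by (simp add: field_simps)
  qed
  have pos: "0 < (1 - t) * a + t * r * b" if "0 < a" "t \<in> {0..1}" "0 < r" "0 < b" for a b t r :: real
    using that by (cases "t = 0") (auto intro!: add_nonneg_pos)
  have conv_up: "of_real (1 - t) * z + of_real (t * r) * Complex (1/4) (1/4) \<in> ?up"
    if "z \<in> ?up" "t \<in> {0..1}" "r > 0" for z t r
    using that pos[of "Re z" t r "1/4"] pos[of "Im z" t r "1/4"] by auto
  \<comment> \<open>The target for \<open>?right\<close> is chosen in \<open>?down\<close>, since
    one deformation has to contract the half plane and preserve the quadrant.\<close>
  have conv_right: "of_real (1 - t) * z + of_real (t * r) * Complex (1/4) (- 1/4) \<in> ?right"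
    if "z \<in> ?right" "t \<in> {0..1}" "r > 0" for z t r
    using that pos[of "Re z" t r "1/4"] by auto
  have conv_down: "of_real (1 - t) * z + of_real (t * r) * Complex (1/4) (- 1/4) \<in> ?down"
    if "z \<in> ?down" "t \<in> {0..1}" "r > 0" for z t r
    using that pos[of "Re z" t r "1/4"] pos[of "- Im z" t r "1/4"] by auto
  \<comment> \<open>The value \<open>1/4\<close> only has to keep the targets inside the quadrants
    and inside the open unit disc.\<close>
  have norm_s: "norm (Complex (1/4) (1/4)) < 1" "norm (Complex (1/4) (- 1/4)) < 1"
    by (auto simp: complex_norm real_sqrt_less_iff[of _ 1, simplified] power2_eq_square)
  have S0: "{x\<in>S. f x = 0} = U {0}"
    using \<delta>(2) foot_zero US[of "{0}"] by (auto simp: U_def)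
  have acyclic: "acyclic_pair (family (U UNIV)) (family (U ?slit))" "acyclic_pair (family (U ?right)) (family (U ?down))"
      "acyclic_pair (family (U UNIV)) (family (U ?up))" "acyclic_pair (family (U UNIV)) (family (U {0}))"
  proof -
    show "acyclic_pair (family (U UNIV)) (family (U ?slit))"
      by (rule deform[of _ _ "- 1 / 2"]) (use convex_slit in auto)
    show "acyclic_pair (family (U ?right)) (family (U ?down))"
      by (rule deform[of _ _ "Complex (1/4) (- 1/4)"]) (use conv_down conv_right norm_s in auto)
    show "acyclic_pair (family (U UNIV)) (family (U ?up))"
      by (rule deform[of _ _ "Complex (1/4) (1/4)"]) (use conv_up norm_s in auto)
    \<comment> \<open>With target \<open>0\<close> the deformation retracts the tube onto the zero
      set.\<close>
    show "acyclic_pair (family (U UNIV)) (family (U {0}))"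
      by (rule deform[of _ _ 0]) auto
  qed
  have fc: "face_closed (family (U C))" for C by (rule face_closed_family[OF US])
  have fe: "face_closed (family {})" by (rule face_closed_family) simp
  note iso = isomorphic_connecting[OF fc fc fc family_mono family_mono]
    isomorphic_restriction[OF fc fc fe family_mono family_mono]
  have 1: "pairs_isomorphic (family S) (family {x\<in>S. f x \<noteq> 0}) (q + 1) (family (U UNIV)) (family (U (- {0}))) (q + 1)"
  proof -
    let ?B = "{x\<in>S. f x \<noteq> 0}"
    have B: "?B = S \<inter> f -` (- {0})" by auto
    have oB: "open ?B" unfolding B using open_S continuous_f by (intro open_Int open_vimage open_sets) auto
    \<comment> \<open>The zero set of \<open>f\<close> in \<open>S\<close> lies in the tube because
      \<open>\<delta>\<close> is positive on \<open>S\<close>.\<close>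
    have un: "U UNIV \<union> ?B = S" using S0 U_mono[of "{0}" UNIV] US by auto
    have int: "U UNIV \<inter> ?B = U (- {0})" using US[of UNIV] by (auto simp: U_def)
    show ?thesis
      using excision[of "U UNIV" ?B "q + 1"] US unfolding un int
      by (simp add: openin oB open_U)
  qed
  \<comment> \<open>First rise in degree, from the triple of slit plane, punctured plane and
    plane.\<close>
  have 2: "pairs_isomorphic (family (U (- {0}))) (family (U ?slit)) q (family (U UNIV)) (family (U (- {0}))) (q + 1)"
    by (rule iso(1)[OF _ _ acyclic(1)]) (auto intro!: U_mono)
  have 3: "pairs_isomorphic (family (U (- {0}))) (family (U ?slit)) q (family (U ?right)) (family (U (?right \<inter> ?slit))) q"
  proof -
    have "?right \<union> ?slit = - {0}" by (auto simp: complex_eq_iff)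
    then show ?thesis
      using excision[of "U ?right" "U ?slit" q] US[of "- {0}"] U_mono[of ?right "- {0}"] U_mono[of ?slit "- {0}"] open_U open_sets
      unfolding U_Un U_Int by (auto simp: openin)
  qed
  have W: "?up \<union> ?down = ?right \<inter> ?slit" by auto
  \<comment> \<open>Second rise in degree, from the triple of \<open>?down\<close>, both quadrants
    and \<open>?right\<close>.\<close>
  have 4: "pairs_isomorphic (family (U (?right \<inter> ?slit))) (family (U ?down)) (q - 1)
      (family (U ?right)) (family (U (?right \<inter> ?slit))) (q - 1 + 1)"
    by (rule iso(1)[OF _ _ acyclic(2)]) (auto intro!: U_mono)
  \<comment> \<open>The quadrants are disjoint, so excising \<open>?down\<close> leaves the absolute
    cohomology over \<open>?up\<close>.\<close>
  have 5: "pairs_isomorphic (family (U (?right \<inter> ?slit))) (family (U ?down)) (q - 1) (family (U ?up)) (family {}) (q - 1)"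
  proof -
    have "?up \<inter> ?down = {}" by auto
    moreover have "U {} = {}" by (simp add: U_def)
    moreover have "openin (top_of_set (U (?right \<inter> ?slit))) (U ?up)" "openin (top_of_set (U (?right \<inter> ?slit))) (U ?down)"
      using open_sets by (auto intro!: openin open_U U_mono)
    ultimately show ?thesis
      using excision[of "U ?up" "U ?down" "q - 1"] US unfolding U_Un U_Int W by simp
  qed
  have 6: "pairs_isomorphic (family (U UNIV)) (family {}) (q - 1) (family (U ?up)) (family {}) (q - 1)"
    by (rule iso(2)[OF _ _ acyclic(3)]) (auto intro!: U_mono)
  have 7: "pairs_isomorphic (family (U UNIV)) (family {}) (q - 1) (family (U {0})) (family {}) (q - 1)"
    by (rule iso(2)[OF _ _ acyclic(4)]) (auto intro!: U_mono)
  have "pairs_isomorphic (family (U {0})) (family {}) (q - 1) (family (U ?right)) (family (U (?right \<inter> ?slit))) q"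
    using quotients_isomorphic_trans[OF quotients_isomorphic_sym[OF 7] quotients_isomorphic_trans[OF 6
        quotients_isomorphic_trans[OF quotients_isomorphic_sym[OF 5] 4]]] by simp
  then show ?thesis
    unfolding S0
    by (rule quotients_isomorphic_trans[OF _ quotients_isomorphic_trans[OF quotients_isomorphic_sym[OF 3]
        quotients_isomorphic_trans[OF 2 quotients_isomorphic_sym[OF 1]]]])
qed

end

subsection \<open>Maps of cohomology induced by linear relations\<close>

context coefficient_system
begin

definition coset :: "('a, 'v) cochain set \<Rightarrow> ('a, 'v) cochain \<Rightarrow> ('a, 'v) cochain set" where
  "coset N x = (\<lambda>h. h + x) ` N"

definition cochain_subspace :: "('a, 'v) cochain set \<Rightarrow> bool" where
  "cochain_subspace Z \<longleftrightarrow> 0 \<in> Z \<and> (\<forall>x\<in>Z. \<forall>y\<in>Z. x + y \<in> Z) \<and> (\<forall>a. \<forall>x\<in>Z. cochain_scale a x \<in> Z)"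

lemma cochain_scale_minus: "cochain_scale (- 1) x = - x"
  by (auto simp: fun_eq_iff)

lemma
  assumes "cochain_subspace Z"
  shows cochain_subspace_0: "0 \<in> Z"
    and cochain_subspace_add: "x \<in> Z \<Longrightarrow> y \<in> Z \<Longrightarrow> x + y \<in> Z"
    and cochain_subspace_scale: "x \<in> Z \<Longrightarrow> cochain_scale a x \<in> Z"
    and cochain_subspace_minus: "x \<in> Z \<Longrightarrow> - x \<in> Z"
    and cochain_subspace_diff: "x \<in> Z \<Longrightarrow> y \<in> Z \<Longrightarrow> x - y \<in> Z"
proof -
  show *: "0 \<in> Z" "x \<in> Z \<Longrightarrow> y \<in> Z \<Longrightarrow> x + y \<in> Z" "x \<in> Z \<Longrightarrow> cochain_scale a x \<in> Z" for x y a
    using assms by (auto simp: cochain_subspace_def)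
  show minus: "x \<in> Z \<Longrightarrow> - x \<in> Z" for x
    using *(3)[of x "- 1"] by (simp add: cochain_scale_minus)
  show "x \<in> Z \<Longrightarrow> y \<in> Z \<Longrightarrow> x - y \<in> Z"
    using *(2)[of x "- y"] minus by simp
qed

lemma mem_coset: "y \<in> coset N x \<longleftrightarrow> y - x \<in> N"
  by (force simp: coset_def image_iff)

lemma coset_eq_iff:
  assumes N: "cochain_subspace N"
  shows "coset N x = coset N y \<longleftrightarrow> x - y \<in> N"
proof
  assume "coset N x = coset N y"
  then show "x - y \<in> N"
    using cochain_subspace_0[OF N] by (metis mem_coset diff_self)
next
  assume xy: "x - y \<in> N"
  have "z - x \<in> N \<longleftrightarrow> z - y \<in> N" for z
    using cochain_subspace_add[OF N _ xy, of "z - x"] cochain_subspace_diff[OF N _ xy, of "z - y"] by auto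
  then show "coset N x = coset N y" by (auto simp: mem_coset)
qed

lemma coset_0: "coset N 0 = N"
  by (simp add: coset_def)

section \<open>Cohomology of a subspace as cohomology relative to the empty family\<close>

lemma cochains_family: "cochains B L q = rel_cochains (family B) (family {}) q"
  unfolding cochains_def rel_cochains_def family_empty by (simp add: family_def)

lemma coboundary_family:
  assumes "B \<subseteq> S"
  shows "coboundary sc B L q c = rel_coboundary (family B) q c"
  using family_mono[OF assms, of "q + 1"]
  by (auto simp: coboundary_def rel_coboundary_def cut_def family_def fun_eq_iff)

lemma cocycles_family: "B \<subseteq> S \<Longrightarrow> cocycles sc B L q = rel_cocycles (family B) (family {}) q"
  by (simp add: cocycles_def rel_cocycles_def cochains_family coboundary_family zero_fun_def)

lemma coboundaries_family: "B \<subseteq> S \<Longrightarrow> coboundaries sc B L q = rel_coboundaries (family B) (family {}) q"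
  by (auto simp: coboundaries_def rel_coboundaries_def cochains_family coboundary_family)

lemma rel_cocycles_subspace: "face_closed P \<Longrightarrow> cochain_subspace (rel_cocycles P Q q)"
  unfolding cochain_subspace_def rel_cocycles_def
  using rel_cochains_add rel_coboundary_add rel_cochains_scale rel_coboundary_scale
  by (auto simp: fun_eq_iff)

lemma rel_coboundaries_subspace:
  assumes P: "face_closed P"
  shows "cochain_subspace (rel_coboundaries P Q q)"
  unfolding cochain_subspace_def rel_coboundaries_def
proof (intro conjI ballI allI)
  show "0 \<in> rel_coboundary P (q - 1) ` rel_cochains P Q (q - 1)"
    using P by (intro image_eqI[of _ _ 0]) auto
  fix x y a assume "x \<in> rel_coboundary P (q - 1) ` rel_cochains P Q (q - 1)"
  then obtain c where c: "c \<in> rel_cochains P Q (q - 1)" "x = rel_coboundary P (q - 1) c" by blast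
  show "cochain_scale a x \<in> rel_coboundary P (q - 1) ` rel_cochains P Q (q - 1)"
    using c rel_coboundary_scale[OF P c(1)] rel_cochains_scale[OF P c(1)]
    by (intro image_eqI[of _ _ "cochain_scale a c"]) auto
  assume "y \<in> rel_coboundary P (q - 1) ` rel_cochains P Q (q - 1)"
  then obtain d where d: "d \<in> rel_cochains P Q (q - 1)" "y = rel_coboundary P (q - 1) d" by blast
  show "x + y \<in> rel_coboundary P (q - 1) ` rel_cochains P Q (q - 1)"
    using c d rel_coboundary_add[OF P c(1) d(1)] rel_cochains_add[OF P c(1) d(1)]
    by (intro image_eqI[of _ _ "c + d"]) auto
qed

lemma rel_coboundaries_cocycles:
  assumes "face_closed P" "face_closed Q" "\<And>q. Q q \<subseteq> P q"
  shows "rel_coboundaries P Q q \<subseteq> rel_cocycles P Q q"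
  using rel_coboundary_in[OF assms, of _ "q - 1"] rel_coboundary_rel_coboundary[OF assms(1), of _ Q "q - 1"]
  by (auto simp: rel_coboundaries_def rel_cocycles_def)

lemma
  assumes "B \<subseteq> S"
  shows cocycles_subspace: "cochain_subspace (cocycles sc B L q)"
    and coboundaries_subspace: "cochain_subspace (coboundaries sc B L q)"
    and coboundaries_cocycles: "coboundaries sc B L q \<subseteq> cocycles sc B L q"
  using assms face_closed_family[OF assms] face_closed_family[of "{}"]
    rel_coboundaries_cocycles[of "family B" "family {}" q]
  by (simp_all add: cocycles_family coboundaries_family rel_cocycles_subspace rel_coboundaries_subspace family_mono)

lemma module_coset: "N +>\<^bsub>cocycle_module sc B L q\<^esub> x = coset N x"
  by (auto simp: a_r_coset_def r_coset_def cocycle_module_def coset_def plus_fun_def)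

lemma carrier_cohomology: "carrier (cohomology sc q B L) = coset (coboundaries sc B L q) ` cocycles sc B L q"
  unfolding cohomology_def quotient_module_def
  by (auto simp: A_RCOSETS_def RCOSETS_def module_coset[unfolded a_r_coset_def]) (auto simp: cocycle_module_def)

lemma coset_add:
  assumes "B \<subseteq> S"
  shows "coset (coboundaries sc B L q) x \<oplus>\<^bsub>cohomology sc q B L\<^esub> coset (coboundaries sc B L q) y
    = coset (coboundaries sc B L q) (x + y)" (is "?l = coset ?N _")
proof -
  have "?l = {u + v |u v. u \<in> coset ?N x \<and> v \<in> coset ?N y}"
    by (auto simp: cohomology_def quotient_module_def set_add_def set_mult_def cocycle_module_def plus_fun_def)
  also have "\<dots> = coset ?N (x + y)"
  proof (intro equalityI subsetI)
    fix z assume "z \<in> {u + v |u v. u \<in> coset ?N x \<and> v \<in> coset ?N y}"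
    then obtain u v where "z = u + v" "u - x \<in> ?N" "v - y \<in> ?N" by (auto simp: mem_coset)
    moreover have "u + v - (x + y) = (u - x) + (v - y)" by simp
    ultimately show "z \<in> coset ?N (x + y)"
      using cochain_subspace_add[OF coboundaries_subspace[OF assms]] by (metis mem_coset)
  next
    fix z assume "z \<in> coset ?N (x + y)"
    then have "z - y \<in> coset ?N x" by (simp add: mem_coset algebra_simps)
    moreover have "y \<in> coset ?N y"
      using cochain_subspace_0[OF coboundaries_subspace[OF assms]] by (simp add: mem_coset)
    ultimately show "z \<in> {u + v |u v. u \<in> coset ?N x \<and> v \<in> coset ?N y}"
      by (intro CollectI exI[of _ "z - y"] exI[of _ y]) simp
  qed
  finally show ?thesis .
qed

text \<open>The scalar multiple is a union over representatives; as scaling preserves coboundaries,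
  all its members are the same coset.\<close>

lemma coset_smult:
  assumes "B \<subseteq> S"
  shows "a \<odot>\<^bsub>cohomology sc q B L\<^esub> coset (coboundaries sc B L q) x
    = coset (coboundaries sc B L q) (cochain_scale a x)" (is "?l = coset ?N _")
proof -
  note N = coboundaries_subspace[OF assms, of q]
  have "?l = (\<Union>u\<in>coset ?N x. coset ?N (cochain_scale a u))"
    by (simp add: cohomology_def quotient_module_def module_coset) (simp add: cocycle_module_def cochain_scale_def)
  also have "\<dots> = (\<Union>u\<in>coset ?N x. coset ?N (cochain_scale a x))"
  proof (rule SUP_cong[OF refl])
    fix u assume "u \<in> coset ?N x"
    then have "cochain_scale a (u - x) \<in> ?N" by (intro cochain_subspace_scale[OF N]) (simp add: mem_coset)
    moreover have "cochain_scale a (u - x) = cochain_scale a u - cochain_scale a x"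
      by (auto simp: fun_eq_iff scale_right_diff_distrib)
    ultimately show "coset ?N (cochain_scale a u) = coset ?N (cochain_scale a x)"
      by (simp add: coset_eq_iff[OF N])
  qed
  also have "\<dots> = coset ?N (cochain_scale a x)"
    using cochain_subspace_0[OF N] by (auto simp: coset_def)
  finally show ?thesis .
qed

lemma zero_cohomology: "\<zero>\<^bsub>cohomology sc q B L\<^esub> = coset (coboundaries sc B L q) 0"
  by (simp add: cohomology_def quotient_module_def coset_0)

lemma group_cohomology:
  assumes B: "B \<subseteq> S"
  shows "group (additive_group (cohomology sc q B L))"
proof (rule groupI)
  let ?N = "coboundaries sc B L q" and ?G = "additive_group (cohomology sc q B L)"
  note Z = cocycles_subspace[OF B, of q]
  show "\<one>\<^bsub>?G\<^esub> \<in> carrier ?G"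
    using cochain_subspace_0[OF Z] by (auto simp: additive_group_def carrier_cohomology zero_cohomology)
  fix X assume X: "X \<in> carrier ?G"
  then obtain x where x: "x \<in> cocycles sc B L q" "X = coset ?N x" by (auto simp: additive_group_def carrier_cohomology)
  show "\<one>\<^bsub>?G\<^esub> \<otimes>\<^bsub>?G\<^esub> X = X"
    by (simp add: additive_group_def zero_cohomology x coset_add[OF B])
  show "\<exists>Y\<in>carrier ?G. Y \<otimes>\<^bsub>?G\<^esub> X = \<one>\<^bsub>?G\<^esub>"
    using cochain_subspace_minus[OF Z x(1)]
    by (intro bexI[of _ "coset ?N (- x)"]) (auto simp: additive_group_def carrier_cohomology zero_cohomology x coset_add[OF B])
  fix Y assume "Y \<in> carrier ?G"
  then obtain y where y: "y \<in> cocycles sc B L q" "Y = coset ?N y" by (auto simp: additive_group_def carrier_cohomology)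
  show "X \<otimes>\<^bsub>?G\<^esub> Y \<in> carrier ?G"
    using cochain_subspace_add[OF Z x(1) y(1)] by (auto simp: additive_group_def carrier_cohomology x y coset_add[OF B])
  fix W assume "W \<in> carrier ?G"
  then obtain w where w: "w \<in> cocycles sc B L q" "W = coset ?N w" by (auto simp: additive_group_def carrier_cohomology)
  show "X \<otimes>\<^bsub>?G\<^esub> Y \<otimes>\<^bsub>?G\<^esub> W = X \<otimes>\<^bsub>?G\<^esub> (Y \<otimes>\<^bsub>?G\<^esub> W)"
    by (simp add: additive_group_def x y w coset_add[OF B] add.assoc)
qed

text \<open>A linear relation of this kind induces the map \<open>X \<mapsto> R `` X\<close> from cosets to cosets.\<close>

definition quotient_relation where
  "quotient_relation Z\<^sub>1 N\<^sub>1 Z\<^sub>2 N\<^sub>2 R \<longleftrightarrow> linear_relation R \<and> R \<subseteq> Z\<^sub>1 \<times> Z\<^sub>2 \<and> (\<forall>x\<in>Z\<^sub>1. \<exists>y. (x, y) \<in> R) \<and>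
     (\<forall>x y. (x, y) \<in> R \<longrightarrow> x \<in> N\<^sub>1 \<longrightarrow> y \<in> N\<^sub>2) \<and> (\<forall>y\<in>N\<^sub>2. (0, y) \<in> R)"

lemma linear_relation_add: "linear_relation R \<Longrightarrow> (x, y) \<in> R \<Longrightarrow> (x', y') \<in> R \<Longrightarrow> (x + x', y + y') \<in> R"
  and linear_relation_scale: "linear_relation R \<Longrightarrow> (x, y) \<in> R \<Longrightarrow> (cochain_scale a x, cochain_scale a y) \<in> R"
  by (auto simp: linear_relation_def)

lemma linear_relation_diff:
  assumes "linear_relation R" "(x, y) \<in> R" "(x', y') \<in> R"
  shows "(x - x', y - y') \<in> R"
  using linear_relation_add[OF assms(1,2) linear_relation_scale[OF assms(1,3), of "- 1"]]
  by (simp add: cochain_scale_minus)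

text \<open>The clause of \<open>quotient_relation\<close> on pairs \<open>(0, y)\<close> makes the
  image a full coset and not merely part of one; the clause on \<open>N\<^sub>1\<close> keeps it
  from being larger.\<close>

lemma Image_coset:
  assumes R: "quotient_relation Z\<^sub>1 N\<^sub>1 Z\<^sub>2 N\<^sub>2 R" and N: "0 \<in> N\<^sub>1" and xy: "(x, y) \<in> R"
  shows "R `` coset N\<^sub>1 x = coset N\<^sub>2 y"
proof -
  have lin: "linear_relation R" using R by (simp add: quotient_relation_def)
  show ?thesis
  proof (intro equalityI subsetI)
    fix w assume "w \<in> R `` coset N\<^sub>1 x"
    then obtain u where "u - x \<in> N\<^sub>1" "(u, w) \<in> R" by (auto simp: mem_coset)
    then show "w \<in> coset N\<^sub>2 y"
      using linear_relation_diff[OF lin _ xy, of u w] R by (auto simp: quotient_relation_def mem_coset)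
  next
    fix w assume "w \<in> coset N\<^sub>2 y"
    then have "(0, w - y) \<in> R" using R by (simp add: quotient_relation_def mem_coset)
    then have "(x, w) \<in> R" using linear_relation_add[OF lin _ xy, of 0 "w - y"] by simp
    then show "w \<in> R `` coset N\<^sub>1 x" using N by (auto simp: mem_coset)
  qed
qed

abbreviation cohomology_relation where
  "cohomology_relation B\<^sub>1 q\<^sub>1 B\<^sub>2 q\<^sub>2 \<equiv> quotient_relation (cocycles sc B\<^sub>1 L q\<^sub>1) (coboundaries sc B\<^sub>1 L q\<^sub>1)
     (cocycles sc B\<^sub>2 L q\<^sub>2) (coboundaries sc B\<^sub>2 L q\<^sub>2)"

text \<open>Agreement of \<open>F\<close> with the relation is demanded on classes only, because
  \<open>cohomology_induced\<close> is given by its own formula on arbitrary sets of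
  cochains.\<close>

lemma relation_linear_map:
  assumes B: "B\<^sub>1 \<subseteq> S" "B\<^sub>2 \<subseteq> S" and R: "cohomology_relation B\<^sub>1 q\<^sub>1 B\<^sub>2 q\<^sub>2 R"
    and F: "\<And>X. X \<in> carrier (cohomology sc q\<^sub>1 B\<^sub>1 L) \<Longrightarrow> F X = R `` X"
  shows "F \<in> linear_maps (cohomology sc q\<^sub>1 B\<^sub>1 L) (cohomology sc q\<^sub>2 B\<^sub>2 L)"
proof -
  let ?N1 = "coboundaries sc B\<^sub>1 L q\<^sub>1" and ?N2 = "coboundaries sc B\<^sub>2 L q\<^sub>2"
  let ?Z1 = "cocycles sc B\<^sub>1 L q\<^sub>1" and ?Z2 = "cocycles sc B\<^sub>2 L q\<^sub>2"
  note Z1 = cocycles_subspace[OF B(1), of q\<^sub>1]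
  have N1: "0 \<in> ?N1" by (rule cochain_subspace_0[OF coboundaries_subspace[OF B(1)]])
  have lin: "linear_relation R" and sub: "R \<subseteq> ?Z1 \<times> ?Z2" and tot: "\<And>x. x \<in> ?Z1 \<Longrightarrow> \<exists>y. (x, y) \<in> R"
    using R by (auto simp: quotient_relation_def)
  have val: "F (coset ?N1 x) = coset ?N2 y" if "(x, y) \<in> R" for x y
    using that sub F[of "coset ?N1 x"] Image_coset[OF R N1 that] by (auto simp: carrier_cohomology)
  have ex: "\<exists>x y. (x, y) \<in> R \<and> X = coset ?N1 x \<and> F X = coset ?N2 y" if "X \<in> carrier (cohomology sc q\<^sub>1 B\<^sub>1 L)" for X
    using that tot val unfolding carrier_cohomology by blast
  show ?thesis
    unfolding linear_maps_def hom_def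
  proof (intro CollectI conjI ballI allI)
    show "F \<in> carrier (additive_group (cohomology sc q\<^sub>1 B\<^sub>1 L)) \<rightarrow> carrier (additive_group (cohomology sc q\<^sub>2 B\<^sub>2 L))"
      using ex sub by (fastforce simp: additive_group_def carrier_cohomology)
  next
    fix X Y assume "X \<in> carrier (additive_group (cohomology sc q\<^sub>1 B\<^sub>1 L))" "Y \<in> carrier (additive_group (cohomology sc q\<^sub>1 B\<^sub>1 L))"
    then obtain x y x' y' where x: "(x, y) \<in> R" "X = coset ?N1 x" "F X = coset ?N2 y"
      and x': "(x', y') \<in> R" "Y = coset ?N1 x'" "F Y = coset ?N2 y'"
      using ex[of X] ex[of Y] by (auto simp: additive_group_def)
    show "F (X \<otimes>\<^bsub>additive_group (cohomology sc q\<^sub>1 B\<^sub>1 L)\<^esub> Y) = F X \<otimes>\<^bsub>additive_group (cohomology sc q\<^sub>2 B\<^sub>2 L)\<^esub> F Y"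
      using val[OF linear_relation_add[OF lin x(1) x'(1)]] x x' by (simp add: additive_group_def coset_add B)
  next
    fix a X assume "X \<in> carrier (cohomology sc q\<^sub>1 B\<^sub>1 L)"
    then obtain x y where x: "(x, y) \<in> R" "X = coset ?N1 x" "F X = coset ?N2 y"
      using ex[of X] by auto
    show "F (a \<odot>\<^bsub>cohomology sc q\<^sub>1 B\<^sub>1 L\<^esub> X) = a \<odot>\<^bsub>cohomology sc q\<^sub>2 B\<^sub>2 L\<^esub> F X"
      using val[OF linear_relation_scale[OF lin x(1)]] x by (simp add: coset_smult B)
  qed
qed

text \<open>Exactness is reduced to representatives: a class is killed when its representative is
  related to a coboundary, and lies in the image when its representative is the second member of a
  related pair.\<close>

lemma relation_exact:
  assumes B: "B\<^sub>1 \<subseteq> S" "B\<^sub>2 \<subseteq> S" "B\<^sub>3 \<subseteq> S"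
    and R: "cohomology_relation B\<^sub>1 q\<^sub>1 B\<^sub>2 q\<^sub>2 R" and T: "cohomology_relation B\<^sub>2 q\<^sub>2 B\<^sub>3 q\<^sub>3 T"
    and F: "\<And>X. X \<in> carrier (cohomology sc q\<^sub>1 B\<^sub>1 L) \<Longrightarrow> F X = R `` X"
    and G: "\<And>X. X \<in> carrier (cohomology sc q\<^sub>2 B\<^sub>2 L) \<Longrightarrow> G X = T `` X"
    and exact: "\<And>y. y \<in> cocycles sc B\<^sub>2 L q\<^sub>2 \<Longrightarrow> (\<exists>x. (x, y) \<in> R) \<longleftrightarrow> (\<exists>w\<in>coboundaries sc B\<^sub>3 L q\<^sub>3. (y, w) \<in> T)"
  shows "kernel (additive_group (cohomology sc q\<^sub>2 B\<^sub>2 L)) (additive_group (cohomology sc q\<^sub>3 B\<^sub>3 L)) G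
    = F ` carrier (additive_group (cohomology sc q\<^sub>1 B\<^sub>1 L))"
proof -
  let ?N1 = "coboundaries sc B\<^sub>1 L q\<^sub>1" and ?N2 = "coboundaries sc B\<^sub>2 L q\<^sub>2" and ?N3 = "coboundaries sc B\<^sub>3 L q\<^sub>3"
  let ?Z1 = "cocycles sc B\<^sub>1 L q\<^sub>1" and ?Z2 = "cocycles sc B\<^sub>2 L q\<^sub>2"
  have N: "0 \<in> ?N1" "0 \<in> ?N2"
    using cochain_subspace_0[OF coboundaries_subspace] B by auto
  have "F ` carrier (additive_group (cohomology sc q\<^sub>1 B\<^sub>1 L)) = (\<lambda>x. R `` coset ?N1 x) ` ?Z1"
    using F by (auto simp: additive_group_def carrier_cohomology image_image)
  also have "\<dots> = {coset ?N2 y |y. \<exists>x. (x, y) \<in> R}"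
  proof (intro equalityI subsetI)
    fix Y assume "Y \<in> (\<lambda>x. R `` coset ?N1 x) ` ?Z1"
    then obtain x where x: "x \<in> ?Z1" "Y = R `` coset ?N1 x" by blast
    then obtain y where "(x, y) \<in> R" using R by (auto simp: quotient_relation_def)
    then show "Y \<in> {coset ?N2 y |y. \<exists>x. (x, y) \<in> R}" using Image_coset[OF R N(1)] x by blast
  next
    fix Y assume "Y \<in> {coset ?N2 y |y. \<exists>x. (x, y) \<in> R}"
    then obtain x y where "(x, y) \<in> R" "Y = coset ?N2 y" by blast
    then show "Y \<in> (\<lambda>x. R `` coset ?N1 x) ` ?Z1"
      using Image_coset[OF R N(1), of x y] R by (intro image_eqI[of _ _ x]) (auto simp: quotient_relation_def)
  qed
  also have "\<dots> = {coset ?N2 y |y. y \<in> ?Z2 \<and> (\<exists>w\<in>?N3. (y, w) \<in> T)}"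
  proof -
    have "y \<in> ?Z2" if "(x, y) \<in> R" for x y using R that by (auto simp: quotient_relation_def)
    then show ?thesis using exact by blast
  qed
  also have "\<dots> = {coset ?N2 y |y. y \<in> ?Z2 \<and> G (coset ?N2 y) = ?N3}"
  proof -
    have "(\<exists>w\<in>?N3. (y, w) \<in> T) \<longleftrightarrow> G (coset ?N2 y) = ?N3" if y: "y \<in> ?Z2" for y
    proof -
      have G': "G (coset ?N2 y) = T `` coset ?N2 y" using y by (intro G) (auto simp: carrier_cohomology)
      obtain w where w: "(y, w) \<in> T" using T y by (auto simp: quotient_relation_def)
      have eq: "G (coset ?N2 y) = coset ?N3 w'" if "(y, w') \<in> T" for w'
        unfolding G' by (rule Image_coset[OF T N(2) that])
      have iff: "coset ?N3 w' = ?N3 \<longleftrightarrow> w' \<in> ?N3" for w'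
        using coset_eq_iff[OF coboundaries_subspace[OF B(3)], of q\<^sub>3 w' 0] by (simp add: coset_0)
      show ?thesis using eq w iff by metis
    qed
    then show ?thesis by blast
  qed
  also have "\<dots> = kernel (additive_group (cohomology sc q\<^sub>2 B\<^sub>2 L)) (additive_group (cohomology sc q\<^sub>3 B\<^sub>3 L)) G"
    by (auto simp: kernel_def additive_group_def carrier_cohomology zero_cohomology coset_0)
  finally show ?thesis ..
qed

end

subsection \<open>The long exact sequence\<close>

context coefficient_system
begin

lemma pullback_cochain_id:
  assumes "B \<subseteq> S"
  shows "pullback_cochain id q B c = cut (family B q) c"
proof
  show "pullback_cochain id q B c \<sigma> = cut (family B q) c \<sigma>" for \<sigma>
    by (auto simp: pullback_cochain_def cut_def family_def simplex_of_degree_def singular_simplex_def extensional_restrict)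
qed

text \<open>The graph of restriction, thickened by coboundaries as \<open>quotient_relation\<close>
  requires; on classes this is what the union in \<open>cohomology_induced\<close> amounts
  to.\<close>

definition restriction_relation where
  "restriction_relation q B = {(c, w). c \<in> cocycles sc S L q \<and> w \<in> cocycles sc B L q \<and>
     w - cut (family B q) c \<in> coboundaries sc B L q}"

lemma pullback_system_id: "pullback_system id L = L"
  by (cases L) (simp add: pullback_system_def)

lemma cohomology_induced_Image:
  assumes B: "B \<subseteq> S" and X: "X \<in> carrier (cohomology sc q S L)"
  shows "cohomology_induced sc q B id L X = restriction_relation q B `` X"
proof -
  have f: "face_closed (family S)" "face_closed (family B)" by (auto intro!: face_closed_family B)
  have XZ: "X \<subseteq> cocycles sc S L q"
  proof
    fix x assume "x \<in> X"
    then obtain z where "z \<in> cocycles sc S L q" "x - z \<in> coboundaries sc S L q"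
      using X by (auto simp: carrier_cohomology mem_coset)
    then have "x - z + z \<in> cocycles sc S L q"
      using coboundaries_cocycles[OF order_refl] by (blast intro: cochain_subspace_add[OF cocycles_subspace[OF order_refl]])
    then show "x \<in> cocycles sc S L q" by simp
  qed
  have "w \<in> cocycles sc B L q" if c: "c \<in> X" and w: "w - cut (family B q) c \<in> coboundaries sc B L q" for c w
  proof -
    have "c \<in> rel_cocycles (family S) (family {}) q" using c XZ cocycles_family[OF order_refl] by auto
    then have "cut (family B q) c \<in> rel_cocycles (family B) (family {}) q"
      using cut_in[where Q = "family B" and P = "family S", OF family_mono[OF B]] cut_rel_coboundary[OF f(2) family_mono[OF B], of q c, symmetric]
      by (auto simp: rel_cocycles_def)
    then have "w - cut (family B q) c + cut (family B q) c \<in> cocycles sc B L q"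
      using w coboundaries_cocycles[OF B, of q] cocycles_family[OF B, of q]
      by (blast intro: cochain_subspace_add[OF cocycles_subspace[OF B]])
    then show ?thesis by simp
  qed
  then show ?thesis
    using XZ unfolding cohomology_induced_def pullback_system_id module_coset pullback_cochain_id[OF B]
    by (auto simp: mem_coset restriction_relation_def)
qed

text \<open>The sequence of the pair \<open>(S, B)\<close>, with its relative term traded through
  \<open>iso\<close> for the cohomology of \<open>B'\<close> two degrees lower.\<close>

theorem long_exact_sequence:
  assumes B: "B \<subseteq> S" and B': "B' \<subseteq> S"
    and iso: "\<And>q. pairs_isomorphic (family B') (family {}) (q - 1) (family S) (family B) (q + 1)"
  shows "\<exists>r d. \<forall>q.
    cohomology_induced sc q B id L \<in> linear_maps (cohomology sc q S L) (cohomology sc q B L) \<and>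
    r q \<in> linear_maps (cohomology sc q B L) (cohomology sc (q - 1) B' L) \<and>
    d q \<in> linear_maps (cohomology sc (q - 1) B' L) (cohomology sc (q + 1) S L) \<and>
    exact_seq
      ([additive_group (cohomology sc (q + 1) B L), additive_group (cohomology sc (q + 1) S L),
        additive_group (cohomology sc (q - 1) B' L), additive_group (cohomology sc q B L),
        additive_group (cohomology sc q S L)],
       [cohomology_induced sc (q + 1) B id L, d q, r q, cohomology_induced sc q B id L])"
proof -
  let ?P = "family S" and ?Q = "family B" and ?E = "family {}"
  let ?CP = "rel_cochains ?P ?E" and ?ZP = "rel_cocycles ?P ?E" and ?NP = "rel_coboundaries ?P ?E"
  let ?ZQ = "rel_cocycles ?Q ?E" and ?NQ = "rel_coboundaries ?Q ?E"
  let ?ZR = "rel_cocycles ?P ?Q" and ?NR = "rel_coboundaries ?P ?Q"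
  have P: "face_closed ?P" and Q: "face_closed ?Q" and E: "face_closed ?E"
    using B by (auto intro!: face_closed_family)
  have QP: "\<And>q. ?Q q \<subseteq> ?P q" and EP: "\<And>q. ?E q \<subseteq> ?P q" and EQ: "\<And>q. ?E q \<subseteq> ?Q q"
    by (auto intro!: family_mono B simp: family_empty)
  note mono = rel_cochains_mono[OF P QP EQ, THEN subsetD]
  have ZS: "cocycles sc S L q = ?ZP q" and NS: "coboundaries sc S L q = ?NP q"
    and ZB: "cocycles sc B L q = ?ZQ q" and NB: "coboundaries sc B L q = ?NQ q" for q
    using B by (auto simp: cocycles_family coboundaries_family)
  let ?Z' = "\<lambda>q. cocycles sc B' L q" and ?N' = "\<lambda>q. coboundaries sc B' L q"
  note NsubZ = coboundaries_cocycles[THEN subsetD]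
  \<comment> \<open>The isomorphisms are given one degree at a time; a single choice fixes relations
    for all \<open>q\<close>, directed from relative cocycles to cocycles on
    \<open>B'\<close>.\<close>
  have "\<exists>\<Phi>. \<forall>q. linear_relation (\<Phi> q) \<and> \<Phi> q \<subseteq> ?ZR (q + 1) \<times> ?Z' (q - 1) \<and>
      (\<forall>w\<in>?ZR (q + 1). \<exists>u. (w, u) \<in> \<Phi> q) \<and> (\<forall>u\<in>?Z' (q - 1). \<exists>w. (w, u) \<in> \<Phi> q) \<and>
      (\<forall>w u. (w, u) \<in> \<Phi> q \<longrightarrow> (w \<in> ?NR (q + 1) \<longleftrightarrow> u \<in> ?N' (q - 1)))"
    using quotients_isomorphic_sym[OF iso] unfolding quotients_isomorphic_def
    by (intro choice) (simp add: cocycles_family[OF B'] coboundaries_family[OF B'])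
  then obtain \<Phi> where lin: "\<And>q. linear_relation (\<Phi> q)"
    and sub: "\<And>q w u. (w, u) \<in> \<Phi> q \<Longrightarrow> w \<in> ?ZR (q + 1) \<and> u \<in> ?Z' (q - 1)"
    and tot: "\<And>q w. w \<in> ?ZR (q + 1) \<Longrightarrow> \<exists>u. (w, u) \<in> \<Phi> q"
    and onto: "\<And>q u. u \<in> ?Z' (q - 1) \<Longrightarrow> \<exists>w. (w, u) \<in> \<Phi> q"
    and iff: "\<And>q w u. (w, u) \<in> \<Phi> q \<Longrightarrow> w \<in> ?NR (q + 1) \<longleftrightarrow> u \<in> ?N' (q - 1)"
    by (fast dest: subsetD)
  have \<Phi>0: "(0, 0) \<in> \<Phi> q" for q
  proof -
    obtain u where "(0, u) \<in> \<Phi> q"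
      using tot cochain_subspace_0[OF rel_cocycles_subspace[OF P]] by blast
    from linear_relation_diff[OF lin this this] show ?thesis by simp
  qed
  have relZ_Z: "w \<in> ?ZP q" if "w \<in> ?ZR q" for w q
    using that mono(1) by (auto simp: rel_cocycles_def)
  have relN_N: "w \<in> ?NP q" if "w \<in> ?NR q" for w q
    using that mono(1) by (auto simp: rel_coboundaries_def)
  have N0: "0 \<in> ?NP q" "0 \<in> ?NQ q" "0 \<in> ?NR q" for q
    using cochain_subspace_0[OF rel_coboundaries_subspace] P Q by auto
  note cut_d = cut_rel_coboundary[OF Q QP]
  have cut_Z: "cut (?Q q) c \<in> ?ZQ q" if "c \<in> ?ZP q" for c q
    using that cut_in[where Q = ?Q and P = ?P, OF QP] cut_d[of q c, symmetric] by (auto simp: rel_cocycles_def)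
  have cut_N: "cut (?Q q) c \<in> ?NQ q" if c: "c \<in> ?NP q" for c q
  proof -
    obtain b where "b \<in> ?CP (q - 1)" "c = rel_coboundary ?P (q - 1) b"
      using c by (auto simp: rel_coboundaries_def)
    then show ?thesis
      using cut_in[where Q = ?Q and P = ?P, OF QP, of b] cut_d[of "q - 1" b] by (auto simp: rel_coboundaries_def)
  qed
  have extend_N: "\<exists>b\<in>?CP (q - 1). cut (?Q q) (rel_coboundary ?P (q - 1) b) = w"
    if w: "w \<in> ?NQ q" for w q
  proof -
    obtain b where b: "b \<in> rel_cochains ?Q ?E (q - 1)" "w = rel_coboundary ?Q (q - 1) b"
      using w by (auto simp: rel_coboundaries_def)
    then show ?thesis
      using mono(2)[OF b(1)] cut_d[of "q - 1" b] cut_same[OF b(1)] by auto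
  qed
  have d_rel: "rel_coboundary ?P q c \<in> ?ZR (q + 1)"
    if c: "c \<in> ?CP q" and z: "cut (?Q q) c \<in> ?ZQ q" for c q
  proof -
    have "cut (?Q (q + 1)) (rel_coboundary ?P q c) = 0"
      using z unfolding cut_d rel_cocycles_def by simp
    then show ?thesis
      using cut_eq_0[where Q = ?Q and R = ?E, OF rel_coboundary_in[OF P E EP c] _ EQ] rel_coboundary_rel_coboundary[OF P c]
      by (auto simp: rel_cocycles_def)
  qed
  have d_N: "rel_coboundary ?P (q - 1) b \<in> ?NP q" if "b \<in> ?CP (q - 1)" for b q
    using that by (auto simp: rel_coboundaries_def)
  have d_C: "rel_coboundary ?P (q - 1) b \<in> ?CP q" if "b \<in> ?CP (q - 1)" for b q
    using rel_coboundary_in[OF P E EP that] by simp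
  have dd: "rel_coboundary ?P q (rel_coboundary ?P (q - 1) b) = 0" if "b \<in> ?CP (q - 1)" for b q
    using rel_coboundary_rel_coboundary[OF P that] by simp

  let ?I = "\<lambda>q. restriction_relation q B"
  \<comment> \<open>The connecting homomorphism of the pair followed by \<open>\<Phi> q\<close>,
    with every extension \<open>c\<close> of \<open>z\<close> allowed.\<close>
  define \<rho> where "\<rho> = (\<lambda>q. {(z, u). z \<in> ?ZQ q \<and>
      (\<exists>c\<in>?CP q. cut (?Q q) c = z \<and> (rel_coboundary ?P q c, u) \<in> \<Phi> q)})"
  \<comment> \<open>\<open>\<Phi> q\<close> read backwards, after which a relative cocycle counts as
    an absolute one; the condition on \<open>v - w\<close> thickens the relation by
    coboundaries.\<close>
  define \<kappa> where "\<kappa> = (\<lambda>q. {(u, v). v \<in> ?ZP (q + 1) \<and>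
      (\<exists>w. (w, u) \<in> \<Phi> q \<and> v - w \<in> ?NP (q + 1))})"

  have I: "cohomology_relation S q B q (?I q)" for q
    unfolding quotient_relation_def
  proof (intro conjI ballI allI impI)
    note ZQ = rel_cocycles_subspace[OF Q] and NQ = rel_coboundaries_subspace[OF Q]
    note ZP = rel_cocycles_subspace[OF P] and NP = rel_coboundaries_subspace[OF P]
    show "linear_relation (?I q)"
      unfolding linear_relation_def restriction_relation_def ZS NS ZB NB
    proof (intro conjI allI impI; clarify)
      fix x y x' y'
      assume "x \<in> ?ZP q" "y \<in> ?ZQ q" "y - cut (?Q q) x \<in> ?NQ q"
        "x' \<in> ?ZP q" "y' \<in> ?ZQ q" "y' - cut (?Q q) x' \<in> ?NQ q"
      then show "x + x' \<in> ?ZP q \<and> y + y' \<in> ?ZQ q \<and> y + y' - cut (?Q q) (x + x') \<in> ?NQ q"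
        using cochain_subspace_add[OF NQ, of "y - cut (?Q q) x" _ _ "y' - cut (?Q q) x'"]
        by (simp add: cochain_subspace_add[OF ZP] cochain_subspace_add[OF ZQ] cut_add algebra_simps)
    next
      fix a x y
      assume "x \<in> ?ZP q" "y \<in> ?ZQ q" "y - cut (?Q q) x \<in> ?NQ q"
      moreover have "cochain_scale a (y - cut (?Q q) x) = cochain_scale a y - cut (?Q q) (cochain_scale a x)"
        by (auto simp: cut_scale fun_eq_iff scale_right_diff_distrib)
      ultimately show "cochain_scale a x \<in> ?ZP q \<and> cochain_scale a y \<in> ?ZQ q \<and>
          cochain_scale a y - cut (?Q q) (cochain_scale a x) \<in> ?NQ q"
        using cochain_subspace_scale[OF NQ, of "y - cut (?Q q) x" _ _ a]
        by (simp add: cochain_subspace_scale[OF ZP] cochain_subspace_scale[OF ZQ])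
    qed
    show "?I q \<subseteq> cocycles sc S L q \<times> cocycles sc B L q" by (auto simp: restriction_relation_def)
    show "\<exists>y. (x, y) \<in> ?I q" if "x \<in> cocycles sc S L q" for x
      using that cut_Z N0 unfolding restriction_relation_def ZS ZB NB by (intro exI[of _ "cut (?Q q) x"]) auto
    show "y \<in> coboundaries sc B L q" if "(x, y) \<in> ?I q" "x \<in> coboundaries sc S L q" for x y
    proof -
      have "y - cut (?Q q) x + cut (?Q q) x \<in> ?NQ q"
        using that cut_N unfolding restriction_relation_def ZS ZB NB NS by (intro cochain_subspace_add[OF NQ]) auto
      then show ?thesis by (simp add: NB)
    qed
    show "(0, y) \<in> ?I q" if "y \<in> coboundaries sc B L q" for y
      using that NsubZ[OF B] cochain_subspace_0[OF ZP] unfolding restriction_relation_def ZS by auto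
  qed

  have \<rho>: "cohomology_relation B q B' (q - 1) (\<rho> q)" for q
    unfolding quotient_relation_def
  proof (intro conjI ballI allI impI)
    show "linear_relation (\<rho> q)"
      unfolding linear_relation_def \<rho>_def
    proof (intro conjI allI impI; clarify)
      fix c u c' u'
      assume c: "c \<in> ?CP q" "(rel_coboundary ?P q c, u) \<in> \<Phi> q" "cut (?Q q) c \<in> ?ZQ q"
        and c': "c' \<in> ?CP q" "(rel_coboundary ?P q c', u') \<in> \<Phi> q" "cut (?Q q) c' \<in> ?ZQ q"
      show "cut (?Q q) c + cut (?Q q) c' \<in> ?ZQ q \<and> (\<exists>d\<in>?CP q. cut (?Q q) d = cut (?Q q) c + cut (?Q q) c' \<and>
          (rel_coboundary ?P q d, u + u') \<in> \<Phi> q)"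
        using c c' rel_cochains_add[OF P c(1) c'(1)] linear_relation_add[OF lin c(2) c'(2)]
        by (auto intro!: bexI[of _ "c + c'"] simp: cut_add rel_coboundary_add[OF P c(1) c'(1)]
            cochain_subspace_add[OF rel_cocycles_subspace[OF Q]])
    next
      fix a c u
      assume c: "c \<in> ?CP q" "(rel_coboundary ?P q c, u) \<in> \<Phi> q" "cut (?Q q) c \<in> ?ZQ q"
      show "cochain_scale a (cut (?Q q) c) \<in> ?ZQ q \<and> (\<exists>d\<in>?CP q. cut (?Q q) d = cochain_scale a (cut (?Q q) c) \<and>
          (rel_coboundary ?P q d, cochain_scale a u) \<in> \<Phi> q)"
        using c rel_cochains_scale[OF P c(1)] linear_relation_scale[OF lin c(2)]
        by (auto intro!: bexI[of _ "cochain_scale a c"] simp: cut_scale rel_coboundary_scale[OF P c(1)]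
            cochain_subspace_scale[OF rel_cocycles_subspace[OF Q]])
    qed
    show "\<rho> q \<subseteq> cocycles sc B L q \<times> cocycles sc B' L (q - 1)"
      using sub by (auto simp: \<rho>_def ZB)
    show "\<exists>u. (z, u) \<in> \<rho> q" if "z \<in> cocycles sc B L q" for z
    proof -
      have z: "z \<in> rel_cochains ?Q ?E q" "z \<in> ?ZQ q" using that by (auto simp: ZB rel_cocycles_def)
      then show ?thesis
        using tot[OF d_rel[OF mono(2)[OF z(1)]]] mono(2)[OF z(1)] cut_same[OF z(1)] by (auto simp: \<rho>_def)
    qed
    show "u \<in> coboundaries sc B' L (q - 1)" if zu: "(z, u) \<in> \<rho> q" and z: "z \<in> coboundaries sc B L q" for z u
    proof -
      obtain c where c: "c \<in> ?CP q" "cut (?Q q) c = z" "(rel_coboundary ?P q c, u) \<in> \<Phi> q"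
        using zu by (auto simp: \<rho>_def)
      obtain b where b: "b \<in> ?CP (q - 1)" "cut (?Q q) (rel_coboundary ?P (q - 1) b) = z"
        using extend_N z by (auto simp: NB)
      \<comment> \<open>The corrected extension vanishes on \<open>B\<close> and has the same
        coboundary, which thus is a relative one; \<open>iff\<close> transfers this to
        \<open>u\<close>.\<close>
      let ?c = "c - rel_coboundary ?P (q - 1) b"
      have "?c \<in> rel_cochains ?P ?Q q"
        using c b by (intro cut_eq_0[where Q = ?Q and R = ?E, OF rel_cochains_diff[OF P c(1) d_C[OF b(1)]] _ EQ]) (simp add: cut_diff)
      moreover have "rel_coboundary ?P q ?c = rel_coboundary ?P q c"
        using rel_coboundary_diff[OF P c(1) d_C[OF b(1)]] dd[OF b(1)] by simp
      ultimately have "rel_coboundary ?P q c \<in> ?NR (q + 1)"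
        by (auto simp: rel_coboundaries_def intro!: image_eqI[of _ _ ?c])
      then show ?thesis using iff[OF c(3)] by simp
    qed
    show "(0, u) \<in> \<rho> q" if u: "u \<in> coboundaries sc B' L (q - 1)" for u
    proof -
      \<comment> \<open>A partner \<open>w\<close> of the coboundary \<open>u\<close> is the
        coboundary of some \<open>b\<close> that is zero on \<open>B\<close>, and this
        \<open>b\<close> is an admissible extension of \<open>0\<close>.\<close>
      obtain w where w: "(w, u) \<in> \<Phi> q" using onto NsubZ[OF B' u] by blast
      then obtain b where b: "b \<in> rel_cochains ?P ?Q q" "w = rel_coboundary ?P q b"
        using iff[OF w] u by (auto simp: rel_coboundaries_def)
      show ?thesis
        using mono(1)[OF b(1)] cut_rel[OF b(1)] b(2) w cochain_subspace_0[OF rel_cocycles_subspace[OF Q]]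
        by (auto simp: \<rho>_def)
    qed
  qed

  have \<kappa>: "cohomology_relation B' (q - 1) S (q + 1) (\<kappa> q)" for q
    unfolding quotient_relation_def
  proof (intro conjI ballI allI impI)
    note ZP = rel_cocycles_subspace[OF P] and NP = rel_coboundaries_subspace[OF P]
    show "linear_relation (\<kappa> q)"
      unfolding linear_relation_def \<kappa>_def
    proof (intro conjI allI impI; clarify)
      fix u v u' v' w w'
      assume v: "v \<in> ?ZP (q + 1)" "(w, u) \<in> \<Phi> q" "v - w \<in> ?NP (q + 1)"
        and v': "v' \<in> ?ZP (q + 1)" "(w', u') \<in> \<Phi> q" "v' - w' \<in> ?NP (q + 1)"
      have "v + v' - (w + w') \<in> ?NP (q + 1)"
        using cochain_subspace_add[OF NP v(3) v'(3)] by (simp add: algebra_simps)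
      then show "v + v' \<in> ?ZP (q + 1) \<and> (\<exists>w. (w, u + u') \<in> \<Phi> q \<and> v + v' - w \<in> ?NP (q + 1))"
        using linear_relation_add[OF lin v(2) v'(2)] cochain_subspace_add[OF ZP v(1) v'(1)] by auto
    next
      fix a u v w
      assume v: "v \<in> ?ZP (q + 1)" "(w, u) \<in> \<Phi> q" "v - w \<in> ?NP (q + 1)"
      have "cochain_scale a (v - w) = cochain_scale a v - cochain_scale a w"
        by (auto simp: fun_eq_iff scale_right_diff_distrib)
      then show "cochain_scale a v \<in> ?ZP (q + 1) \<and>
          (\<exists>w. (w, cochain_scale a u) \<in> \<Phi> q \<and> cochain_scale a v - w \<in> ?NP (q + 1))"
        using linear_relation_scale[OF lin v(2), of a] cochain_subspace_scale[OF ZP v(1)] cochain_subspace_scale[OF NP v(3), of a]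
        by metis
    qed
    show "\<kappa> q \<subseteq> cocycles sc B' L (q - 1) \<times> cocycles sc S L (q + 1)"
      using sub by (auto simp: \<kappa>_def ZS)
    show "\<exists>v. (u, v) \<in> \<kappa> q" if u: "u \<in> cocycles sc B' L (q - 1)" for u
    proof -
      obtain w where "(w, u) \<in> \<Phi> q" using onto[OF u] by blast
      then show ?thesis using sub relZ_Z N0(1) by (intro exI[of _ w]) (auto simp: \<kappa>_def intro!: exI[of _ w])
    qed
    show "v \<in> coboundaries sc S L (q + 1)" if uv: "(u, v) \<in> \<kappa> q" and u: "u \<in> coboundaries sc B' L (q - 1)" for u v
    proof -
      obtain w where w: "(w, u) \<in> \<Phi> q" "v - w \<in> ?NP (q + 1)" using uv by (auto simp: \<kappa>_def)
      have "v - w + w \<in> ?NP (q + 1)"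
        using iff[OF w(1)] u by (intro cochain_subspace_add[OF NP w(2)] relN_N) simp
      then show ?thesis by (simp add: NS)
    qed
    show "(0, v) \<in> \<kappa> q" if "v \<in> coboundaries sc S L (q + 1)" for v
      using that \<Phi>0 NsubZ[OF order_refl that] unfolding \<kappa>_def NS ZS by (auto intro!: exI[of _ 0])
  qed

  \<comment> \<open>Exactness at the cohomology of \<open>B\<close>: up to coboundaries, a cocycle
    extends to a cocycle on \<open>S\<close> precisely when its connecting class vanishes.\<close>
  have exact1: "(\<exists>c. (c, z) \<in> ?I q) \<longleftrightarrow> (\<exists>u\<in>?N' (q - 1). (z, u) \<in> \<rho> q)" if z: "z \<in> cocycles sc B L q" for q z
  proof
    assume "\<exists>c. (c, z) \<in> ?I q"
    then obtain c where c: "c \<in> ?ZP q" "z - cut (?Q q) c \<in> ?NQ q"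
      by (auto simp: restriction_relation_def ZS NB)
    then obtain b where b: "b \<in> ?CP (q - 1)" "cut (?Q q) (rel_coboundary ?P (q - 1) b) = z - cut (?Q q) c"
      using extend_N by blast
    have c': "c \<in> ?CP q" "rel_coboundary ?P q c = 0" using c by (auto simp: rel_cocycles_def)
    have "rel_coboundary ?P q (c + rel_coboundary ?P (q - 1) b) = 0"
      using rel_coboundary_add[OF P c'(1) d_C[OF b(1)]] dd[OF b(1)] c' by simp
    moreover have "cut (?Q q) (c + rel_coboundary ?P (q - 1) b) = z" using b by (simp add: cut_add)
    ultimately have "(z, 0) \<in> \<rho> q"
      using rel_cochains_add[OF P c'(1) d_C[OF b(1)]] \<Phi>0[of q] z
      by (auto simp: \<rho>_def ZB intro!: bexI[of _ "c + rel_coboundary ?P (q - 1) b"])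
    then show "\<exists>u\<in>?N' (q - 1). (z, u) \<in> \<rho> q"
      using cochain_subspace_0[OF coboundaries_subspace[OF B']] by blast
  next
    assume "\<exists>u\<in>?N' (q - 1). (z, u) \<in> \<rho> q"
    then obtain u c where u: "u \<in> ?N' (q - 1)" and c: "c \<in> ?CP q" "cut (?Q q) c = z" "(rel_coboundary ?P q c, u) \<in> \<Phi> q"
      by (auto simp: \<rho>_def)
    \<comment> \<open>Subtracting \<open>b\<close>, which vanishes on \<open>B\<close>, turns the
      extension into a cocycle without changing its restriction.\<close>
    obtain b where b: "b \<in> rel_cochains ?P ?Q q" "rel_coboundary ?P q c = rel_coboundary ?P q b"
      using iff[OF c(3)] u by (auto simp: rel_coboundaries_def)
    have "c - b \<in> ?ZP q"
      using rel_cochains_diff[OF P c(1) mono(1)[OF b(1)]] rel_coboundary_diff[OF P c(1) b(1)] b(2) by (simp add: rel_cocycles_def)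
    moreover have "cut (?Q q) (c - b) = z" using c b cut_rel[OF b(1)] by (simp add: cut_diff)
    ultimately show "\<exists>c. (c, z) \<in> ?I q"
      using z N0 by (intro exI[of _ "c - b"]) (simp add: restriction_relation_def ZS NB)
  qed

  \<comment> \<open>Exactness at the cohomology of \<open>B'\<close>: a relative cocycle is trivial
    as an absolute class precisely when it is the coboundary of a cochain on \<open>S\<close>, whose
    restriction to \<open>B\<close> is then a cocycle.\<close>
  have exact2: "(\<exists>z. (z, u) \<in> \<rho> q) \<longleftrightarrow> (\<exists>v\<in>coboundaries sc S L (q + 1). (u, v) \<in> \<kappa> q)" if u: "u \<in> ?Z' (q - 1)" for q u
  proof
    assume "\<exists>z. (z, u) \<in> \<rho> q"
    then obtain c where c: "c \<in> ?CP q" "(rel_coboundary ?P q c, u) \<in> \<Phi> q" by (auto simp: \<rho>_def)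
    have "rel_coboundary ?P q c \<in> ?NP (q + 1)" using c by (auto simp: rel_coboundaries_def)
    moreover from this have "(u, rel_coboundary ?P q c) \<in> \<kappa> q"
      using c sub[OF c(2)] relZ_Z N0(1) by (auto simp: \<kappa>_def intro!: exI[of _ "rel_coboundary ?P q c"])
    ultimately show "\<exists>v\<in>coboundaries sc S L (q + 1). (u, v) \<in> \<kappa> q" by (auto simp: NS)
  next
    assume "\<exists>v\<in>coboundaries sc S L (q + 1). (u, v) \<in> \<kappa> q"
    then obtain v w where v: "v \<in> ?NP (q + 1)" and w: "(w, u) \<in> \<Phi> q" "v - w \<in> ?NP (q + 1)"
      by (auto simp: \<kappa>_def NS)
    have "v - (v - w) \<in> ?NP (q + 1)"
      by (rule cochain_subspace_diff[OF rel_coboundaries_subspace[OF P] v w(2)])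
    then obtain c where c: "c \<in> ?CP q" "w = rel_coboundary ?P q c"
      by (auto simp: rel_coboundaries_def)
    have "w \<in> rel_cochains ?P ?Q (q + 1)" using sub[OF w(1)] by (auto simp: rel_cocycles_def)
    then have "rel_coboundary ?Q q (cut (?Q q) c) = 0"
      using cut_d[of q c] cut_rel c by metis
    then have "(cut (?Q q) c, u) \<in> \<rho> q"
      using c w cut_in[where Q = ?Q and P = ?P, OF QP c(1)] by (auto simp: \<rho>_def rel_cocycles_def)
    then show "\<exists>z. (z, u) \<in> \<rho> q" by blast
  qed

  \<comment> \<open>Exactness at the cohomology of \<open>S\<close> in degree \<open>q + 1\<close>:
    a cocycle whose restriction to \<open>B\<close> is a coboundary can be changed by a coboundary
    so that it vanishes on \<open>B\<close>.\<close>
  have exact3: "(\<exists>u. (u, v) \<in> \<kappa> q) \<longleftrightarrow> (\<exists>y\<in>coboundaries sc B L (q + 1). (v, y) \<in> ?I (q + 1))"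
    if v: "v \<in> cocycles sc S L (q + 1)" for q v
  proof
    assume "\<exists>u. (u, v) \<in> \<kappa> q"
    then obtain u w where w: "(w, u) \<in> \<Phi> q" "v - w \<in> ?NP (q + 1)" by (auto simp: \<kappa>_def)
    have "w \<in> rel_cochains ?P ?Q (q + 1)" using sub[OF w(1)] by (auto simp: rel_cocycles_def)
    then have "cut (?Q (q + 1)) v = cut (?Q (q + 1)) (v - w)" using cut_rel by (simp add: cut_diff)
    also have "\<dots> \<in> ?NQ (q + 1)" by (rule cut_N[OF w(2)])
    finally show "\<exists>y\<in>coboundaries sc B L (q + 1). (v, y) \<in> ?I (q + 1)"
      using v N0(2) NsubZ[OF B, of _ "q + 1"]
      by (intro bexI[of _ "cut (?Q (q + 1)) v"]) (auto simp: restriction_relation_def NB)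
  next
    assume "\<exists>y\<in>coboundaries sc B L (q + 1). (v, y) \<in> ?I (q + 1)"
    then obtain y where y: "y \<in> ?NQ (q + 1)" "y - cut (?Q (q + 1)) v \<in> ?NQ (q + 1)"
      by (auto simp: restriction_relation_def NB)
    have "y - (y - cut (?Q (q + 1)) v) \<in> ?NQ (q + 1)"
      by (rule cochain_subspace_diff[OF rel_coboundaries_subspace[OF Q] y])
    then have "cut (?Q (q + 1)) v \<in> ?NQ (q + 1)" by simp
    from extend_N[OF this] obtain b where b: "b \<in> ?CP q" "cut (?Q (q + 1)) (rel_coboundary ?P q b) = cut (?Q (q + 1)) v"
      by auto
    have v': "v \<in> ?CP (q + 1)" "rel_coboundary ?P (q + 1) v = 0" using v by (auto simp: ZS rel_cocycles_def)
    note db = rel_coboundary_in[OF P E EP b(1)]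
    let ?w = "v - rel_coboundary ?P q b"
    have "?w \<in> rel_cochains ?P ?Q (q + 1)"
      using b by (intro cut_eq_0[where Q = ?Q and R = ?E, OF rel_cochains_diff[OF P v'(1) db] _ EQ]) (simp add: cut_diff)
    moreover have "rel_coboundary ?P (q + 1) ?w = 0"
      using rel_coboundary_diff[OF P v'(1) db] rel_coboundary_rel_coboundary[OF P b(1)] v'(2) by simp
    ultimately obtain u where u: "(?w, u) \<in> \<Phi> q" using tot[of ?w q] by (auto simp: rel_cocycles_def)
    have "v - ?w \<in> ?NP (q + 1)" using b by (auto simp: rel_coboundaries_def)
    then have "(u, v) \<in> \<kappa> q" using u v unfolding \<kappa>_def ZS by blast
    then show "\<exists>u. (u, v) \<in> \<kappa> q" by blast
  qed

  let ?r = "\<lambda>q X. \<rho> q `` X" and ?d = "\<lambda>q X. \<kappa> q `` X"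
  note Iind = cohomology_induced_Image[OF B]
  have lI: "cohomology_induced sc q B id L \<in> linear_maps (cohomology sc q S L) (cohomology sc q B L)" for q
    by (rule relation_linear_map[OF order_refl B I Iind])
  have lr: "?r q \<in> linear_maps (cohomology sc q B L) (cohomology sc (q - 1) B' L)" for q
    by (rule relation_linear_map[OF B B' \<rho> refl])
  have ld: "?d q \<in> linear_maps (cohomology sc (q - 1) B' L) (cohomology sc (q + 1) S L)" for q
    by (rule relation_linear_map[OF B' order_refl \<kappa> refl])
  show ?thesis
  proof (rule exI[of _ ?r], rule exI[of _ ?d], intro allI conjI lI lr ld)
    fix q
    note g = group_cohomology[OF order_refl] group_cohomology[OF B] group_cohomology[OF B']
    show "exact_seq
      ([additive_group (cohomology sc (q + 1) B L), additive_group (cohomology sc (q + 1) S L),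
        additive_group (cohomology sc (q - 1) B' L), additive_group (cohomology sc q B L),
        additive_group (cohomology sc q S L)],
       [cohomology_induced sc (q + 1) B id L, ?d q, ?r q, cohomology_induced sc q B id L])"
      using lI[of q] lI[of "q + 1"] lr[of q] ld[of q]
        relation_exact[OF order_refl B B' I \<rho> Iind refl exact1, of q]
        relation_exact[OF B B' order_refl \<rho> \<kappa> refl refl exact2, of q]
        relation_exact[OF B' order_refl B \<kappa> I refl Iind exact3, of q]
      by (simp add: g group_hom_def group_hom_axioms_def linear_maps_def)
  qed
qed

end

theorem theorem4:
  fixes H :: "(complex ^ 'n) set"
    and \<A> \<A>' \<A>'' :: "(complex ^ 'n) set set"
    and M M' M'' :: "(complex ^ 'n) set"
    and sc :: "complex \<Rightarrow> 'v::ab_group_add \<Rightarrow> 'v"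
    and \<L> \<L>' \<L>'' :: "(complex ^ 'n, 'v) local_system"
  assumes "arrangement_triple H \<A> \<A>' \<A>''"
    and "M = complement_in UNIV \<A>"
    and "M' = complement_in UNIV \<A>'"
    and "M'' = complement_in H \<A>''"
    and "vector_space sc"
    and "rank_one_local_system sc M' \<L>'"
    and "\<L> = pullback_system id \<L>'"
    and "\<L>'' = pullback_system id \<L>'"
  shows "\<exists>r d. \<forall>q::int.
    cohomology_induced sc q M id \<L>'
      \<in> linear_maps (cohomology sc q M' \<L>') (cohomology sc q M \<L>) \<and>
    r q \<in> linear_maps (cohomology sc q M \<L>) (cohomology sc (q - 1) M'' \<L>'') \<and>
    d q \<in> linear_maps (cohomology sc (q - 1) M'' \<L>'') (cohomology sc (q + 1) M' \<L>') \<and>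
    exact_seq
      ([additive_group (cohomology sc (q + 1) M \<L>),
        additive_group (cohomology sc (q + 1) M' \<L>'),
        additive_group (cohomology sc (q - 1) M'' \<L>''),
        additive_group (cohomology sc q M \<L>),
        additive_group (cohomology sc q M' \<L>')],
       [cohomology_induced sc (q + 1) M id \<L>', d q, r q, cohomology_induced sc q M id \<L>'])"
proof -
  let ?form = "\<lambda>a x :: complex ^ 'n. \<Sum>i\<in>UNIV. a $ i * x $ i"
  have hyp: "\<And>K. K \<in> \<A> \<Longrightarrow> complex_hyperplane K" and fin: "finite \<A>'" and HA: "H \<in> \<A>" "\<A>' = \<A> - {H}"
    and A'': "\<A>'' = {K \<inter> H | K. K \<in> \<A>' \<and> K \<inter> H \<noteq> {}}"
    using assms(1) by (auto simp: arrangement_triple_def hyperplane_arrangement_def)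
  have cont: "continuous_on UNIV (?form a)" for a
    by (intro continuous_intros)
  have "closed K" if K: "K \<in> \<A>'" for K
  proof -
    obtain a b where "K = {x. ?form a x = b}"
      using hyp[of K] K HA by (auto simp: complex_hyperplane_def)
    then show ?thesis using cont by (auto intro!: closed_Collect_eq continuous_intros)
  qed
  then have open_M': "open M'"
    unfolding assms(3) complement_in_def using fin by (intro open_Diff open_UNIV closed_Union) auto
  obtain a b where a: "a \<noteq> 0" and H: "H = {x. ?form a x = b}"
    using hyp[OF HA(1)] by (auto simp: complex_hyperplane_def)
  obtain k where k: "a $ k \<noteq> 0" using a by (auto simp: vec_eq_iff)
  define f where "f = (\<lambda>x. ?form a x - b)"
  \<comment> \<open>The \<open>k\<close>-th axis is transversal to \<open>H\<close> because
    \<open>a $ k\<close> is nonzero; dividing by it makes \<open>f\<close> the fibre coordinate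
    along this axis.\<close>
  define E where "E = (\<lambda>z. axis k (z / a $ k) :: complex ^ 'n)"
  \<comment> \<open>\<open>linear\<close> refers to real scalars, so real scaling has to be moved
    through a complex quotient.\<close>
  have scaleR_divide: "r *\<^sub>R z / w = r *\<^sub>R (z / w)" for r and z w :: complex
    by (simp add: scaleR_conv_of_real)
  have "linear E"
    by (rule linearI) (auto simp: E_def axis_def vec_eq_iff add_divide_distrib scaleR_divide)
  then have linear_E: "bounded_linear E" by (simp add: linear_conv_bounded_linear)
  have "?form a (E z) = z" for z
    using k by (simp add: E_def axis_def if_distrib[of "\<lambda>x. _ * x"] sum.delta cong: if_cong)
  then have f_E: "f (x + E z) = f x + z" for x z
    by (simp add: f_def distrib_left sum.distrib)
  have cont_f: "continuous_on UNIV f"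
    unfolding f_def by (intro continuous_intros cont)
  have "coefficient_system sc M' \<L>'"
    using assms(5,6) by (auto simp: coefficient_system_def coefficient_system_axioms_def rank_one_local_system_def)
  then interpret transversal_line sc M' \<L>' f E
    by (intro transversal_line.intro transversal_line_axioms.intro open_M' cont_f linear_E f_E)
  have M: "M = {x \<in> M'. f x \<noteq> 0}"
    using HA by (auto simp: assms(2,3) complement_in_def f_def H)
  \<comment> \<open>Leaving the empty intersections out of \<open>\<A>''\<close> does not change the
    complement in \<open>H\<close>.\<close>
  have M'': "M'' = {x \<in> M'. f x = 0}"
    by (auto simp: assms(3,4) complement_in_def f_def H A'')
  \<comment> \<open>Pulling back along \<open>id\<close> returns the same record, so one coefficient
    system serves all three spaces.\<close>
  have L: "\<L> = \<L>'" "\<L>'' = \<L>'" using assms(7,8) pullback_system_id by auto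
  show ?thesis
    unfolding L
    by (rule long_exact_sequence) (use thom_isomorphism in \<open>auto simp: M M''\<close>)
qed

end
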